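(* Let $f:\mathbb{R}^d\to\mathbb{R}$ be $L_1$-smooth and have $L_2$-Lipschitz continuous Hessian, let $x_1\in\mathbb{R}^d$, and let $\Delta_f>0$ satisfy $f(x_1)-\inf_{x}f(x)\le\Delta_f<\infty$. Let $\epsilon>0$, let $$\alpha=\min\left\{L_1,\ \max\left\{\epsilon^2\Delta_f^{-1},\ \epsilon^{1/2}L_2^{1/2}\right\}\right\},$$ and let $\delta\in(0,1)$. Then with probability at least $1-\delta$, the procedure $\mathrm{ANCM}(x_1,f,\epsilon,L_1,L_2,\alpha,\Delta_f,\delta)$ (defined in the context) returns a point $x$ that satisfies $$\|\nabla f(x)\|\le\epsilon\quad\text{and}\quad\lambda_{\min}(\nabla^2f(x))\ge-2\,\epsilon^{1/2}L_2^{1/2}$$ in time $$O\left(\mathsf{T}_{\rm grad}\left(\Delta_fL_1^{1/2}L_2^{1/4}\epsilon^{-7/4}+\Delta_f^{1/2}L_1^{1/2}\epsilon^{-1}+1\right)\log\tau\right),$$ where $\tau=1+1/\epsilon+1/\delta+d+L_1+L_2+\Delta_f$.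
   Context: Notation. $\|\cdot\|$ is the Euclidean norm on vectors and the $\ell_2$-operator norm on matrices; $\log$ is the natural logarithm; $\lambda_{\min}(A)$ is the smallest eigenvalue of a symmetric matrix $A$; $[t]_+=\max\{t,0\}$. $L_1,L_2>0$ are constants. $f$ is $L_1$-smooth if $\|\nabla f(x)-\nabla f(y)\|\le L_1\|x-y\|$ for all $x,y$. A twice differentiable $f$ has $L_2$-Lipschitz continuous Hessian if $\|\nabla^2f(x)-\nabla^2f(y)\|\le L_2\|x-y\|$ for all $x,y$. $M_1=O(M_2)$ means $M_1\le C\,M_2$ with a universal constant $C$ independent of all parameters $(\epsilon,\delta,L_1,L_2,\Delta_f,d)$ and of the problem instance. Cost model (exact real arithmetic). Each of the following takes time $O(\mathsf{T}_{\rm grad})$: evaluating $\nabla f(x)$; evaluating a Hessian-vector product $\nabla^2f(x)v$; an arithmetic operation (addition, subtraction, multiplication) on two vectors of dimension at most $d$. Eigenvector subroutine (an available primitive, e.g. the Lanczos method). For an $L_1$-smooth twice differentiable $f$, a point $x$, accuracy $\varepsilon>0$ and $\delta\in(0,1)$, there is a randomized procedure that returns a unit vector $v$ which, with probability at least $1-\delta$, satisfies $\lambda_{\min}(\nabla^2f(x))\ge v^T\nabla^2f(x)v-\varepsilon$, in time $O(\mathsf{T}_{\rm grad}(1+\log(d/\delta)\sqrt{L_1/\varepsilon}))$. Procedure $\mathrm{AGD}(g,y_1,\epsilon,L,\sigma)$: set $\kappa=L/\sigma$, $z_1=y_1$. For $j=1,2,\dots$: if $\|\nabla g(y_j)\|\le\epsilon$,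 return $y_j$; otherwise set $y_{j+1}=z_j-\frac1L\nabla g(z_j)$ and $z_{j+1}=\left(1+\frac{\sqrt\kappa-1}{\sqrt\kappa+1}\right)y_{j+1}-\frac{\sqrt\kappa-1}{\sqrt\kappa+1}y_j$. Procedure $\mathrm{ACAGD}(h,z_1,\epsilon,\gamma,L)$: for $j=1,2,\dots$: if $\|\nabla h(z_j)\|\le\epsilon$, return $z_j$; otherwise let $g_j(z)=h(z)+\gamma\|z-z_j\|^2$, $\epsilon'=\epsilon\sqrt{\gamma/(50(L+2\gamma))}$, and $z_{j+1}=\mathrm{AGD}(g_j,z_j,\epsilon',L+2\gamma,\gamma)$. Procedure $\mathrm{NCD}(z_1,f,L_2,\alpha,\Delta_f,\delta)$: set $\delta'=\delta/(1+12L_2^2\Delta_f/\alpha^3)$. For $j=1,2,\dots$: using the eigenvector subroutine, find $v_j$ with $\|v_j\|=1$ such that, with probability at least $1-\delta'$, $\lambda_{\min}(\nabla^2f(z_j))\ge v_j^T\nabla^2f(z_j)v_j-\alpha/2$. If $v_j^T\nabla^2f(z_j)v_j\le-\alpha/2$, set $z_{j+1}=z_j-\frac{2|v_j^T\nabla^2f(z_j)v_j|}{L_2}\,\mathrm{sign}(v_j^T\nabla f(z_j))\,v_j$; otherwise return $z_j$. Procedure $\mathrm{ANCM}(x_1,f,\epsilon,L_1,L_2,\alpha,\Delta_f,\delta)$: set $K=\lceil1+\Delta_f(12L_2^2/\alpha^3+\sqrt{10}L_2/(\alpha\epsilon))\rceil$ and $\delta''=\delta/K$. For $k=1,2,\dots$: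 if $\alpha<L_1$ set $\hat x_k=\mathrm{NCD}(x_k,f,L_2,\alpha,\Delta_f,\delta'')$, else set $\hat x_k=x_k$; if $\|\nabla f(\hat x_k)\|\le\epsilon$, return $\hat x_k$; otherwise set $f_k(x)=f(x)+L_1\left([\|x-\hat x_k\|-\alpha/L_2]_+\right)^2$ and $x_{k+1}=\mathrm{ACAGD}(f_k,\hat x_k,\epsilon/2,3\alpha,5L_1)$. *)

theory Defs
  imports "HOL-Probability.Probability" "HOL-Library.Monad_Syntax"
begin

section \<open>Euclidean spaces of all finite dimensions inside one type\<close>

text \<open>
  The constant hidden in the O-notation must not depend on the dimension \<open>d\<close>, so \<open>d\<close> has to be a
  term and cannot be encoded in a type as in \<open>real ^ 'n\<close>. We therefore use the inner product space
  \<open>rvec\<close> of finitely supported real sequences, and \<open>Rn d\<close>, the subspace of sequences vanishing from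
  index \<open>d\<close> on, is the Euclidean space of dimension \<open>d\<close>.
\<close>

typedef rvec = "{x :: nat \<Rightarrow> real. finite {i. x i \<noteq> 0}}"
  morphisms coord Abs_rvec
  by (rule exI[of _ "\<lambda>_. 0"]) simp

setup_lifting type_definition_rvec

lemma finite_coord [simp]: "finite {i. coord x i \<noteq> 0}"
  using coord[of x] by simp

lemma rvec_eqI: "(\<And>i. coord x i = coord y i) \<Longrightarrow> x = y"
  by (metis coord_inject ext)

instantiation rvec :: real_vector
begin

lift_definition zero_rvec :: rvec is "\<lambda>_. 0" by simp

lift_definition plus_rvec :: "rvec \<Rightarrow> rvec \<Rightarrow> rvec" is "\<lambda>x y i. x i + y i"
proof -
  fix x y :: "nat \<Rightarrow> real"
  assume "finite {i. x i \<noteq> 0}" "finite {i. y i \<noteq> 0}"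
  then have "finite ({i. x i \<noteq> 0} \<union> {i. y i \<noteq> 0})" by simp
  then show "finite {i. x i + y i \<noteq> 0}" by (rule rev_finite_subset) auto
qed

lift_definition uminus_rvec :: "rvec \<Rightarrow> rvec" is "\<lambda>x i. - x i" by simp

lift_definition minus_rvec :: "rvec \<Rightarrow> rvec \<Rightarrow> rvec" is "\<lambda>x y i. x i - y i"
proof -
  fix x y :: "nat \<Rightarrow> real"
  assume "finite {i. x i \<noteq> 0}" "finite {i. y i \<noteq> 0}"
  then have "finite ({i. x i \<noteq> 0} \<union> {i. y i \<noteq> 0})" by simp
  then show "finite {i. x i - y i \<noteq> 0}" by (rule rev_finite_subset) auto
qed

lift_definition scaleR_rvec :: "real \<Rightarrow> rvec \<Rightarrow> rvec" is "\<lambda>c x i. c * x i"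
  by (erule rev_finite_subset) auto

instance
  by standard (transfer; simp add: fun_eq_iff algebra_simps)+

end

instantiation rvec :: real_inner
begin

definition inner_rvec :: "rvec \<Rightarrow> rvec \<Rightarrow> real" where
  "inner_rvec x y = (\<Sum>i | coord x i \<noteq> 0. coord x i * coord y i)"

definition norm_rvec :: "rvec \<Rightarrow> real" where
  "norm_rvec x = sqrt (inner x x)"

definition sgn_rvec :: "rvec \<Rightarrow> rvec" where
  "sgn_rvec x = x /\<^sub>R norm x"

definition dist_rvec :: "rvec \<Rightarrow> rvec \<Rightarrow> real" where
  "dist_rvec x y = norm (x - y)"

definition uniformity_rvec :: "(rvec \<times> rvec) filter" where
  "uniformity_rvec = (INF e\<in>{0 <..}. principal {(x, y). dist x y < e})"

definition open_rvec :: "rvec set \<Rightarrow> bool" where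
  "open_rvec S = (\<forall>x\<in>S. \<forall>\<^sub>F (x', y) in uniformity. x' = x \<longrightarrow> y \<in> S)"

lemma inner_rvec_superset:
  assumes "finite A" "{i. coord x i \<noteq> 0} \<subseteq> A"
  shows "inner x y = (\<Sum>i\<in>A. coord x i * coord y i)"
  unfolding inner_rvec_def
  by (rule sum.mono_neutral_left) (use assms in auto)

instance
proof
  fix x y z :: rvec and r :: real
  let ?S = "\<lambda>x. {i. coord x i \<noteq> 0}"
  show "inner x y = inner y x"
    by (simp add: inner_rvec_superset[of "?S x \<union> ?S y"] mult.commute)
  show "inner (x + y) z = inner x z + inner y z"
  proof -
    have "?S (x + y) \<subseteq> ?S x \<union> ?S y" by (auto simp: plus_rvec.rep_eq)
    then show ?thesis
      by (simp add: inner_rvec_superset[of "?S x \<union> ?S y"] plus_rvec.rep_eq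
          sum.distrib distrib_right)
  qed
  show "inner (scaleR r x) y = r * inner x y"
  proof -
    have "?S (scaleR r x) \<subseteq> ?S x" by (auto simp: scaleR_rvec.rep_eq)
    then show ?thesis
      by (simp add: inner_rvec_superset[of "?S x"] scaleR_rvec.rep_eq sum_distrib_left mult.assoc)
  qed
  show "0 \<le> inner x x"
    by (simp add: inner_rvec_def sum_nonneg)
  show "inner x x = 0 \<longleftrightarrow> x = 0"
  proof
    assume "inner x x = 0"
    then have "\<forall>i\<in>?S x. coord x i * coord x i = 0"
      unfolding inner_rvec_def by (subst (asm) sum_nonneg_eq_0_iff) auto
    then show "x = 0"
      by (intro rvec_eqI) (auto simp: zero_rvec.rep_eq)
  qed (simp add: inner_rvec_def zero_rvec.rep_eq)
qed (simp_all add: norm_rvec_def sgn_rvec_def dist_rvec_def uniformity_rvec_def open_rvec_def)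

end

definition Rn :: "nat \<Rightarrow> rvec set" where
  "Rn d = {x. \<forall>i\<ge>d. coord x i = 0}"

lift_definition trunc :: "nat \<Rightarrow> rvec \<Rightarrow> rvec" is "\<lambda>d x i. if i < d then x i else 0"
  by (erule rev_finite_subset) auto

text \<open>
  A function on \<open>Rn d\<close> is represented by its extension to \<open>rvec\<close> that is constant in the remaining
  coordinates. At points of \<open>Rn d\<close> the gradient of this extension is the gradient on \<open>Rn d\<close>, and
  its Hessian is the Hessian on \<open>Rn d\<close> extended by 0 on the orthogonal complement. Hence the infimum,
  the Lipschitz constants and the operator norms below are those on \<open>Rn d\<close>.
\<close>

definition function_on_Rn :: "nat \<Rightarrow> (rvec \<Rightarrow> real) \<Rightarrow> bool" where
  "function_on_Rn d f \<longleftrightarrow> (\<forall>x. f (trunc d x) = f x)"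


section \<open>Smoothness\<close>

definition grad :: "('a::real_inner \<Rightarrow> real) \<Rightarrow> 'a \<Rightarrow> 'a" where
  "grad f x = (THE D. GDERIV f x :> D)"

definition hess :: "('a::real_inner \<Rightarrow> real) \<Rightarrow> 'a \<Rightarrow> 'a \<Rightarrow> 'a" where
  "hess f x = frechet_derivative (grad f) (at x)"

definition smooth :: "real \<Rightarrow> ('a::real_inner \<Rightarrow> real) \<Rightarrow> bool" where
  "smooth L f \<longleftrightarrow> (\<forall>x. GDERIV f x :> grad f x) \<and>
     (\<forall>x y. norm (grad f x - grad f y) \<le> L * norm (x - y))"

definition lipschitz_hessian :: "real \<Rightarrow> ('a::real_inner \<Rightarrow> real) \<Rightarrow> bool" where
  "lipschitz_hessian L f \<longleftrightarrow>
     (\<forall>x. GDERIV f x :> grad f x) \<and> (\<forall>x. grad f differentiable (at x)) \<and>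
     (\<forall>x y. onorm (\<lambda>v. hess f x v - hess f y v) \<le> L * norm (x - y))"

text \<open>The smallest eigenvalue of a symmetric operator \<open>A\<close> on \<open>Rn d\<close>, for \<open>d \<ge> 1\<close>.\<close>

definition lambda_min :: "nat \<Rightarrow> (rvec \<Rightarrow> rvec) \<Rightarrow> real" where
  "lambda_min d A = (LEAST l. \<exists>v\<in>Rn d. v \<noteq> 0 \<and> A v = l *\<^sub>R v)"


section \<open>Cost model and eigenvector subroutine\<close>

text \<open>
  \<open>t_grad\<close>, \<open>t_hvp\<close> and \<open>t_arith\<close> are the times of one gradient evaluation of \<open>f\<close>, of one
  Hessian-vector product and of one arithmetic operation on vectors. Inner products, products of a
  scalar and a vector, and operations on scalars (including division, square root and comparison)
  are also charged \<open>t_arith\<close>; the norm of a vector is an inner product and a square root.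
\<close>

record costs =
  t_grad :: real
  t_hvp :: real
  t_arith :: real

definition costs_bounded :: "real \<Rightarrow> costs \<Rightarrow> bool" where
  "costs_bounded B C \<longleftrightarrow> t_grad C \<in> {0..B} \<and> t_hvp C \<in> {0..B} \<and> t_arith C \<in> {0..B}"

text \<open>
  A randomized subroutine is a function of its inputs and of a random seed, and each call uses a
  fresh seed, drawn with law \<open>seed_law\<close> independently of the earlier ones. The arguments of
  \<open>eig_vec\<close> and \<open>eig_time\<close> are the accuracy, the failure probability, the point and the seed.
\<close>

record eig_routine =
  seed_law :: "real measure"
  eig_vec :: "real \<Rightarrow> real \<Rightarrow> rvec \<Rightarrow> real \<Rightarrow> rvec"
  eig_time :: "real \<Rightarrow> real \<Rightarrow> rvec \<Rightarrow> real \<Rightarrow> real"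

definition eigenvector_subroutine ::
  "real \<Rightarrow> nat \<Rightarrow> real \<Rightarrow> (rvec \<Rightarrow> real) \<Rightarrow> eig_routine \<Rightarrow> bool" where
  "eigenvector_subroutine B d L f E \<longleftrightarrow>
     prob_space (seed_law E) \<and> sets (seed_law E) = sets borel \<and>
     (\<forall>a \<delta>. 0 < a \<and> 0 < \<delta> \<and> \<delta> < 1 \<longrightarrow>
        (\<lambda>(x, s). eig_vec E a \<delta> x s)
           \<in> borel_measurable (restrict_space borel (Rn d) \<Otimes>\<^sub>M seed_law E) \<and>
        (\<forall>x\<in>Rn d.
           (\<forall>s. eig_vec E a \<delta> x s \<in> Rn d \<and> norm (eig_vec E a \<delta> x s) = 1 \<and>
                0 \<le> eig_time E a \<delta> x s \<and>
                eig_time E a \<delta> x s \<le> B * (1 + ln (d / \<delta>) * sqrt (L / a))) \<and>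
           \<P>(s in seed_law E. lambda_min d (hess f x) \<ge>
               eig_vec E a \<delta> x s \<bullet> hess f x (eig_vec E a \<delta> x s) - a) \<ge> 1 - \<delta>))"


section \<open>The procedures\<close>

text \<open>
  A run is \<open>None\<close> if it does not terminate. The argument \<open>t\<close> is the time spent so far, \<open>V\<close> is
  \<open>t_arith\<close>, and \<open>G\<close> is the time of one gradient evaluation of the function being minimized.
\<close>

partial_function (option) agd_loop ::
  "(rvec \<Rightarrow> real) \<Rightarrow> real \<Rightarrow> real \<Rightarrow> real \<Rightarrow> real \<Rightarrow> real \<Rightarrow> rvec \<Rightarrow> rvec \<Rightarrow> real \<Rightarrow> (rvec \<times> real) option"
where
  "agd_loop g G V \<epsilon> L \<kappa> y z t =
     (if norm (grad g y) \<le> \<epsilon> then Some (y, t + G + 3 * V)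
      else let m = (sqrt \<kappa> - 1) / (sqrt \<kappa> + 1);
               y' = z - (1 / L) *\<^sub>R grad g z;
               z' = (1 + m) *\<^sub>R y' - m *\<^sub>R y
           in agd_loop g G V \<epsilon> L \<kappa> y' z' (t + 2 * G + 8 * V))"

definition agd ::
  "(rvec \<Rightarrow> real) \<Rightarrow> real \<Rightarrow> real \<Rightarrow> rvec \<Rightarrow> real \<Rightarrow> real \<Rightarrow> real \<Rightarrow> real \<Rightarrow> (rvec \<times> real) option"
where
  "agd g G V y1 \<epsilon> L \<sigma> t = agd_loop g G V \<epsilon> L (L / \<sigma>) y1 y1 (t + 7 * V)"

partial_function (option) acagd ::
  "(rvec \<Rightarrow> real) \<Rightarrow> real \<Rightarrow> real \<Rightarrow> rvec \<Rightarrow> real \<Rightarrow> real \<Rightarrow> real \<Rightarrow> real \<Rightarrow> (rvec \<times> real) option"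
where
  "acagd h G V z \<epsilon> \<gamma> L t =
     (if norm (grad h z) \<le> \<epsilon> then Some (z, t + G + 3 * V)
      else do {
        (z', t') \<leftarrow> agd (\<lambda>w. h w + \<gamma> * (norm (w - z))\<^sup>2) (G + 4 * V) V z
           (\<epsilon> * sqrt (\<gamma> / (50 * (L + 2 * \<gamma>)))) (L + 2 * \<gamma>) \<gamma> (t + G + 9 * V);
        acagd h G V z' \<epsilon> \<gamma> L t'
      })"

text \<open>
  The convention \<open>sign(0) = 1\<close> matters: with value 0, NCD would never leave a saddle point.
\<close>

definition sign :: "real \<Rightarrow> real" where
  "sign t = (if t < 0 then - 1 else 1)"

text \<open>
  \<open>\<omega>\<close> is the sequence of all seeds and \<open>n\<close> is the index of the first unused one.
\<close>

partial_function (option) ncd_loop ::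
  "costs \<Rightarrow> eig_routine \<Rightarrow> (nat \<Rightarrow> real) \<Rightarrow> (rvec \<Rightarrow> real) \<Rightarrow> real \<Rightarrow> real \<Rightarrow> real \<Rightarrow>
     rvec \<Rightarrow> nat \<Rightarrow> real \<Rightarrow> (rvec \<times> nat \<times> real) option"
where
  "ncd_loop C E \<omega> f L2 \<alpha> \<delta>' z n t =
     (let v = eig_vec E (\<alpha> / 2) \<delta>' z (\<omega> n);
          c = v \<bullet> hess f z v;
          t' = t + eig_time E (\<alpha> / 2) \<delta>' z (\<omega> n) + t_hvp C + 4 * t_arith C
      in if c \<le> - \<alpha> / 2
         then ncd_loop C E \<omega> f L2 \<alpha> \<delta>' (z - (2 * \<bar>c\<bar> / L2 * sign (v \<bullet> grad f z)) *\<^sub>R v)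
                (Suc n) (t' + t_grad C + 8 * t_arith C)
         else Some (z, Suc n, t'))"

definition ncd ::
  "costs \<Rightarrow> eig_routine \<Rightarrow> (nat \<Rightarrow> real) \<Rightarrow> rvec \<Rightarrow> (rvec \<Rightarrow> real) \<Rightarrow> real \<Rightarrow> real \<Rightarrow> real \<Rightarrow> real \<Rightarrow>
     nat \<Rightarrow> real \<Rightarrow> (rvec \<times> nat \<times> real) option"
where
  "ncd C E \<omega> z1 f L2 \<alpha> \<Delta> \<delta> n t =
     ncd_loop C E \<omega> f L2 \<alpha> (\<delta> / (1 + 12 * L2\<^sup>2 * \<Delta> / \<alpha> ^ 3)) z1 n (t + 8 * t_arith C)"

text \<open>
  A gradient evaluation of the penalized function \<open>f\<^sub>k\<close> costs one gradient evaluation of \<open>f\<close> and at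
  most 11 arithmetic operations.
\<close>

partial_function (option) ancm_loop ::
  "costs \<Rightarrow> eig_routine \<Rightarrow> (nat \<Rightarrow> real) \<Rightarrow> (rvec \<Rightarrow> real) \<Rightarrow> real \<Rightarrow> real \<Rightarrow> real \<Rightarrow> real \<Rightarrow> real \<Rightarrow> real \<Rightarrow>
     rvec \<Rightarrow> nat \<Rightarrow> real \<Rightarrow> (rvec \<times> real) option"
where
  "ancm_loop C E \<omega> f \<epsilon> L1 L2 \<alpha> \<Delta> \<delta>'' x n t = do {
     (xh, n', t') \<leftarrow> (if \<alpha> < L1 then ncd C E \<omega> x f L2 \<alpha> \<Delta> \<delta>'' n (t + t_arith C)
                     else Some (x, n, t + t_arith C));
     if norm (grad f xh) \<le> \<epsilon> then Some (xh, t' + t_grad C + 3 * t_arith C)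
     else do {
       (x', t'') \<leftarrow> acagd (\<lambda>w. f w + L1 * (max (norm (w - xh) - \<alpha> / L2) 0)\<^sup>2)
          (t_grad C + 11 * t_arith C) (t_arith C) xh (\<epsilon> / 2) (3 * \<alpha>) (5 * L1)
          (t' + t_grad C + 6 * t_arith C);
       ancm_loop C E \<omega> f \<epsilon> L1 L2 \<alpha> \<Delta> \<delta>'' x' n' t''
     }
   }"

definition ancm ::
  "costs \<Rightarrow> eig_routine \<Rightarrow> (nat \<Rightarrow> real) \<Rightarrow> rvec \<Rightarrow> (rvec \<Rightarrow> real) \<Rightarrow> real \<Rightarrow> real \<Rightarrow> real \<Rightarrow> real \<Rightarrow> real \<Rightarrow> real \<Rightarrow>
     (rvec \<times> real) option"
where
  "ancm C E \<omega> x1 f \<epsilon> L1 L2 \<alpha> \<Delta> \<delta> =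
     (let K = \<lceil>1 + \<Delta> * (12 * L2\<^sup>2 / \<alpha> ^ 3 + sqrt 10 * L2 / (\<alpha> * \<epsilon>))\<rceil>
      in ancm_loop C E \<omega> f \<epsilon> L1 L2 \<alpha> \<Delta> (\<delta> / real_of_int K) x1 0 (20 * t_arith C))"

end

(*
  Every part of the run is charged to a decrease of f, whose total is at most Delta. An NCD step
  decreases f by alpha^3/(12 L2^2), because f lies below its second-order expansion plus a cubic term.
  If the last Hessian seen by NCD is at least -alpha, the penalized function f_k is 3 alpha-almost convex:
  up to distance 2 alpha/L2 from the centre the Hessian of f has changed by at most 2 alpha, and further
  out the gradient of the penalty is strongly monotone with constant L1. Each proximal step of ACAGD but
  the last decreases f_k by a multiple of eps^2/alpha, and if ACAGD moves further than alpha/L2, where the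
  penalty begins, it decreases f by at least min (3 alpha^3/L2^2) (alpha eps/(5 L2)).

  AGD is analysed by a Lyapunov function that compares with an arbitrary point instead of a minimizer.
  Comparing with the starting point shows that the value does not increase, and comparing with the next
  gradient step shows that the gradient decays geometrically relative to the initial gradient.

  For the failure probability, the point of the n-th eigenvector call is a measurable function of the
  first n seeds, so each call fails with probability at most delta', and the number of calls of a run
  is at most delta/delta'.

  If alpha > 2 sqrt (eps L2), the bound -alpha on the least eigenvalue is not enough. But then Delta is
  so small that a step along an eigenvector of an eigenvalue below -2 sqrt (eps L2) would decrease f
  by more than Delta.
*)
theory Submission
  imports Defs
begin

section \<open>Gradients and Hessians\<close>

text \<open>The procedure fixes the failure probability of one call, and \<open>\<delta>\<close>
  divided by it is exactly \<open>K (1 + 12 L2^2 \<Delta> / \<alpha>^3)\<close>. So the calls must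
  be counted with explicit constants, while time matters only up to a constant factor. Hence two
  accountings. For time, all work is priced in the smallest descent, a multiple of
  \<open>\<epsilon>^2 / \<alpha>\<close>. For calls, the larger units
  \<open>\<alpha>^3 / (12 L2^2)\<close> and \<open>\<alpha> \<epsilon> / (5 L2)\<close> are kept
  apart. The formula for \<open>K\<close> corresponds to ACAGD descents of
  \<open>\<alpha> \<epsilon> / (sqrt 10 L2)\<close>; the descent established here is smaller by the
  factor \<open>sqrt 10 / 5\<close>, so \<open>K\<close> does not serve as a bound on outer
  iterations. Only the total number of calls is bounded, and there the product leaves enough room.
  The procedures are partial functions of a random seed sequence, so measurability is obtained
  through total versions with explicit iteration bounds. These bounds are uniform over a run because
  the objective gap is at most \<open>\<Delta>\<close> throughout, and on good seeds the total
  versions reproduce the run.\<close>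

lemma grad_eqI:
  fixes f :: "'a::real_inner \<Rightarrow> real"
  assumes "GDERIV f x :> D"
  shows "grad f x = D"
  unfolding grad_def
proof (rule the_equality)
  show "GDERIV f x :> D" by fact
  fix D' assume "GDERIV f x :> D'"
  then have "(\<lambda>h. h \<bullet> D') = (\<lambda>h. h \<bullet> D)"
    using assms unfolding gderiv_def by (rule has_derivative_unique)
  then have "h \<bullet> D' = h \<bullet> D" for h by (rule fun_cong)
  then show "D' = D" using vector_eq_ldot by blast
qed

lemma gderiv_line:
  fixes f :: "'a::real_inner \<Rightarrow> real"
  assumes "GDERIV f (x + t *\<^sub>R u) :> D"
  shows "((\<lambda>t. f (x + t *\<^sub>R u)) has_real_derivative (D \<bullet> u)) (at t within S)"
proof -
  have "((\<lambda>t. x + t *\<^sub>R u) has_derivative (\<lambda>h. h *\<^sub>R u)) (at t within S)"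
    by (auto intro!: derivative_eq_intros)
  from has_derivative_compose[OF this assms[unfolded gderiv_def]]
  have "((\<lambda>t. f (x + t *\<^sub>R u)) has_derivative (\<lambda>h. (h *\<^sub>R u) \<bullet> D)) (at t within S)" .
  then show ?thesis
    by (simp add: has_field_derivative_def inner_commute mult_commute_abs)
qed

text \<open>The derivative of \<open>\<psi>\<close> at \<open>t > 0\<close> is \<open>1 / t\<close>
  times the slack of the monotonicity hypothesis between \<open>x\<close> and
  \<open>x + t u\<close>. The modulus may have either sign: \<open>- L\<close> yields the upper
  bound for smooth functions, \<open>\<gamma>\<close> the strong convexity of the proximal
  objective.\<close>

lemma quadratic_lower_bound:
  fixes f :: "'a::real_inner \<Rightarrow> real"
  assumes d: "\<And>x. GDERIV f x :> g x"
    and mono: "\<And>x y. (g y - g x) \<bullet> (y - x) \<ge> \<mu> * (norm (y - x))\<^sup>2"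
  shows "f y \<ge> f x + g x \<bullet> (y - x) + \<mu> / 2 * (norm (y - x))\<^sup>2"
proof -
  define u where "u = y - x"
  define \<psi> where "\<psi> t = f (x + t *\<^sub>R u) - t * (g x \<bullet> u) - \<mu> / 2 * t\<^sup>2 * (norm u)\<^sup>2" for t
  have "\<psi> 0 \<le> \<psi> 1"
  proof (rule DERIV_nonneg_imp_nondecreasing[of 0 1 \<psi>])
    fix t :: real assume t: "0 \<le> t" "t \<le> 1"
    let ?D = "g (x + t *\<^sub>R u) \<bullet> u - g x \<bullet> u - \<mu> * t * (norm u)\<^sup>2"
    have "(\<psi> has_real_derivative ?D) (at t)"
      unfolding \<psi>_def by (auto intro!: derivative_eq_intros gderiv_line[OF d])
    moreover have "0 \<le> ?D"
    proof (cases "t = 0")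
      case False
      then have "0 < t" using t by simp
      have "t * ?D = (g (x + t *\<^sub>R u) - g x) \<bullet> (t *\<^sub>R u) - \<mu> * (norm (t *\<^sub>R u))\<^sup>2"
        by (simp add: inner_diff_left right_diff_distrib power2_eq_square)
      also have "\<dots> \<ge> 0" using mono[of "x + t *\<^sub>R u" x] by simp
      finally show ?thesis using \<open>0 < t\<close> by (simp add: zero_le_mult_iff)
    qed simp
    ultimately show "\<exists>y. (\<psi> has_real_derivative y) (at t) \<and> 0 \<le> y" by blast
  qed simp
  then show ?thesis by (simp add: \<psi>_def u_def)
qed

lemma quadratic_upper_bound:
  fixes f :: "'a::real_inner \<Rightarrow> real"
  assumes d: "\<And>x. GDERIV f x :> g x"
    and lip: "\<And>x y. norm (g y - g x) \<le> L * norm (y - x)"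
  shows "f y \<le> f x + g x \<bullet> (y - x) + L / 2 * (norm (y - x))\<^sup>2"
proof -
  have "- f y \<ge> - f x + (- g x) \<bullet> (y - x) + (- L) / 2 * (norm (y - x))\<^sup>2"
  proof (rule quadratic_lower_bound)
    show "GDERIV (\<lambda>x. - f x) x :> - g x" for x by (rule GDERIV_minus[OF d])
    fix x y
    have "(g y - g x) \<bullet> (y - x) \<le> norm (g y - g x) * norm (y - x)" by (rule norm_cauchy_schwarz)
    also have "\<dots> \<le> L * norm (y - x) * norm (y - x)" by (rule mult_right_mono[OF lip]) simp
    finally show "- L * (norm (y - x))\<^sup>2 \<le> (- g y - - g x) \<bullet> (y - x)"
      by (simp add: power2_eq_square inner_diff_left)
  qed
  then show ?thesis by simp
qed

lemma gradient_step:
  fixes f :: "'a::real_inner \<Rightarrow> real"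
  assumes d: "\<And>x. GDERIV f x :> g x"
    and lip: "\<And>x y. norm (g y - g x) \<le> L * norm (y - x)" and "0 < L"
  shows "f (x - (1 / L) *\<^sub>R g x) \<le> f x - (norm (g x))\<^sup>2 / (2 * L)"
proof -
  have "f (x - (1 / L) *\<^sub>R g x) \<le> f x - 1 / L * (norm (g x))\<^sup>2 + L / 2 * ((1 / L) * norm (g x))\<^sup>2"
    using quadratic_upper_bound[OF d lip, of "x - (1 / L) *\<^sub>R g x" x] \<open>0 < L\<close>
    by (simp add: power2_norm_eq_inner)
  also have "\<dots> = f x - (norm (g x))\<^sup>2 / (2 * L)"
    using \<open>0 < L\<close> by (simp add: power2_eq_square field_simps)
  finally show ?thesis .
qed

lemma norm_gradient_le:
  fixes f :: "'a::real_inner \<Rightarrow> real"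
  assumes d: "\<And>x. GDERIV f x :> g x"
    and lip: "\<And>x y. norm (g y - g x) \<le> L * norm (y - x)" and "0 < L"
    and lb: "\<And>x. m \<le> f x"
  shows "(norm (g x))\<^sup>2 \<le> 2 * L * (f x - m)"
proof -
  have "(norm (g x))\<^sup>2 / (2 * L) \<le> f x - m"
    using gradient_step[OF assms(1-3), of x] lb[of "x - (1 / L) *\<^sub>R g x"] by simp
  then show ?thesis using \<open>0 < L\<close> by (simp add: field_simps)
qed

text \<open>Stands in for dividing by \<open>t\<close> and letting it tend to 0: in the symmetry of
  the Hessian, in its lower bound, and in the first-order condition for the smallest
  eigenvalue.\<close>

lemma le_zero_if_le_small:
  fixes a C :: real
  assumes "\<And>t. 0 < t \<Longrightarrow> a \<le> t * C"
  shows "a \<le> 0"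
proof (rule ccontr)
  assume "\<not> a \<le> 0"
  then have "0 < a / (2 * (\<bar>C\<bar> + 1))" by simp
  from assms[OF this] have "a * (2 * (\<bar>C\<bar> + 1)) \<le> a * C" by (simp add: field_simps)
  then show False using \<open>\<not> a \<le> 0\<close> by (auto simp: mult_le_cancel_left)
qed

section \<open>Functions with Lipschitz continuous Hessian\<close>

context
  fixes f :: "'a::real_inner \<Rightarrow> real" and M :: real
  assumes lh: "lipschitz_hessian M f" and M: "0 \<le> M"
begin

lemma lh_gderiv: "GDERIV f x :> grad f x"
  using lh by (simp add: lipschitz_hessian_def)

lemma lh_has_derivative: "(grad f has_derivative hess f x) (at x)"
  using lh unfolding lipschitz_hessian_def hess_def by (simp add: frechet_derivative_works)

lemma bounded_linear_hess: "bounded_linear (hess f x)"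
  using lh_has_derivative by (rule has_derivative_bounded_linear)

lemma hess_diff_le: "norm (hess f x v - hess f y v) \<le> M * norm (x - y) * norm v"
proof -
  have "norm (hess f x v - hess f y v) \<le> onorm (\<lambda>v. hess f x v - hess f y v) * norm v"
    by (rule onorm) (intro bounded_linear_sub bounded_linear_hess)
  also have "\<dots> \<le> M * norm (x - y) * norm v"
    using lh by (intro mult_right_mono) (auto simp: lipschitz_hessian_def)
  finally show ?thesis .
qed

lemma grad_line_derivative:
  "((\<lambda>t. grad f (x + t *\<^sub>R u) \<bullet> w) has_real_derivative (hess f (x + t *\<^sub>R u) u \<bullet> w)) (at t within S)"
proof -
  have "((\<lambda>t. x + t *\<^sub>R u) has_derivative (\<lambda>h. h *\<^sub>R u)) (at t within S)"
    by (auto intro!: derivative_eq_intros)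
  from has_derivative_compose[OF this lh_has_derivative]
  have "((\<lambda>t. grad f (x + t *\<^sub>R u)) has_derivative (\<lambda>h. hess f (x + t *\<^sub>R u) (h *\<^sub>R u))) (at t within S)" .
  then have "((\<lambda>t. grad f (x + t *\<^sub>R u) \<bullet> w) has_derivative (\<lambda>h. hess f (x + t *\<^sub>R u) (h *\<^sub>R u) \<bullet> w)) (at t within S)"
    by (rule has_derivative_inner_left)
  moreover have "hess f (x + t *\<^sub>R u) (h *\<^sub>R u) = h *\<^sub>R hess f (x + t *\<^sub>R u) u" for h
    using bounded_linear_hess by (rule linear_simps)
  ultimately show ?thesis
    by (simp add: has_field_derivative_def mult_commute_abs)
qed

text \<open>The mean value theorem for the scalar function \<open>\<phi>\<close> gives
  \<open>M\<close> where Taylor's formula would give \<open>M / 2\<close>. The estimate is applied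
  to vectors scaled by a \<open>t\<close> that tends to 0, where the constant is immaterial.\<close>

lemma grad_expansion:
  "\<bar>(grad f (x + u) - grad f x - hess f x u) \<bullet> w\<bar> \<le> M * (norm u)\<^sup>2 * norm w"
proof -
  define \<phi> where "\<phi> t = grad f (x + t *\<^sub>R u) \<bullet> w" for t
  have "\<exists>z. 0 < z \<and> z < 1 \<and> \<phi> 1 - \<phi> 0 = (1 - 0) * (hess f (x + z *\<^sub>R u) u \<bullet> w)"
    unfolding \<phi>_def by (rule MVT2) (simp, rule grad_line_derivative)
  then obtain z where z: "0 < z" "z < 1" "\<phi> 1 - \<phi> 0 = hess f (x + z *\<^sub>R u) u \<bullet> w" by auto
  then have "(grad f (x + u) - grad f x - hess f x u) \<bullet> w = (hess f (x + z *\<^sub>R u) u - hess f x u) \<bullet> w"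
    by (simp add: \<phi>_def inner_diff_left)
  also have "\<bar>\<dots>\<bar> \<le> norm (hess f (x + z *\<^sub>R u) u - hess f x u) * norm w"
    by (rule Cauchy_Schwarz_ineq2)
  also have "\<dots> \<le> (M * norm (x + z *\<^sub>R u - x) * norm u) * norm w"
    by (intro mult_right_mono hess_diff_le) simp
  also have "\<dots> = z * (M * (norm u)\<^sup>2 * norm w)"
    using z by (simp add: power2_eq_square)
  also have "\<dots> \<le> M * (norm u)\<^sup>2 * norm w"
    using z M by (intro mult_left_le_one_le) auto
  finally show ?thesis .
qed

text \<open>The second difference is symmetric in \<open>u\<close> and \<open>v\<close>, so letting \<open>t\<close> tend to 0 shows that the Hessian
  is symmetric.\<close>

lemma second_difference:
  assumes "0 \<le> t"
  shows "\<bar>f (x + t *\<^sub>R u + t *\<^sub>R v) - f (x + t *\<^sub>R v) - f (x + t *\<^sub>R u) + f x - t\<^sup>2 * (hess f x u \<bullet> v)\<bar>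
     \<le> t ^ 3 * (M * (norm u + norm v)\<^sup>2 * norm v + M * (norm v)\<^sup>2 * norm v)"
proof -
  define \<phi> where "\<phi> s = f (x + t *\<^sub>R u + s *\<^sub>R (t *\<^sub>R v)) - f (x + s *\<^sub>R (t *\<^sub>R v))" for s
  have "\<exists>z. 0 < z \<and> z < 1 \<and> \<phi> 1 - \<phi> 0 =
     (1 - 0) * (grad f (x + t *\<^sub>R u + z *\<^sub>R (t *\<^sub>R v)) \<bullet> (t *\<^sub>R v) - grad f (x + z *\<^sub>R (t *\<^sub>R v)) \<bullet> (t *\<^sub>R v))"
    unfolding \<phi>_def by (rule MVT2) (simp, intro DERIV_diff gderiv_line lh_gderiv)
  then obtain z where z: "0 < z" "z < 1" and eq: "\<phi> 1 - \<phi> 0 =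
     t * ((grad f (x + t *\<^sub>R u + z *\<^sub>R (t *\<^sub>R v)) - grad f (x + z *\<^sub>R (t *\<^sub>R v))) \<bullet> v)"
    by (auto simp: inner_diff_left right_diff_distrib)
  let ?p = "t *\<^sub>R u + z *\<^sub>R (t *\<^sub>R v)" and ?q = "z *\<^sub>R (t *\<^sub>R v)"
  have lin: "hess f x ?p = hess f x (t *\<^sub>R u) + hess f x ?q" "hess f x (t *\<^sub>R u) = t *\<^sub>R hess f x u"
    using bounded_linear_hess[of x] by (rule linear_simps)+
  have "\<phi> 1 - \<phi> 0 - t\<^sup>2 * (hess f x u \<bullet> v) =
      t * ((grad f (x + ?p) - grad f x - hess f x ?p) \<bullet> v
         - (grad f (x + ?q) - grad f x - hess f x ?q) \<bullet> v)"
    unfolding eq lin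
    by (simp add: inner_diff_left inner_add_left right_diff_distrib distrib_left power2_eq_square add.assoc)
  also have "\<bar>\<dots>\<bar> \<le> t * (M * (norm ?p)\<^sup>2 * norm v + M * (norm ?q)\<^sup>2 * norm v)"
    unfolding abs_mult using assms
    by (intro mult_mono order_trans[OF abs_triangle_ineq4] add_mono grad_expansion) auto
  also have "\<dots> \<le> t * (M * (t * (norm u + norm v))\<^sup>2 * norm v + M * (t * norm v)\<^sup>2 * norm v)"
  proof -
    have q: "norm ?q \<le> t * norm v"
      using assms z mult_left_le_one_le[of "t * norm v" z] by (simp add: mult.assoc)
    have "norm ?p \<le> t * norm u + norm ?q"
      by (rule order_trans[OF norm_triangle_ineq]) (use assms in simp)
    then have p: "norm ?p \<le> t * (norm u + norm v)" using q by (simp add: algebra_simps)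
    show ?thesis using assms M
      by (intro mult_left_mono add_mono mult_right_mono power_mono p q) auto
  qed
  also have "\<dots> = t ^ 3 * (M * (norm u + norm v)\<^sup>2 * norm v + M * (norm v)\<^sup>2 * norm v)"
    by (simp add: power2_eq_square power3_eq_cube algebra_simps)
  finally show ?thesis by (simp add: \<phi>_def)
qed

lemma hess_symmetric: "hess f x u \<bullet> v = u \<bullet> hess f x v"
proof -
  define C where "C = (M * (norm u + norm v)\<^sup>2 * norm v + M * (norm v)\<^sup>2 * norm v)
     + (M * (norm v + norm u)\<^sup>2 * norm u + M * (norm u)\<^sup>2 * norm u)"
  let ?D = "hess f x u \<bullet> v - hess f x v \<bullet> u"
  have "\<bar>?D\<bar> \<le> 0"
  proof (rule le_zero_if_le_small)
    fix t :: real assume "0 < t"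
    have swap: "x + t *\<^sub>R v + t *\<^sub>R u = x + t *\<^sub>R u + t *\<^sub>R v" by simp
    have "t\<^sup>2 * \<bar>?D\<bar> = \<bar>t\<^sup>2 * (hess f x u \<bullet> v) - t\<^sup>2 * (hess f x v \<bullet> u)\<bar>"
      by (simp flip: right_diff_distrib add: abs_mult)
    also have "\<dots> \<le> t ^ 3 * C"
      using second_difference[of t x u v] second_difference[of t x v u] \<open>0 < t\<close>
      unfolding swap C_def distrib_left[of "t ^ 3" "M * (norm u + norm v)\<^sup>2 * norm v + _"] by linarith
    finally show "\<bar>?D\<bar> \<le> t * C"
      using \<open>0 < t\<close> by (simp add: power2_eq_square power3_eq_cube mult.assoc)
  qed
  then show ?thesis by (simp add: inner_commute)
qed

lemma hess_ge_of_lipschitz_grad: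
  assumes lip: "\<And>x y. norm (grad f x - grad f y) \<le> L * norm (x - y)"
  shows "hess f x u \<bullet> u \<ge> - L * (norm u)\<^sup>2"
proof -
  have "- (hess f x u \<bullet> u) - L * (norm u)\<^sup>2 \<le> 0"
  proof (rule le_zero_if_le_small)
    fix t :: real assume "0 < t"
    have lin: "hess f x (t *\<^sub>R u) = t *\<^sub>R hess f x u"
      using bounded_linear_hess[of x] by (rule linear_simps)
    have "\<bar>(grad f (x + t *\<^sub>R u) - grad f x) \<bullet> u\<bar> \<le> norm (grad f (x + t *\<^sub>R u) - grad f x) * norm u"
      by (rule Cauchy_Schwarz_ineq2)
    also have "\<dots> \<le> L * norm (x + t *\<^sub>R u - x) * norm u"
      by (intro mult_right_mono lip) simp
    finally have "\<bar>(grad f (x + t *\<^sub>R u) - grad f x) \<bullet> u\<bar> \<le> t * (L * (norm u)\<^sup>2)"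
      using \<open>0 < t\<close> by (simp add: power2_eq_square algebra_simps)
    moreover have "\<bar>(grad f (x + t *\<^sub>R u) - grad f x) \<bullet> u - t * (hess f x u \<bullet> u)\<bar> \<le> t * (t * (M * norm u ^ 3))"
      using grad_expansion[of x "t *\<^sub>R u" u] \<open>0 < t\<close>
      by (simp add: lin inner_diff_left power2_eq_square power3_eq_cube algebra_simps)
    ultimately have "t * (- (hess f x u \<bullet> u) - L * (norm u)\<^sup>2) \<le> t * (t * (M * norm u ^ 3))"
      by (simp add: right_diff_distrib)
    then show "- (hess f x u \<bullet> u) - L * (norm u)\<^sup>2 \<le> t * (M * norm u ^ 3)"
      using \<open>0 < t\<close> by simp
  qed
  then show ?thesis by simp
qed

lemma hess_lower_shift: "hess f y u \<bullet> u \<ge> hess f x u \<bullet> u - M * norm (y - x) * (norm u)\<^sup>2"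
proof -
  have "\<bar>(hess f y u - hess f x u) \<bullet> u\<bar> \<le> norm (hess f y u - hess f x u) * norm u"
    by (rule Cauchy_Schwarz_ineq2)
  also have "\<dots> \<le> M * norm (y - x) * norm u * norm u"
    by (intro mult_right_mono hess_diff_le) simp
  finally show ?thesis by (simp add: inner_diff_left power2_eq_square)
qed

text \<open>Taylor's formula by two nested monotonicity arguments: \<open>\<psi>1\<close> is the
  derivative of \<open>\<psi>\<close> and itself has a nonnegative derivative. The sharp constant
  \<open>M / 6\<close> is kept because it determines the descent of an NCD step, to which the
  prescribed failure probability is tied.\<close>

lemma cubic_upper_bound:
  "f (x + u) \<le> f x + grad f x \<bullet> u + hess f x u \<bullet> u / 2 + M / 6 * norm u ^ 3"
proof -
  define \<psi>1 where "\<psi>1 t = grad f x \<bullet> u + t * (hess f x u \<bullet> u) + M / 2 * t\<^sup>2 * norm u ^ 3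
      - grad f (x + t *\<^sub>R u) \<bullet> u" for t
  define \<psi> where "\<psi> t = t * (grad f x \<bullet> u) + t\<^sup>2 / 2 * (hess f x u \<bullet> u) + M / 6 * t ^ 3 * norm u ^ 3
      - f (x + t *\<^sub>R u)" for t
  have \<psi>1: "0 \<le> \<psi>1 t" if "0 \<le> t" for t
  proof -
    have "\<psi>1 0 \<le> \<psi>1 t"
    proof (rule DERIV_nonneg_imp_nondecreasing[OF that])
      fix s :: real assume s: "0 \<le> s" "s \<le> t"
      have "(\<psi>1 has_real_derivative
          hess f x u \<bullet> u + M * s * norm u ^ 3 - hess f (x + s *\<^sub>R u) u \<bullet> u) (at s)"
        unfolding \<psi>1_def by (auto intro!: derivative_eq_intros grad_line_derivative)
      moreover have "hess f (x + s *\<^sub>R u) u \<bullet> u \<le> hess f x u \<bullet> u + M * s * norm u ^ 3"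
        using hess_lower_shift[where x = "x + s *\<^sub>R u" and y = x and u = u] s
        by (simp add: power2_eq_square power3_eq_cube algebra_simps)
      ultimately show "\<exists>y. (\<psi>1 has_real_derivative y) (at s) \<and> 0 \<le> y" by force
    qed
    then show ?thesis by (simp add: \<psi>1_def)
  qed
  have "\<psi> 0 \<le> \<psi> 1"
  proof (rule DERIV_nonneg_imp_nondecreasing[of 0 1 \<psi>])
    fix t :: real assume t: "0 \<le> t" "t \<le> 1"
    have "(\<psi> has_real_derivative \<psi>1 t) (at t)"
      unfolding \<psi>_def \<psi>1_def by (auto intro!: derivative_eq_intros gderiv_line lh_gderiv)
    then show "\<exists>y. (\<psi> has_real_derivative y) (at t) \<and> 0 \<le> y" using \<psi>1[OF t(1)] by blast
  qed simp
  then show ?thesis by (simp add: \<psi>_def)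
qed

text \<open>The length \<open>2 |c| / M\<close> minimizes \<open>- |c| r^2 / 2 + M r^3 / 6\<close>
  over \<open>r \<ge> 0\<close>, with value \<open>- 2 |c|^3 / (3 M^2)\<close>; the sign makes the
  linear term nonpositive. At \<open>|c| = \<alpha> / 2\<close> the descent is
  \<open>\<alpha>^3 / (12 M^2)\<close>.\<close>

lemma negative_curvature_step:
  assumes "0 < M" and v: "norm v = 1" and c: "c = v \<bullet> hess f z v" "c \<le> 0"
  shows "f (z - (2 * \<bar>c\<bar> / M * sign (v \<bullet> grad f z)) *\<^sub>R v) \<le> f z - 2 / 3 * \<bar>c\<bar> ^ 3 / M\<^sup>2"
proof -
  define s where "s = sign (v \<bullet> grad f z)"
  define r where "r = 2 * \<bar>c\<bar> / M * s"
  have s: "s * s = 1" "\<bar>s\<bar> = 1" "0 \<le> s * (v \<bullet> grad f z)" by (auto simp: s_def sign_def)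
  have lin: "hess f z (- r *\<^sub>R v) = - r *\<^sub>R hess f z v"
    using bounded_linear_hess[of z] by (rule linear_simps)
  have absr: "\<bar>r\<bar> = 2 * \<bar>c\<bar> / M" using \<open>0 < M\<close> s by (simp add: r_def abs_mult)
  have "f (z + - r *\<^sub>R v) \<le> f z + grad f z \<bullet> (- r *\<^sub>R v)
      + hess f z (- r *\<^sub>R v) \<bullet> (- r *\<^sub>R v) / 2 + M / 6 * norm (- r *\<^sub>R v) ^ 3"
    by (rule cubic_upper_bound)
  also have "\<dots> = f z - r * (v \<bullet> grad f z) + \<bar>r\<bar>\<^sup>2 * c / 2 + M / 6 * \<bar>r\<bar> ^ 3"
    using c(1) v unfolding lin by (simp add: inner_commute power2_eq_square)
  also have "\<dots> \<le> f z - 2 / 3 * \<bar>c\<bar> ^ 3 / M\<^sup>2"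
  proof -
    have "0 \<le> 2 * \<bar>c\<bar> / M * (s * (v \<bullet> grad f z))"
      by (rule mult_nonneg_nonneg[OF _ s(3)]) (use \<open>0 < M\<close> in simp)
    then have "0 \<le> r * (v \<bullet> grad f z)" by (simp add: r_def)
    moreover have "\<bar>r\<bar>\<^sup>2 * c / 2 + M / 6 * \<bar>r\<bar> ^ 3 = - 2 / 3 * \<bar>c\<bar> ^ 3 / M\<^sup>2"
      using c(2) \<open>0 < M\<close> unfolding absr by (simp add: power2_eq_square power3_eq_cube field_simps)
    ultimately show ?thesis by simp
  qed
  finally show ?thesis by (simp add: r_def s_def)
qed

lemma grad_monotone_of_hess:
  assumes "\<And>t. 0 \<le> t \<Longrightarrow> t \<le> 1 \<Longrightarrow>
    hess f (x + t *\<^sub>R (y - x)) (y - x) \<bullet> (y - x) \<ge> \<mu> * (norm (y - x))\<^sup>2"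
  shows "(grad f y - grad f x) \<bullet> (y - x) \<ge> \<mu> * (norm (y - x))\<^sup>2"
proof -
  have "\<exists>z. 0 < z \<and> z < 1 \<and>
      grad f (x + 1 *\<^sub>R (y - x)) \<bullet> (y - x) - grad f (x + 0 *\<^sub>R (y - x)) \<bullet> (y - x)
      = (1 - 0) * (hess f (x + z *\<^sub>R (y - x)) (y - x) \<bullet> (y - x))"
    by (rule MVT2) (simp, rule grad_line_derivative)
  then show ?thesis using assms by (auto simp: inner_diff_left)
qed

text \<open>Joint continuity is needed because both the point and the direction depend on the seeds.
  \<open>hess_diff_le\<close> controls a change of the point, linearity a change of the
  direction.\<close>

lemma continuous_on_curvature: "continuous_on UNIV (\<lambda>p. snd p \<bullet> hess f (fst p) (snd p))"
proof (rule continuous_at_imp_continuous_on, intro ballI)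
  fix p :: "'a \<times> 'a"
  let ?F = "at p within UNIV"
  have "((\<lambda>q. hess f (fst q) (snd q) - hess f (fst p) (snd q)) \<longlongrightarrow> 0) ?F"
  proof (rule Lim_null_comparison)
    show "\<forall>\<^sub>F q in ?F. norm (hess f (fst q) (snd q) - hess f (fst p) (snd q))
        \<le> M * norm (fst q - fst p) * norm (snd q)"
      using hess_diff_le by simp
    show "((\<lambda>q. M * norm (fst q - fst p) * norm (snd q)) \<longlongrightarrow> 0) ?F"
      by (auto intro!: tendsto_eq_intros)
  qed
  then have "((\<lambda>q. snd q \<bullet> ((hess f (fst q) (snd q) - hess f (fst p) (snd q)) + hess f (fst p) (snd q)))
      \<longlongrightarrow> snd p \<bullet> (0 + hess f (fst p) (snd p))) ?F"
    by (intro tendsto_intros bounded_linear.tendsto[OF bounded_linear_hess]) auto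
  then show "isCont (\<lambda>p. snd p \<bullet> hess f (fst p) (snd p)) p"
    by (simp add: isCont_def)
qed

end

section \<open>The space \<open>rvec\<close>\<close>

lemma coord_add [simp]: "coord (x + y) i = coord x i + coord y i"
  by (simp add: plus_rvec.rep_eq)

lemma coord_diff [simp]: "coord (x - y) i = coord x i - coord y i"
  by (simp add: minus_rvec.rep_eq)

lemma coord_scaleR [simp]: "coord (c *\<^sub>R x) i = c * coord x i"
  by (simp add: scaleR_rvec.rep_eq)

lemma coord_zero [simp]: "coord 0 i = 0"
  by (simp add: zero_rvec.rep_eq)

lemma coord_trunc [simp]: "coord (trunc d x) i = (if i < d then coord x i else 0)"
  by (simp add: trunc.rep_eq)

lemma subspace_Rn: "subspace (Rn d)"
  by (auto simp: subspace_def Rn_def)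

lemmas Rn_intros = subspace_0[OF subspace_Rn] subspace_add[OF subspace_Rn]
  subspace_diff[OF subspace_Rn] subspace_scale[OF subspace_Rn]

lemma trunc_in_Rn [simp]: "trunc d x \<in> Rn d"
  by (simp add: Rn_def)

lemma Rn_iff_trunc: "x \<in> Rn d \<longleftrightarrow> trunc d x = x"
proof
  assume "x \<in> Rn d"
  then show "trunc d x = x" by (intro rvec_eqI) (simp add: Rn_def)
qed (metis trunc_in_Rn)

lemma ex_Rn: "\<exists>n. x \<in> Rn n"
proof -
  have "\<exists>m. \<forall>i\<in>{i. coord x i \<noteq> 0}. i < m"
    using finite_coord[of x] finite_nat_set_iff_bounded by blast
  then show ?thesis by (auto simp: Rn_def) (metis not_le)
qed

lemma inner_Rn:
  assumes "x \<in> Rn d"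
  shows "x \<bullet> y = (\<Sum>i<d. coord x i * coord y i)"
  by (rule inner_rvec_superset) (use assms in \<open>auto simp: Rn_def not_less[symmetric]\<close>)

lemma inner_trunc: "trunc d x \<bullet> y = x \<bullet> trunc d y"
  by (simp add: inner_Rn[where d = d] inner_commute[of x] mult.commute)

lemma norm_trunc_le: "norm (trunc d x) \<le> norm x"
proof -
  have "trunc d x \<bullet> trunc d x = x \<bullet> trunc d x"
    by (simp add: inner_trunc[symmetric]) (metis Rn_iff_trunc trunc_in_Rn)
  then have "(norm (trunc d x))\<^sup>2 \<le> norm x * norm (trunc d x)"
    by (metis norm_cauchy_schwarz power2_norm_eq_inner)
  then show ?thesis by (cases "norm (trunc d x) = 0") (auto simp: power2_eq_square)
qed

lift_definition unit_rvec :: "nat \<Rightarrow> rvec" is "\<lambda>k i. if i = k then 1 else 0"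
  by simp

lemma coord_unit [simp]: "coord (unit_rvec k) i = (if i = k then 1 else 0)"
  by (simp add: unit_rvec.rep_eq)

lemma inner_unit: "unit_rvec k \<bullet> x = coord x k"
  by (simp add: inner_Rn[of _ "Suc k"] Rn_def)

lemma norm_unit [simp]: "norm (unit_rvec k) = 1"
  by (simp add: norm_rvec_def inner_unit)

lemma abs_coord_le_norm: "\<bar>coord x k\<bar> \<le> norm x"
  using Cauchy_Schwarz_ineq2[of "unit_rvec k" x] by (simp add: inner_unit)

lemma Rn_Suc_split:
  "x \<in> Rn (Suc d) \<longleftrightarrow> (\<exists>y\<in>Rn d. \<exists>s. x = y + s *\<^sub>R unit_rvec d)" (is "_ \<longleftrightarrow> ?R")
proof
  assume x: "x \<in> Rn (Suc d)"
  have "x = trunc d x + coord x d *\<^sub>R unit_rvec d"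
    using x by (intro rvec_eqI) (auto simp: Rn_def)
  then show ?R by (metis trunc_in_Rn)
qed (auto simp: Rn_def)

text \<open>Bounded closed sets of \<open>rvec\<close> need not be compact, so compactness is built
  up one coordinate at a time: each box is a continuous image of the previous one times an
  interval.\<close>

lemma compact_box_Rn: "compact {x \<in> Rn d. \<forall>i. \<bar>coord x i\<bar> \<le> 1}"
proof (induction d)
  case 0
  have "{x \<in> Rn 0. \<forall>i. \<bar>coord x i\<bar> \<le> 1} = {0}"
    by (auto simp: Rn_def intro: rvec_eqI)
  then show ?case by simp
next
  case (Suc d)
  let ?B = "\<lambda>d. {x \<in> Rn d. \<forall>i. \<bar>coord x i\<bar> \<le> 1}"
  have "?B (Suc d) = (\<lambda>p. fst p + snd p *\<^sub>R unit_rvec d) ` (?B d \<times> {- 1..1})"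
  proof (intro subset_antisym subsetI)
    fix x assume x: "x \<in> ?B (Suc d)"
    then have "x = fst (trunc d x, coord x d) + snd (trunc d x, coord x d) *\<^sub>R unit_rvec d"
      by (intro rvec_eqI) (auto simp: Rn_def)
    moreover have "(trunc d x, coord x d) \<in> ?B d \<times> {- 1..1}"
      using x by (auto simp: abs_le_iff minus_le_iff)
    ultimately show "x \<in> (\<lambda>p. fst p + snd p *\<^sub>R unit_rvec d) ` (?B d \<times> {- 1..1})"
      by (rule image_eqI)
  qed (auto simp: Rn_def abs_le_iff)
  moreover have "compact ((\<lambda>p. fst p + snd p *\<^sub>R unit_rvec d) ` (?B d \<times> {- 1..1::real}))"
    by (intro compact_continuous_image compact_Times Suc compact_Icc continuous_intros)
  ultimately show ?case by simp
qed

lemma compact_sphere_Rn: "compact {x \<in> Rn d. norm x = 1}"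
proof -
  have "{x \<in> Rn d. norm x = 1} = {x \<in> Rn d. \<forall>i. \<bar>coord x i\<bar> \<le> 1} \<inter> {x. norm x = 1}"
    by (auto intro: order_trans[OF abs_coord_le_norm])
  moreover have "closed {x :: rvec. norm x = 1}"
    by (intro closed_Collect_eq continuous_intros)
  ultimately show ?thesis using compact_box_Rn by (simp add: compact_Int_closed)
qed

subsection \<open>The smallest eigenvalue\<close>

text \<open>The \<open>LEAST\<close> in \<open>lambda_min\<close> is meaningful only if a least
  eigenvalue exists. It is the minimum of the Rayleigh quotient on the compact unit sphere of
  \<open>Rn d\<close>. For a minimizer \<open>v\<close> the residual \<open>w = A v - l v\<close> is
  orthogonal to \<open>v\<close>, and moving to \<open>v - t w\<close> changes the quadratic form by
  \<open>- 2 t |w|^2\<close> to first order, so \<open>w = 0\<close>.\<close>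

lemma lambda_min_minimizer:
  assumes "1 \<le> d" and bl: "bounded_linear A" and inv: "\<And>v. v \<in> Rn d \<Longrightarrow> A v \<in> Rn d"
    and sym: "\<And>u v. A u \<bullet> v = u \<bullet> A v"
  shows "\<exists>v\<in>Rn d. norm v = 1 \<and> A v = lambda_min d A *\<^sub>R v \<and>
    (\<forall>u\<in>Rn d. lambda_min d A * (norm u)\<^sup>2 \<le> u \<bullet> A u)"
proof -
  interpret A: bounded_linear A by fact
  have "unit_rvec 0 \<in> {x \<in> Rn d. norm x = 1}"
    using \<open>1 \<le> d\<close> by (auto simp: Rn_def)
  moreover have "continuous_on {x \<in> Rn d. norm x = 1} (\<lambda>u. u \<bullet> A u)"
    by (intro continuous_intros A.continuous_on)
  ultimately obtain v where v: "v \<in> Rn d" "norm v = 1"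
    and min: "\<And>u. u \<in> Rn d \<Longrightarrow> norm u = 1 \<Longrightarrow> v \<bullet> A v \<le> u \<bullet> A u"
    using continuous_attains_inf[OF compact_sphere_Rn, of d "\<lambda>u. u \<bullet> A u"] by fast
  define l where "l = v \<bullet> A v"
  have low: "l * (norm u)\<^sup>2 \<le> u \<bullet> A u" if "u \<in> Rn d" for u
  proof (cases "u = 0")
    case False
    then have "l \<le> (u /\<^sub>R norm u) \<bullet> A (u /\<^sub>R norm u)"
      unfolding l_def using that by (intro min Rn_intros) auto
    then show ?thesis using False by (simp add: A.scaleR field_simps power2_eq_square)
  qed simp
  define w where "w = A v - l *\<^sub>R v"
  have w: "w \<in> Rn d" unfolding w_def by (intro Rn_intros inv v)
  have vw: "v \<bullet> w = 0"
    using v by (simp add: w_def inner_diff_right l_def flip: power2_norm_eq_inner)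
  have "(norm w)\<^sup>2 \<le> 0"
  proof (rule le_zero_if_le_small)
    fix t :: real assume "0 < t"
    define C where "C = (w \<bullet> A w - l * (norm w)\<^sup>2) / 2"
    have vAv: "v \<bullet> A v = l" and vv: "v \<bullet> v = 1" and Av: "A v = w + l *\<^sub>R v"
      using v by (simp_all add: l_def w_def flip: power2_norm_eq_inner)
    have "l * (norm (v - t *\<^sub>R w))\<^sup>2 \<le> (v - t *\<^sub>R w) \<bullet> A (v - t *\<^sub>R w)"
      by (intro low Rn_intros v w)
    also have "\<dots> = v \<bullet> A v - 2 * t * (w \<bullet> A v) + t\<^sup>2 * (w \<bullet> A w)"
      using sym[of v w]
      by (simp add: A.diff A.scaleR inner_diff_left inner_diff_right inner_commute power2_eq_square)
    also have "w \<bullet> A v = (norm w)\<^sup>2"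
      using vw by (simp add: Av inner_add_right inner_commute power2_norm_eq_inner)
    also have "(norm (v - t *\<^sub>R w))\<^sup>2 = 1 + t\<^sup>2 * (norm w)\<^sup>2"
      using vw vv unfolding power2_norm_eq_inner
      by (simp add: inner_diff_left inner_diff_right inner_commute[of w v] power2_eq_square)
    finally have "2 * t * (norm w)\<^sup>2 \<le> 2 * t * (t * C)"
      by (simp add: vAv C_def power2_eq_square algebra_simps)
    then show "(norm w)\<^sup>2 \<le> t * C" using \<open>0 < t\<close> by simp
  qed
  then have Av: "A v = l *\<^sub>R v" by (simp add: w_def)
  have "lambda_min d A = l"
    unfolding lambda_min_def
  proof (rule Least_equality)
    show "\<exists>v\<in>Rn d. v \<noteq> 0 \<and> A v = l *\<^sub>R v" using v Av by force
    fix k assume "\<exists>v\<in>Rn d. v \<noteq> 0 \<and> A v = k *\<^sub>R v"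
    then obtain u where u: "u \<in> Rn d" "u \<noteq> 0" "A u = k *\<^sub>R u" by blast
    then have "l * (norm u)\<^sup>2 \<le> k * (norm u)\<^sup>2"
      using low[OF u(1)] by (simp add: power2_norm_eq_inner)
    then show "l \<le> k" using u(2) by simp
  qed
  then show ?thesis using v Av low by blast
qed

subsection \<open>Functions of finitely many coordinates\<close>

lemma grad_in_Rn:
  assumes "function_on_Rn d f" and d: "GDERIV f x :> grad f x"
  shows "grad f x \<in> Rn d"
proof -
  define w where "w = grad f x - trunc d (grad f x)"
  have "f (x + t *\<^sub>R w) = f x" for t
  proof -
    have "trunc d (x + t *\<^sub>R w) = trunc d x" by (rule rvec_eqI) (simp add: w_def)
    then show ?thesis using assms(1) by (metis function_on_Rn_def)
  qed
  moreover have "((\<lambda>t. f (x + t *\<^sub>R w)) has_real_derivative (grad f x \<bullet> w)) (at 0)"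
    by (rule gderiv_line) (simp add: d)
  ultimately have "grad f x \<bullet> w = 0"
    using DERIV_unique[OF DERIV_const[of "f x" "at 0"]] by simp
  moreover have "trunc d (grad f x) \<bullet> w = 0"
    unfolding inner_trunc by (subst inner_commute) (simp add: w_def inner_Rn[of _ d])
  ultimately have "w \<bullet> w = 0" by (simp add: w_def inner_diff_left)
  then show ?thesis by (simp add: w_def Rn_iff_trunc)
qed

lemma hess_in_Rn:
  assumes f: "function_on_Rn d f" and lh: "lipschitz_hessian M f" "0 \<le> M"
  shows "hess f x u \<in> Rn d"
proof -
  have "coord (hess f x u) i = 0" if "d \<le> i" for i
  proof -
    have "grad f y \<bullet> unit_rvec i = 0" for y
      using grad_in_Rn[OF f lh_gderiv[OF lh]] that by (simp add: inner_unit inner_commute Rn_def)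
    then have "((\<lambda>t. 0) has_real_derivative (hess f (x + 0 *\<^sub>R u) u \<bullet> unit_rvec i)) (at 0)"
      using grad_line_derivative[OF lh, of x u "unit_rvec i" 0 UNIV] by simp
    then have "hess f x u \<bullet> unit_rvec i = 0"
      using DERIV_unique[OF DERIV_const[of 0 "at 0"]] by simp
    then show ?thesis by (simp add: inner_unit inner_commute)
  qed
  then show ?thesis by (simp add: Rn_def)
qed

text \<open>The Hessian vanishes on the orthogonal complement of \<open>Rn d\<close>, so a lower bound on it at \<open>Rn d\<close>
  that is nonpositive holds for all directions in \<open>rvec\<close>.\<close>

lemma hess_trunc:
  assumes f: "function_on_Rn d f" and lh: "lipschitz_hessian M f" "0 \<le> M"
  shows "u \<bullet> hess f x u = trunc d u \<bullet> hess f x (trunc d u)"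
proof -
  have "u \<bullet> hess f x u = trunc d u \<bullet> hess f x u"
    using hess_in_Rn[OF assms, of x u] by (simp add: inner_trunc Rn_iff_trunc)
  also have "\<dots> = hess f x (trunc d u) \<bullet> u"
    using hess_symmetric[OF lh, of x "trunc d u" u] by simp
  also have "\<dots> = hess f x (trunc d u) \<bullet> trunc d u"
    using hess_in_Rn[OF assms, of x "trunc d u"] by (metis Rn_iff_trunc inner_trunc)
  finally show ?thesis by (simp add: inner_commute)
qed

lemma lambda_min_hess:
  assumes "1 \<le> d" and f: "function_on_Rn d f" and lh: "lipschitz_hessian M f" "0 \<le> M"
  obtains v where "v \<in> Rn d" "norm v = 1" "hess f x v = lambda_min d (hess f x) *\<^sub>R v"
    "\<And>u. u \<in> Rn d \<Longrightarrow> lambda_min d (hess f x) * (norm u)\<^sup>2 \<le> u \<bullet> hess f x u"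
  using lambda_min_minimizer[OF \<open>1 \<le> d\<close> bounded_linear_hess[OF lh] hess_in_Rn[OF f lh]
      hess_symmetric[OF lh], of x] by blast

lemma hess_lower_bound:
  assumes "1 \<le> d" and f: "function_on_Rn d f" and lh: "lipschitz_hessian M f" "0 \<le> M"
    and l: "- l \<le> lambda_min d (hess f x)" "0 \<le> l"
  shows "- l * (norm u)\<^sup>2 \<le> hess f x u \<bullet> u"
proof -
  have "- l * (norm u)\<^sup>2 \<le> - l * (norm (trunc d u))\<^sup>2"
    using l(2) norm_trunc_le[of d u] by (simp add: mult_left_mono power_mono)
  also have "\<dots> \<le> lambda_min d (hess f x) * (norm (trunc d u))\<^sup>2"
    by (intro mult_right_mono l) simp
  also have "\<dots> \<le> trunc d u \<bullet> hess f x (trunc d u)"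
    using lambda_min_hess[OF assms(1-4), of x] trunc_in_Rn by metis
  finally show ?thesis by (simp add: hess_trunc[OF f lh, of u] inner_commute)
qed

text \<open>Weyl's inequality, by testing the form at \<open>x\<close> with an eigenvector at
  \<open>y\<close>. It makes the smallest eigenvalue continuous, hence the event of a good seed
  measurable.\<close>

lemma lambda_min_hess_lipschitz:
  assumes "1 \<le> d" and f: "function_on_Rn d f" and lh: "lipschitz_hessian M f" "0 \<le> M"
  shows "lambda_min d (hess f x) - M * norm (y - x) \<le> lambda_min d (hess f y)"
proof -
  obtain v where v: "v \<in> Rn d" "norm v = 1" "hess f y v = lambda_min d (hess f y) *\<^sub>R v"
    using lambda_min_hess[OF assms] by blast
  have "lambda_min d (hess f x) * (norm v)\<^sup>2 \<le> v \<bullet> hess f x v"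
    using lambda_min_hess[OF assms] v(1) by metis
  then have "lambda_min d (hess f x) - M * norm (y - x) \<le> hess f y v \<bullet> v"
    using hess_lower_shift[OF lh, of x v y] v(2) by (simp add: inner_commute)
  also have "\<dots> = lambda_min d (hess f y)"
    using v(2) by (simp add: v(3) flip: power2_norm_eq_inner)
  finally show ?thesis .
qed

lemma continuous_on_lambda_min_hess:
  assumes "1 \<le> d" and f: "function_on_Rn d f" and lh: "lipschitz_hessian M f" "0 \<le> M"
  shows "continuous_on UNIV (\<lambda>x. lambda_min d (hess f x))"
proof (rule continuous_at_imp_continuous_on, intro ballI)
  fix x
  have "((\<lambda>y. lambda_min d (hess f y) - lambda_min d (hess f x)) \<longlongrightarrow> 0) (at x)"
  proof (rule Lim_null_comparison)
    show "\<forall>\<^sub>F y in at x. norm (lambda_min d (hess f y) - lambda_min d (hess f x)) \<le> M * norm (y - x)"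
      using lambda_min_hess_lipschitz[OF assms, of x] lambda_min_hess_lipschitz[OF assms, of _ x]
      by (intro always_eventually allI) (smt (verit) norm_minus_commute real_norm_def)
    show "((\<lambda>y. M * norm (y - x)) \<longlongrightarrow> 0) (at x)" by (auto intro!: tendsto_eq_intros)
  qed
  then show "isCont (\<lambda>x. lambda_min d (hess f x)) x"
    by (simp add: isCont_def LIM_zero_iff)
qed

subsection \<open>A countable base\<close>

text \<open>Without it, sums and pairs of Borel functions need not be Borel functions.\<close>

primrec rat_rvecs :: "nat \<Rightarrow> rvec set" where
  "rat_rvecs 0 = {0}"
| "rat_rvecs (Suc n) = (\<lambda>(y, q). y + real_of_rat q *\<^sub>R unit_rvec n) ` (rat_rvecs n \<times> UNIV)"

lemma countable_rat_rvecs: "countable (rat_rvecs n)"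
  by (induction n) auto

lemma rat_rvecs_dense:
  assumes "x \<in> Rn n" "0 < e"
  shows "\<exists>y\<in>rat_rvecs n. norm (x - y) < e"
  using assms
proof (induction n arbitrary: x e)
  case 0
  then have "x = 0" by (intro rvec_eqI) (simp add: Rn_def)
  then show ?case using 0 by simp
next
  case (Suc n)
  obtain z s where z: "z \<in> Rn n" and x: "x = z + s *\<^sub>R unit_rvec n"
    using Suc.prems(1) unfolding Rn_Suc_split by blast
  obtain y where y: "y \<in> rat_rvecs n" "norm (z - y) < e / 2"
    using Suc.IH[OF z, of "e / 2"] Suc.prems(2) by auto
  obtain q where q: "s < of_rat q" "of_rat q < s + e / 2"
    using of_rat_dense[of s "s + e / 2"] Suc.prems(2) by auto
  have "x - (y + of_rat q *\<^sub>R unit_rvec n) = (z - y) + (s - of_rat q) *\<^sub>R unit_rvec n"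
    by (simp add: x algebra_simps)
  then have "norm (x - (y + of_rat q *\<^sub>R unit_rvec n)) \<le> norm (z - y) + \<bar>s - of_rat q\<bar>"
    by (metis mult.right_neutral norm_scaleR norm_triangle_ineq norm_unit)
  also have "\<dots> < e" using y(2) q by simp
  finally show ?case using y(1) by force
qed

instance rvec :: second_countable_topology
proof
  define D where "D = (\<Union>n. rat_rvecs n)"
  define B where "B = (\<lambda>(x, n). ball x (1 / real (Suc n))) ` (D \<times> UNIV)"
  have dense: "\<exists>y\<in>D. norm (x - y) < e" if "0 < e" for x e
    using ex_Rn[of x] rat_rvecs_dense[OF _ that] unfolding D_def by blast
  have "countable B"
    unfolding B_def D_def by (intro countable_image countable_SIGMA countable_UN countable_rat_rvecs) auto
  moreover have "topological_basis B"
  proof (rule topological_basisI)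
    fix b assume "b \<in> B" then show "open b" by (auto simp: B_def)
  next
    fix S :: "rvec set" and x assume "open S" "x \<in> S"
    then obtain e where e: "0 < e" "ball x e \<subseteq> S" by (auto simp: open_contains_ball)
    obtain n where n: "1 / real (Suc n) < e / 2"
      using reals_Archimedean[of "e / 2"] e(1) by (auto simp: inverse_eq_divide)
    obtain y where y: "y \<in> D" "norm (x - y) < 1 / real (Suc n)"
      using dense[of "1 / real (Suc n)" x] by auto
    have "ball y (1 / real (Suc n)) \<subseteq> ball x e"
    proof
      fix w assume "w \<in> ball y (1 / real (Suc n))"
      then show "w \<in> ball x e"
        using y(2) n dist_triangle[of x w y] by (simp add: dist_norm)
    qed
    moreover have "x \<in> ball y (1 / real (Suc n))"
      using y(2) by (simp add: dist_norm norm_minus_commute)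
    moreover have "ball y (1 / real (Suc n)) \<in> B"
      using y(1) by (auto simp: B_def)
    ultimately show "\<exists>b\<in>B. x \<in> b \<and> b \<subseteq> S" using e(2) by blast
  qed
  ultimately show "\<exists>B::rvec set set. countable B \<and> open = generate_topology B"
    using topological_basis_imp_subbasis by blast
qed

section \<open>The penalized function\<close>

text \<open>The displacement of \<open>x\<close> from its projection onto the ball of radius \<open>r\<close> around the origin.\<close>

definition shrink :: "real \<Rightarrow> 'a::real_inner \<Rightarrow> 'a" where
  "shrink r x = (max (norm x - r) 0 / norm x) *\<^sub>R x"

lemma norm_shrink: "0 < r \<Longrightarrow> norm (shrink r x) = max (norm x - r) 0"
  by (simp add: shrink_def)

lemma shrink_inside: "norm x \<le> r \<Longrightarrow> shrink r x = 0"
  by (simp add: shrink_def)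

lemma shrink_outside: "0 < r \<Longrightarrow> r \<le> norm x \<Longrightarrow> x - shrink r x = (r / norm x) *\<^sub>R x"
proof -
  assume "0 < r" "r \<le> norm x"
  then have "x - shrink r x = (1 - (norm x - r) / norm x) *\<^sub>R x"
    by (simp add: shrink_def scaleR_left_diff_distrib)
  also have "1 - (norm x - r) / norm x = r / norm x"
    using \<open>0 < r\<close> \<open>r \<le> norm x\<close> by (auto simp: diff_divide_distrib)
  finally show ?thesis .
qed

lemma norm_diff_shrink_le: "0 < r \<Longrightarrow> norm (x - shrink r x) \<le> r"
  by (cases "norm x \<le> r") (auto simp: shrink_inside shrink_outside)

text \<open>The variational inequality of the metric projection \<open>x - shrink r x\<close> onto
  the ball, tested at a point \<open>p\<close> of the ball.\<close>

lemma shrink_variational: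
  assumes "0 < r" "norm p \<le> r"
  shows "shrink r x \<bullet> (p - (x - shrink r x)) \<le> 0"
proof (cases "norm x \<le> r")
  case False
  have "x \<bullet> p \<le> norm x * r"
    using norm_cauchy_schwarz[of x p] assms by (meson mult_left_mono norm_ge_zero order_trans)
  moreover have "x \<bullet> (p - (x - shrink r x)) = x \<bullet> p - norm x * r"
    using False assms
    by (simp add: shrink_outside inner_diff_right power2_eq_square flip: power2_norm_eq_inner)
  ultimately have "x \<bullet> (p - (x - shrink r x)) \<le> 0" by simp
  then show ?thesis
    unfolding shrink_def[of r x, THEN arg_cong[where f = "\<lambda>q. q \<bullet> (p - (x - shrink r x))"]] inner_scaleR_left
    by (intro mult_nonneg_nonpos) auto
qed (simp add: shrink_inside)

text \<open>Firm nonexpansiveness: the sum of the variational inequalities at \<open>x\<close> and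
  at \<open>y\<close>, each tested at the projection of the other point.\<close>

lemma shrink_firm:
  assumes "0 < r"
  shows "(norm (shrink r x - shrink r y))\<^sup>2 \<le> (shrink r x - shrink r y) \<bullet> (x - y)"
proof -
  have "shrink r x \<bullet> ((y - shrink r y) - (x - shrink r x)) \<le> 0"
    "shrink r y \<bullet> ((x - shrink r x) - (y - shrink r y)) \<le> 0"
    by (intro shrink_variational norm_diff_shrink_le assms)+
  then show ?thesis
    by (simp add: power2_norm_eq_inner inner_diff_left inner_diff_right inner_commute)
qed

lemma shrink_monotone: "0 < r \<Longrightarrow> 0 \<le> (shrink r x - shrink r y) \<bullet> (x - y)"
  using shrink_firm[of r x y] by (meson order_trans zero_le_power2)

lemma shrink_nonexpansive:
  assumes "0 < r"
  shows "norm (shrink r x - shrink r y) \<le> norm (x - y)"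
proof -
  have "(norm (shrink r x - shrink r y))\<^sup>2 \<le> norm (shrink r x - shrink r y) * norm (x - y)"
    using shrink_firm[OF assms] norm_cauchy_schwarz by (rule order_trans)
  then show ?thesis
    by (cases "shrink r x = shrink r y") (auto simp: power2_eq_square)
qed

text \<open>Outside the doubled ball both ratios \<open>r / norm x\<close> and
  \<open>r / norm y\<close> are at most 1/2, so the projection contributes at most half of
  \<open>|x - y|^2\<close>. Multiplied by the \<open>2 L\<close> of the penalty, the remaining half
  cancels the \<open>- L\<close> of an \<open>L\<close>-smooth function.\<close>

lemma shrink_strongly_monotone:
  assumes "0 < r" "2 * r \<le> norm x" "2 * r \<le> norm y"
  shows "(norm (x - y))\<^sup>2 / 2 \<le> (shrink r x - shrink r y) \<bullet> (x - y)"
proof -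
  define a b s where "a = norm x" and "b = norm y" and "s = x \<bullet> y"
  have pos: "0 < a" "0 < b" and ab: "2 * r \<le> a" "2 * r \<le> b" using assms by (auto simp: a_def b_def)
  have "r / a \<le> 1 / 2" "r / b \<le> 1 / 2" using pos ab by (auto simp: field_simps)
  then have c: "r / a + r / b \<le> 1" by linarith
  have s: "s \<le> a * b" unfolding a_def b_def s_def by (rule norm_cauchy_schwarz)
  have xx: "x \<bullet> x = a * a" "y \<bullet> y = b * b"
    by (simp_all add: a_def b_def power2_eq_square flip: power2_norm_eq_inner)
  have n: "(norm (x - y))\<^sup>2 = a * a + b * b - 2 * s"
    unfolding power2_norm_eq_inner by (simp add: inner_diff_left inner_diff_right inner_commute[of y x] xx s_def)
  have "((x - shrink r x) - (y - shrink r y)) \<bullet> (x - y) = (r / a) * (a * a - s) - (r / b) * (s - b * b)"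
    using assms
    by (simp add: shrink_outside inner_diff_left inner_diff_right inner_commute[of y x] xx s_def
        right_diff_distrib flip: a_def b_def)
  also have "\<dots> = (r / a + r / b) * (a * b - s)"
    using pos by (simp add: field_simps)
  also have "\<dots> \<le> 1 * (a * b - s)"
    using s by (intro mult_right_mono c) auto
  also have "\<dots> \<le> (norm (x - y))\<^sup>2 / 2"
    using zero_le_square[of "a - b"] by (simp add: n algebra_simps)
  finally show ?thesis
    unfolding power2_norm_eq_inner by (simp add: inner_diff_left inner_diff_right)
qed

lemma GDERIV_quadratic_error:
  fixes f :: "'a::real_inner \<Rightarrow> real"
  assumes "\<And>y. \<bar>f y - f x - D \<bullet> (y - x)\<bar> \<le> C * (norm (y - x))\<^sup>2"
  shows "GDERIV f x :> D"
  unfolding gderiv_def has_derivative_at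
proof
  show "bounded_linear (\<lambda>h. h \<bullet> D)" by (rule bounded_linear_inner_left)
  show "((\<lambda>h. norm (f (x + h) - f x - h \<bullet> D) / norm h) \<longlongrightarrow> 0) (at 0)"
  proof (rule Lim_null_comparison)
    show "\<forall>\<^sub>F h in at 0. norm (norm (f (x + h) - f x - h \<bullet> D) / norm h) \<le> C * norm h"
      using assms[of "x + h" for h]
      by (intro always_eventually allI)
        (auto simp: divide_le_eq power2_eq_square inner_commute[of D] mult.assoc)
    show "((\<lambda>h. C * norm h) \<longlongrightarrow> 0) (at (0::'a))" by (auto intro!: tendsto_eq_intros)
  qed
qed

lemma GDERIV_dist_square: "GDERIV (\<lambda>w. (norm (w - z))\<^sup>2) x :> 2 *\<^sub>R (x - z)"
proof (rule GDERIV_quadratic_error)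
  fix y
  have "(norm (y - z))\<^sup>2 - (norm (x - z))\<^sup>2 - (2 *\<^sub>R (x - z)) \<bullet> (y - x) = (norm (y - x))\<^sup>2"
    unfolding power2_norm_eq_inner by (simp add: inner_diff_left inner_diff_right inner_commute)
  then show "\<bar>(norm (y - z))\<^sup>2 - (norm (x - z))\<^sup>2 - (2 *\<^sub>R (x - z)) \<bullet> (y - x)\<bar> \<le> 1 * (norm (y - x))\<^sup>2"
    by simp
qed

text \<open>A two-sided quadratic error avoids differentiating the norm at the centre and the
  maximum on the sphere. The upper estimate measures the distance of \<open>b\<close> to the ball by
  the projection of \<open>a\<close>; the lower one is the upper estimate with the points exchanged,
  combined with monotonicity of \<open>shrink\<close>.\<close>

lemma GDERIV_ball_dist_square:
  assumes "0 < r"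
  shows "GDERIV (\<lambda>x. (max (norm x - r) 0)\<^sup>2) x :> 2 *\<^sub>R shrink r x"
proof (rule GDERIV_quadratic_error)
  fix y
  have upper: "(norm (shrink r b))\<^sup>2 \<le> (norm (shrink r a))\<^sup>2 + 2 * (shrink r a \<bullet> (b - a)) + (norm (b - a))\<^sup>2"
    for a b :: 'a
  proof -
    define p where "p = a - shrink r a"
    have "shrink r b \<bullet> (p - (b - shrink r b)) \<le> 0"
      unfolding p_def by (intro shrink_variational norm_diff_shrink_le assms)
    then have "(norm (shrink r b))\<^sup>2 \<le> shrink r b \<bullet> (b - p)"
      by (simp add: power2_norm_eq_inner inner_diff_right)
    also have "\<dots> \<le> norm (shrink r b) * norm (b - p)" by (rule norm_cauchy_schwarz)
    finally have "norm (shrink r b) \<le> norm (b - p)"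
      by (cases "shrink r b = 0") (auto simp: power2_eq_square)
    then have "(norm (shrink r b))\<^sup>2 \<le> (norm (b - p))\<^sup>2" by (simp add: power_mono)
    also have "b - p = shrink r a + (b - a)" by (simp add: p_def)
    also have "(norm (shrink r a + (b - a)))\<^sup>2 =
        (norm (shrink r a))\<^sup>2 + 2 * (shrink r a \<bullet> (b - a)) + (norm (b - a))\<^sup>2"
      unfolding power2_norm_eq_inner by (simp add: inner_add_left inner_add_right inner_commute)
    finally show ?thesis .
  qed
  have "\<bar>(norm (shrink r y))\<^sup>2 - (norm (shrink r x))\<^sup>2 - (2 *\<^sub>R shrink r x) \<bullet> (y - x)\<bar> \<le> 1 * (norm (y - x))\<^sup>2"
    using upper[of y x] upper[of x y] shrink_monotone[OF assms, of x y]
    by (simp add: abs_le_iff norm_minus_commute[of x y] inner_diff_left inner_diff_right)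
  then show "\<bar>(max (norm y - r) 0)\<^sup>2 - (max (norm x - r) 0)\<^sup>2 - (2 *\<^sub>R shrink r x) \<bullet> (y - x)\<bar>
      \<le> 1 * (norm (y - x))\<^sup>2"
    by (simp add: norm_shrink assms)
qed

lemma GDERIV_shift:
  assumes "GDERIV f (x - z) :> D"
  shows "GDERIV (\<lambda>x. f (x - z)) x :> D"
proof -
  have "((\<lambda>x. x - z) has_derivative (\<lambda>h. h)) (at x)" by (auto intro!: derivative_eq_intros)
  from has_derivative_compose[OF this assms[unfolded gderiv_def]] show ?thesis
    by (simp add: gderiv_def)
qed

lemma GDERIV_cmult: "GDERIV f x :> D \<Longrightarrow> GDERIV (\<lambda>x. c * f x) x :> c *\<^sub>R D"
  using GDERIV_mult[OF GDERIV_const] by fastforce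

text \<open>A pair on different sides is split at a point \<open>w\<close> where the segment meets
  the sphere. Both pieces have the direction of \<open>y - x\<close>, so their estimates add up with
  weights \<open>t\<close> and \<open>1 - t\<close>. A pair of outer points is covered by the
  hypothesis even if its segment crosses the ball.\<close>

lemma monotone_grad_two_regions:
  fixes G :: "'a::real_inner \<Rightarrow> 'a"
  assumes inside: "\<And>x y. norm (x - c) \<le> R \<Longrightarrow> norm (y - c) \<le> R \<Longrightarrow>
      \<mu> * (norm (y - x))\<^sup>2 \<le> (G y - G x) \<bullet> (y - x)"
    and outside: "\<And>x y. R \<le> norm (x - c) \<Longrightarrow> R \<le> norm (y - c) \<Longrightarrow>
      \<mu> * (norm (y - x))\<^sup>2 \<le> (G y - G x) \<bullet> (y - x)"
  shows "\<mu> * (norm (y - x))\<^sup>2 \<le> (G y - G x) \<bullet> (y - x)"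
proof -
  have mixed: "\<mu> * (norm (y - x))\<^sup>2 \<le> (G y - G x) \<bullet> (y - x)"
    if x: "norm (x - c) \<le> R" and y: "R \<le> norm (y - c)" for x y
  proof -
    let ?u = "y - x"
    have "\<exists>t\<ge>0. t \<le> 1 \<and> norm (x + t *\<^sub>R ?u - c) = R"
      by (rule IVT') (use x y in \<open>auto intro!: continuous_intros\<close>)
    then obtain t where t: "0 \<le> t" "t \<le> 1" "norm (x + t *\<^sub>R ?u - c) = R" by blast
    define w where "w = x + t *\<^sub>R ?u"
    have scale: "\<mu> * s * (norm ?u)\<^sup>2 \<le> (G b - G a) \<bullet> ?u"
      if "\<mu> * (norm (b - a))\<^sup>2 \<le> (G b - G a) \<bullet> (b - a)" "b - a = s *\<^sub>R ?u" "0 \<le> s" for a b s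
    proof (cases "s = 0")
      case False
      then have "s * (\<mu> * s * (norm ?u)\<^sup>2) \<le> s * ((G b - G a) \<bullet> ?u)"
        using that(1,3) unfolding that(2) by (simp add: power_mult_distrib power2_eq_square mult_ac)
      then show ?thesis using False that(3) by simp
    qed (use that in simp)
    have "\<mu> * t * (norm ?u)\<^sup>2 \<le> (G w - G x) \<bullet> ?u"
      by (rule scale) (use inside[OF x, of w] t in \<open>auto simp: w_def\<close>)
    moreover have "\<mu> * (1 - t) * (norm ?u)\<^sup>2 \<le> (G y - G w) \<bullet> ?u"
      by (rule scale) (use outside[OF _ y, of w] t in \<open>auto simp: w_def scaleR_left_diff_distrib\<close>)
    ultimately show ?thesis by (simp add: inner_diff_left algebra_simps)
  qed
  consider "norm (x - c) \<le> R" "norm (y - c) \<le> R" | "R \<le> norm (x - c)" "R \<le> norm (y - c)"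
    | "norm (x - c) \<le> R" "R \<le> norm (y - c)" | "R \<le> norm (x - c)" "norm (y - c) \<le> R"
    by linarith
  then show ?thesis
  proof cases
    case 4
    have "(G y - G x) \<bullet> (y - x) = (G x - G y) \<bullet> (x - y)" by (simp add: inner_diff_left inner_diff_right)
    then show ?thesis using mixed[OF 4(2,1)] by (simp add: norm_minus_commute)
  qed (use inside outside mixed in blast)+
qed

section \<open>The penalized objective of one outer iteration\<close>

definition penalized :: "('a::real_inner \<Rightarrow> real) \<Rightarrow> real \<Rightarrow> real \<Rightarrow> 'a \<Rightarrow> 'a \<Rightarrow> real" where
  "penalized f L r c = (\<lambda>w. f w + L * (max (norm (w - c) - r) 0)\<^sup>2)"

definition penalized_grad :: "('a::real_inner \<Rightarrow> real) \<Rightarrow> real \<Rightarrow> real \<Rightarrow> 'a \<Rightarrow> 'a \<Rightarrow> 'a" where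
  "penalized_grad f L r c w = grad f w + (2 * L) *\<^sub>R shrink r (w - c)"

lemma GDERIV_penalized:
  assumes "GDERIV f w :> grad f w" "0 < r"
  shows "GDERIV (penalized f L r c) w :> penalized_grad f L r c w"
proof -
  have "GDERIV (\<lambda>w. (max (norm (w - c) - r) 0)\<^sup>2) w :> 2 *\<^sub>R shrink r (w - c)"
    using GDERIV_shift[OF GDERIV_ball_dist_square[OF assms(2)]] .
  from GDERIV_add[OF assms(1) GDERIV_cmult[OF this, of L]]
  show ?thesis unfolding penalized_def penalized_grad_def by (simp add: mult.commute)
qed

lemma penalized_grad_lipschitz:
  assumes "\<And>x y. norm (grad f x - grad f y) \<le> L * norm (x - y)" "0 < r" "0 \<le> L"
  shows "norm (penalized_grad f L r c x - penalized_grad f L r c y) \<le> 3 * L * norm (x - y)"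
proof -
  have "penalized_grad f L r c x - penalized_grad f L r c y =
      (grad f x - grad f y) + (2 * L) *\<^sub>R (shrink r (x - c) - shrink r (y - c))"
    by (simp add: penalized_grad_def scaleR_right_diff_distrib)
  also have "norm \<dots> \<le> L * norm (x - y) + 2 * L * norm (x - y)"
    using assms(1)[of x y] mult_left_mono[OF shrink_nonexpansive[OF assms(2), of "x - c" "y - c"], of "2 * L"] assms(3)
    by (intro order_trans[OF norm_triangle_ineq] add_mono) auto
  finally show ?thesis by simp
qed

lemma penalized_grad_center: "0 < r \<Longrightarrow> penalized_grad f L r c c = grad f c"
  by (simp add: penalized_grad_def shrink_inside)

lemma penalized_grad_monotone:
  assumes lip: "\<And>x y. norm (grad f x - grad f y) \<le> L * norm (x - y)"
    and lh: "lipschitz_hessian M f" and "0 < M" "0 < \<alpha>" "0 \<le> L"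
    and curv: "\<And>u. - \<alpha> * (norm u)\<^sup>2 \<le> hess f c u \<bullet> u"
  shows "- (3 * \<alpha>) * (norm (y - x))\<^sup>2 \<le>
    (penalized_grad f L (\<alpha> / M) c y - penalized_grad f L (\<alpha> / M) c x) \<bullet> (y - x)"
proof (rule monotone_grad_two_regions[where c = c and R = "2 * (\<alpha> / M)"])
  let ?r = "\<alpha> / M"
  have r: "0 < ?r" using assms by simp
  have split: "(penalized_grad f L ?r c y - penalized_grad f L ?r c x) \<bullet> (y - x) =
      (grad f y - grad f x) \<bullet> (y - x) +
      2 * L * ((shrink ?r (y - c) - shrink ?r (x - c)) \<bullet> ((y - c) - (x - c)))" for x y
    by (simp add: penalized_grad_def inner_diff_left inner_add_left algebra_simps)
  {
    fix x y assume x: "norm (x - c) \<le> 2 * ?r" and y: "norm (y - c) \<le> 2 * ?r"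
    have "- (3 * \<alpha>) * (norm (y - x))\<^sup>2 \<le> (grad f y - grad f x) \<bullet> (y - x)"
    proof (rule grad_monotone_of_hess[OF lh])
      show "0 \<le> M" using assms by simp
      fix t :: real assume t: "0 \<le> t" "t \<le> 1"
      let ?w = "x + t *\<^sub>R (y - x)"
      have "norm (?w - c) = norm ((1 - t) *\<^sub>R (x - c) + t *\<^sub>R (y - c))"
        by (simp add: algebra_simps)
      also have "\<dots> \<le> (1 - t) * (2 * ?r) + t * (2 * ?r)"
        using t by (intro order_trans[OF norm_triangle_ineq] add_mono)
          (simp_all del: times_divide_eq_right add: mult_left_mono x y)
      also have "\<dots> = 2 * ?r" by (simp only: left_diff_distrib)
      finally have "M * norm (?w - c) * (norm (y - x))\<^sup>2 \<le> M * (2 * ?r) * (norm (y - x))\<^sup>2"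
        using assms(3) by (intro mult_right_mono mult_left_mono) auto
      also have "\<dots> = 2 * \<alpha> * (norm (y - x))\<^sup>2" using assms(3) by simp
      finally show "- (3 * \<alpha>) * (norm (y - x))\<^sup>2 \<le> hess f ?w (y - x) \<bullet> (y - x)"
        using hess_lower_shift[OF lh, of c "y - x" ?w] curv[of "y - x"] assms(3) by simp
    qed
    moreover have "0 \<le> 2 * L * ((shrink ?r (y - c) - shrink ?r (x - c)) \<bullet> ((y - c) - (x - c)))"
      using assms(5) by (intro mult_nonneg_nonneg shrink_monotone[OF r]) auto
    ultimately show "- (3 * \<alpha>) * (norm (y - x))\<^sup>2 \<le>
        (penalized_grad f L ?r c y - penalized_grad f L ?r c x) \<bullet> (y - x)"
      unfolding split by simp
  }
  {
    fix x y assume x: "2 * ?r \<le> norm (x - c)" and y: "2 * ?r \<le> norm (y - c)"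
    have "\<bar>(grad f y - grad f x) \<bullet> (y - x)\<bar> \<le> norm (grad f y - grad f x) * norm (y - x)"
      by (rule Cauchy_Schwarz_ineq2)
    also have "\<dots> \<le> L * norm (y - x) * norm (y - x)" by (intro mult_right_mono lip) simp
    finally have "- L * (norm (y - x))\<^sup>2 \<le> (grad f y - grad f x) \<bullet> (y - x)"
      by (simp add: power2_eq_square)
    moreover have "L * (norm (y - x))\<^sup>2 \<le>
        2 * L * ((shrink ?r (y - c) - shrink ?r (x - c)) \<bullet> ((y - c) - (x - c)))"
      using mult_left_mono[OF shrink_strongly_monotone[OF r y x], of "2 * L"] assms(5) by simp
    moreover have "0 \<le> 3 * \<alpha> * (norm (y - x))\<^sup>2" using assms by simp
    ultimately show "- (3 * \<alpha>) * (norm (y - x))\<^sup>2 \<le>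
        (penalized_grad f L ?r c y - penalized_grad f L ?r c x) \<bullet> (y - x)"
      unfolding split by simp
  }
qed

section \<open>Accelerated gradient descent\<close>

text \<open>The point in the norm is the auxiliary sequence \<open>w\<close> of Nesterov's method, recovered from
  \<open>z = (y + \<theta> w) / (1 + \<theta>)\<close>.\<close>

definition lyapunov :: "('a::real_inner \<Rightarrow> real) \<Rightarrow> real \<Rightarrow> real \<Rightarrow> 'a \<Rightarrow> 'a \<Rightarrow> 'a \<Rightarrow> real" where
  "lyapunov g \<sigma> \<theta> u y z = g y - g u + \<sigma> / 2 * (norm ((1 / \<theta>) *\<^sub>R ((1 + \<theta>) *\<^sub>R z - y) - u))\<^sup>2"

lemma norm_convex_combination:
  fixes a b :: "'a::real_inner"
  assumes "0 \<le> \<theta>" "\<theta> \<le> 1"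
  shows "(norm ((1 - \<theta>) *\<^sub>R b + \<theta> *\<^sub>R a))\<^sup>2 \<le> (1 - \<theta>) * (norm b)\<^sup>2 + \<theta> * (norm a)\<^sup>2"
proof -
  have "(1 - \<theta>) * (norm b)\<^sup>2 + \<theta> * (norm a)\<^sup>2 - (norm ((1 - \<theta>) *\<^sub>R b + \<theta> *\<^sub>R a))\<^sup>2
      = \<theta> * (1 - \<theta>) * (norm (a - b))\<^sup>2"
    unfolding power2_norm_eq_inner
    by (simp add: inner_add_left inner_add_right inner_diff_left inner_diff_right
        inner_commute[of b a]) (simp add: algebra_simps)
  also have "\<dots> \<ge> 0" using assms by simp
  finally show ?thesis by simp
qed

text \<open>The decay holds for every comparison point \<open>u\<close>, not only for a minimizer of \<open>g\<close>.\<close>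

lemma lyapunov_decrease:
  fixes g :: "'a::real_inner \<Rightarrow> real"
  assumes d: "\<And>x. GDERIV g x :> Gd x"
    and lip: "\<And>x y. norm (Gd y - Gd x) \<le> L * norm (y - x)"
    and strong: "\<And>x y. g x + Gd x \<bullet> (y - x) + \<sigma> / 2 * (norm (y - x))\<^sup>2 \<le> g y"
    and pos: "0 < \<sigma>" "0 < L" and \<theta>: "0 < \<theta>" "\<theta> \<le> 1" "\<theta>\<^sup>2 = \<sigma> / L"
    and m: "m = (1 - \<theta>) / (1 + \<theta>)" and y': "y' = z - (1 / L) *\<^sub>R Gd z"
    and z': "z' = (1 + m) *\<^sub>R y' - m *\<^sub>R y"
  shows "lyapunov g \<sigma> \<theta> u y' z' \<le> (1 - \<theta>) * lyapunov g \<sigma> \<theta> u y z"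
proof -
  define w where "w = (1 / \<theta>) *\<^sub>R ((1 + \<theta>) *\<^sub>R z - y)"
  define a b D where "a = z - u" and "b = w - u" and "D = Gd z"
  have y: "y = (1 + \<theta>) *\<^sub>R z - \<theta> *\<^sub>R w" using \<theta> by (simp add: w_def)
  \<comment> \<open>The auxiliary point is averaged with \<open>z\<close> and moved by a gradient
    step of length \<open>\<theta> / \<sigma>\<close>, which equals \<open>1 / (\<theta> L)\<close>
    by the choice of \<open>\<theta>\<close>.\<close>
  have w': "(1 / \<theta>) *\<^sub>R ((1 + \<theta>) *\<^sub>R z' - y') = (1 - \<theta>) *\<^sub>R w + \<theta> *\<^sub>R z - (\<theta> / \<sigma>) *\<^sub>R D"
  proof -
    have mm: "(1 + \<theta>) * m = 1 - \<theta>" using \<theta> by (simp add: m)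
    have "(1 + \<theta>) *\<^sub>R z' - y' = ((1 + \<theta>) + (1 + \<theta>) * m - 1) *\<^sub>R y' - ((1 + \<theta>) * m) *\<^sub>R y"
      by (simp add: z' algebra_simps)
    also have "\<dots> = y' - (1 - \<theta>) *\<^sub>R y" by (simp add: mm)
    also have "\<dots> = \<theta> *\<^sub>R ((1 - \<theta>) *\<^sub>R w + \<theta> *\<^sub>R z) - (1 / L) *\<^sub>R D"
      by (simp add: y' y D_def algebra_simps power2_eq_square)
    finally have "(1 / \<theta>) *\<^sub>R ((1 + \<theta>) *\<^sub>R z' - y') = (1 - \<theta>) *\<^sub>R w + \<theta> *\<^sub>R z - (1 / (\<theta> * L)) *\<^sub>R D"
      using \<theta> by (simp add: scaleR_right_diff_distrib)
    also have "1 / (\<theta> * L) = \<theta> / \<sigma>" using \<theta> pos by (simp add: field_simps power2_eq_square)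
    finally show ?thesis .
  qed
  have "(norm ((1 / \<theta>) *\<^sub>R ((1 + \<theta>) *\<^sub>R z' - y') - u))\<^sup>2
      = (norm (((1 - \<theta>) *\<^sub>R b + \<theta> *\<^sub>R a) - (\<theta> / \<sigma>) *\<^sub>R D))\<^sup>2"
    unfolding w' by (simp add: a_def b_def algebra_simps)
  also have "\<dots> = (norm ((1 - \<theta>) *\<^sub>R b + \<theta> *\<^sub>R a))\<^sup>2
      - 2 * (\<theta> / \<sigma>) * ((1 - \<theta>) * (D \<bullet> b) + \<theta> * (D \<bullet> a)) + (\<theta> / \<sigma>)\<^sup>2 * (norm D)\<^sup>2"
    unfolding power2_norm_eq_inner inner_diff_left inner_diff_right
    by (simp add: inner_add_left inner_add_right inner_commute power2_eq_square algebra_simps)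
  also have "\<dots> \<le> (1 - \<theta>) * (norm b)\<^sup>2 + \<theta> * (norm a)\<^sup>2
      - 2 * (\<theta> / \<sigma>) * ((1 - \<theta>) * (D \<bullet> b) + \<theta> * (D \<bullet> a)) + (\<theta> / \<sigma>)\<^sup>2 * (norm D)\<^sup>2"
    using norm_convex_combination[of \<theta> b a] \<theta> by simp
  finally have "\<sigma> / 2 * (norm ((1 / \<theta>) *\<^sub>R ((1 + \<theta>) *\<^sub>R z' - y') - u))\<^sup>2
      \<le> \<sigma> / 2 * ((1 - \<theta>) * (norm b)\<^sup>2 + \<theta> * (norm a)\<^sup>2
      - 2 * (\<theta> / \<sigma>) * ((1 - \<theta>) * (D \<bullet> b) + \<theta> * (D \<bullet> a)) + (\<theta> / \<sigma>)\<^sup>2 * (norm D)\<^sup>2)"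
    by (rule mult_left_mono) (use pos in simp)
  also have "\<dots> = (1 - \<theta>) * (\<sigma> / 2 * (norm b)\<^sup>2) + \<theta> * (\<sigma> / 2 * (norm a)\<^sup>2)
      - \<theta> * ((1 - \<theta>) * (D \<bullet> b) + \<theta> * (D \<bullet> a)) + (norm D)\<^sup>2 / (2 * L)"
    using pos by (simp add: power_divide \<theta>(3)) (simp add: field_simps power2_eq_square)
  finally have quad: "\<sigma> / 2 * (norm ((1 / \<theta>) *\<^sub>R ((1 + \<theta>) *\<^sub>R z' - y') - u))\<^sup>2 \<le> \<dots>" .
  have step: "g y' \<le> g z - (norm D)\<^sup>2 / (2 * L)"
    unfolding y' D_def by (rule gradient_step[OF d lip pos(2)])
  have yz: "y - z = \<theta> *\<^sub>R (a - b)" by (simp add: y a_def b_def algebra_simps)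
  have "0 \<le> \<sigma> / 2 * (norm (y - z))\<^sup>2" using pos by simp
  moreover have "D \<bullet> (y - z) = \<theta> * (D \<bullet> a - D \<bullet> b)" by (simp add: yz inner_diff_right)
  ultimately have "g z + \<theta> * (D \<bullet> a - D \<bullet> b) \<le> g y"
    using strong[of z y] unfolding D_def by linarith
  then have y_low: "(1 - \<theta>) * (g z + \<theta> * (D \<bullet> a - D \<bullet> b)) \<le> (1 - \<theta>) * g y"
    by (rule mult_left_mono) (use \<theta> in simp)
  have "g z - D \<bullet> a + \<sigma> / 2 * (norm a)\<^sup>2 \<le> g u"
    using strong[of z u] by (simp add: a_def D_def inner_diff_right norm_minus_commute)
  then have u_low: "\<theta> * (g z - D \<bullet> a + \<sigma> / 2 * (norm a)\<^sup>2) \<le> \<theta> * g u"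
    by (rule mult_left_mono) (use \<theta> in simp)
  \<comment> \<open>Convexity at \<open>z\<close> is used towards \<open>y\<close> with weight
    \<open>1 - \<theta>\<close> and towards \<open>u\<close> with weight \<open>\<theta>\<close>.
    With these weights the inner products with \<open>D\<close>, the term in \<open>norm a\<close>
    and the term \<open>(norm D)^2 / (2 L)\<close> all cancel against \<open>quad\<close> and
    \<open>step\<close>.\<close>
  show ?thesis
    using quad step y_low u_low unfolding lyapunov_def w_def[symmetric] b_def[symmetric]
    by (simp add: algebra_simps)
qed

lemma lyapunov_start:
  fixes g :: "'a::real_inner \<Rightarrow> real"
  assumes "0 < \<theta>"
  shows "lyapunov g \<sigma> \<theta> u y y = g y - g u + \<sigma> / 2 * (norm (y - u))\<^sup>2"
proof -
  have "(1 / \<theta>) *\<^sub>R ((1 + \<theta>) *\<^sub>R y - y) = y" using assms by (simp add: algebra_simps)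
  then show ?thesis by (simp add: lyapunov_def)
qed

text \<open>Bounds the initial Lyapunov value by the initial gradient alone, for every comparison
  point in the sublevel set of the start. This takes the place of the distance to a
  minimizer.\<close>

lemma strong_sublevel:
  fixes g :: "'a::real_inner \<Rightarrow> real"
  assumes strong: "g x + D \<bullet> (u - x) + \<sigma> / 2 * (norm (u - x))\<^sup>2 \<le> g u"
    and "0 < \<sigma>" "g u \<le> g x"
  shows "g x - g u + \<sigma> / 2 * (norm (x - u))\<^sup>2 \<le> 2 * (norm D)\<^sup>2 / \<sigma>"
proof -
  define n where "n = norm (u - x)"
  have "- (D \<bullet> (u - x)) \<le> norm D * n"
    unfolding n_def using Cauchy_Schwarz_ineq2[of D "u - x"] by linarith
  then have *: "g x - g u + \<sigma> / 2 * n\<^sup>2 \<le> norm D * n"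
    using strong by (simp add: n_def)
  then have "\<sigma> / 2 * n\<^sup>2 \<le> norm D * n" using assms(3) by simp
  then have "\<sigma> * n \<le> 2 * norm D"
    by (cases "n = 0") (auto simp: power2_eq_square n_def)
  then have "norm D * n \<le> norm D * (2 * norm D / \<sigma>)"
    using assms(2) by (intro mult_left_mono) (auto simp: field_simps)
  then show ?thesis using * by (simp add: n_def norm_minus_commute power2_eq_square mult_ac)
qed

text \<open>\<open>agd\<close> with a bound on the number of iterations: total and hence a measurable function of its
  arguments. It depends on the objective only through the gradient field \<open>Gd\<close>.\<close>

primrec agd_fuel ::
  "nat \<Rightarrow> (rvec \<Rightarrow> rvec) \<Rightarrow> real \<Rightarrow> real \<Rightarrow> real \<Rightarrow> rvec \<Rightarrow> rvec \<Rightarrow> rvec" where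
  "agd_fuel 0 Gd \<epsilon> L \<kappa> y z = y"
| "agd_fuel (Suc n) Gd \<epsilon> L \<kappa> y z =
    (if norm (Gd y) \<le> \<epsilon> then y
     else let m = (sqrt \<kappa> - 1) / (sqrt \<kappa> + 1); y' = z - (1 / L) *\<^sub>R Gd z
          in agd_fuel n Gd \<epsilon> L \<kappa> y' ((1 + m) *\<^sub>R y' - m *\<^sub>R y))"

text \<open>\<open>k\<close> iterations are done and \<open>n\<close> remain. Hypothesis
  \<open>J\<close> forces the gradient test to succeed once the fuel is used up, so the bounded
  version returns the point of the loop. The invariant ranges over all \<open>u\<close> because two
  comparison points are needed, one of which is known only at the end.\<close>

lemma agd_loop_fuel:
  assumes d: "\<And>x. GDERIV g x :> Gd x"
    and lip: "\<And>x y. norm (Gd y - Gd x) \<le> L * norm (y - x)"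
    and strong: "\<And>x y. g x + Gd x \<bullet> (y - x) + \<sigma> / 2 * (norm (y - x))\<^sup>2 \<le> g y"
    and pos: "0 < \<sigma>" "\<sigma> \<le> L" "0 \<le> \<epsilon>" "0 \<le> G" "0 \<le> A"
    and \<theta>: "\<theta> = 1 / sqrt (L / \<sigma>)"
    and J: "4 * L / \<sigma> * (norm (Gd y1))\<^sup>2 * (1 - \<theta>) ^ J \<le> \<epsilon>\<^sup>2"
    and inv: "\<And>u. lyapunov g \<sigma> \<theta> u y z \<le> (1 - \<theta>) ^ k * lyapunov g \<sigma> \<theta> u y1 y1"
    and "k + n = J"
  shows "\<exists>t'. agd_loop g G A \<epsilon> L (L / \<sigma>) y z t = Some (agd_fuel n Gd \<epsilon> L (L / \<sigma>) y z, t')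
      \<and> t' \<le> t + real n * (2 * G + 8 * A) + G + 3 * A
      \<and> norm (Gd (agd_fuel n Gd \<epsilon> L (L / \<sigma>) y z)) \<le> \<epsilon>
      \<and> g (agd_fuel n Gd \<epsilon> L (L / \<sigma>) y z) \<le> g y1"
  using inv \<open>k + n = J\<close>
proof (induction n arbitrary: k y z t)
  have L: "0 < L" using pos by simp
  have grad: "grad g x = Gd x" for x by (rule grad_eqI[OF d])
  have sq: "1 \<le> sqrt (L / \<sigma>)" using pos by simp
  have \<theta>01: "0 < \<theta>" "\<theta> \<le> 1" using sq by (auto simp: \<theta>)
  have \<theta>2: "\<theta>\<^sup>2 = \<sigma> / L" using pos L by (simp add: \<theta> power_divide)
  have m: "(sqrt (L / \<sigma>) - 1) / (sqrt (L / \<sigma>) + 1) = (1 - \<theta>) / (1 + \<theta>)"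
  proof -
    have "(q - 1) / (q + 1) = (1 - 1 / q) / (1 + 1 / q)" if "1 \<le> q" for q :: real
    proof -
      have "1 - 1 / q = (q - 1) / q" "1 + 1 / q = (q + 1) / q"
        using that by (auto simp: diff_divide_distrib add_divide_distrib)
      then show ?thesis using that by simp
    qed
    then show ?thesis unfolding \<theta> using sq .
  qed
  have below: "g y \<le> g y1"
    if "\<And>u. lyapunov g \<sigma> \<theta> u y z \<le> (1 - \<theta>) ^ k * lyapunov g \<sigma> \<theta> u y1 y1" for k y z
  proof -
    have "0 \<le> \<sigma> / 2 * (norm ((1 / \<theta>) *\<^sub>R ((1 + \<theta>) *\<^sub>R z - y) - y1))\<^sup>2"
      using pos by simp
    then show ?thesis
      using that[of y1] unfolding lyapunov_start[OF \<theta>01(1)] by (simp add: lyapunov_def)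
  qed
  have stop: "\<exists>t'. agd_loop g G A \<epsilon> L (L / \<sigma>) y z t = Some (y, t')
      \<and> t' \<le> t + real n * (2 * G + 8 * A) + G + 3 * A"
    if "norm (Gd y) \<le> \<epsilon>" for y z t and n :: nat
    using that pos by (subst agd_loop.simps) (auto simp: grad)
  {
    case (0 k)
    \<comment> \<open>The gradient step from the last iterate as comparison point turns a small
      Lyapunov value into a small gradient at \<open>y\<close>.\<close>
    let ?u = "y - (1 / L) *\<^sub>R Gd y"
    have yy1: "g y \<le> g y1" by (rule below[OF 0(1)])
    have step: "g ?u \<le> g y - (norm (Gd y))\<^sup>2 / (2 * L)" by (rule gradient_step[OF d lip L])
    moreover have "0 \<le> (norm (Gd y))\<^sup>2 / (2 * L)" using L by simp
    ultimately have uy1: "g ?u \<le> g y1" using yy1 by linarith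
    have "(norm (Gd y))\<^sup>2 / (2 * L) \<le> g y - g ?u" using step by simp
    also have "\<dots> \<le> lyapunov g \<sigma> \<theta> ?u y z" using pos by (simp add: lyapunov_def)
    also have "\<dots> \<le> (1 - \<theta>) ^ J * lyapunov g \<sigma> \<theta> ?u y1 y1" using 0 by simp
    also have "\<dots> \<le> (1 - \<theta>) ^ J * (2 * (norm (Gd y1))\<^sup>2 / \<sigma>)"
      unfolding lyapunov_start[OF \<theta>01(1)] using \<theta>01
      by (intro mult_left_mono strong_sublevel[OF strong] pos uy1) auto
    finally have "(norm (Gd y))\<^sup>2 \<le> (1 - \<theta>) ^ J * (2 * (norm (Gd y1))\<^sup>2 / \<sigma>) * (2 * L)"
      using L by (subst (asm) pos_divide_le_eq) auto
    also have "\<dots> = 4 * L / \<sigma> * (norm (Gd y1))\<^sup>2 * (1 - \<theta>) ^ J" by (simp add: mult_ac)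
    also have "\<dots> \<le> \<epsilon>\<^sup>2" by (rule J)
    finally have "norm (Gd y) \<le> \<epsilon>" using pos(3) by (rule power2_le_imp_le)
    then show ?case using stop[of y z t 0] yy1 unfolding agd_fuel.simps by blast
  next
    case (Suc n k)
    show ?case
    proof (cases "norm (Gd y) \<le> \<epsilon>")
      case True
      then show ?thesis using stop[OF True, of z t "Suc n"] below[OF Suc.prems(1)] by simp
    next
      case False
      define y' where "y' = z - (1 / L) *\<^sub>R Gd z"
      define z' where "z' = (1 + (1 - \<theta>) / (1 + \<theta>)) *\<^sub>R y' - ((1 - \<theta>) / (1 + \<theta>)) *\<^sub>R y"
      have "lyapunov g \<sigma> \<theta> u y' z' \<le> (1 - \<theta>) ^ Suc k * lyapunov g \<sigma> \<theta> u y1 y1" for u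
      proof -
        have "lyapunov g \<sigma> \<theta> u y' z' \<le> (1 - \<theta>) * lyapunov g \<sigma> \<theta> u y z"
          by (rule lyapunov_decrease[OF d lip strong pos(1) L \<theta>01 \<theta>2 refl y'_def z'_def])
        also have "\<dots> \<le> (1 - \<theta>) * ((1 - \<theta>) ^ k * lyapunov g \<sigma> \<theta> u y1 y1)"
          by (intro mult_left_mono Suc.prems) (use \<theta>01 in simp)
        finally show ?thesis by simp
      qed
      from Suc.IH[OF this, of "t + 2 * G + 8 * A"] Suc.prems(2)
      obtain t' where
        "agd_loop g G A \<epsilon> L (L / \<sigma>) y' z' (t + 2 * G + 8 * A) =
           Some (agd_fuel n Gd \<epsilon> L (L / \<sigma>) y' z', t')"
        "t' \<le> (t + 2 * G + 8 * A) + real n * (2 * G + 8 * A) + G + 3 * A"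
        "norm (Gd (agd_fuel n Gd \<epsilon> L (L / \<sigma>) y' z')) \<le> \<epsilon>"
        "g (agd_fuel n Gd \<epsilon> L (L / \<sigma>) y' z') \<le> g y1" by auto
      moreover have "agd_loop g G A \<epsilon> L (L / \<sigma>) y z t = agd_loop g G A \<epsilon> L (L / \<sigma>) y' z' (t + 2 * G + 8 * A)"
        using False by (subst agd_loop.simps) (simp add: grad m Let_def y'_def z'_def)
      moreover have "agd_fuel (Suc n) Gd \<epsilon> L (L / \<sigma>) y z = agd_fuel n Gd \<epsilon> L (L / \<sigma>) y' z'"
        using False by (simp add: m Let_def y'_def z'_def)
      ultimately show ?thesis by (auto simp: distrib_right)
    qed
  }
qed

lemma agd_fuel_correct:
  assumes d: "\<And>x. GDERIV g x :> Gd x"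
    and lip: "\<And>x y. norm (Gd y - Gd x) \<le> L * norm (y - x)"
    and strong: "\<And>x y. g x + Gd x \<bullet> (y - x) + \<sigma> / 2 * (norm (y - x))\<^sup>2 \<le> g y"
    and pos: "0 < \<sigma>" "\<sigma> \<le> L" "0 \<le> \<epsilon>" "0 \<le> G" "0 \<le> A"
    and J: "4 * L / \<sigma> * (norm (Gd y1))\<^sup>2 * (1 - 1 / sqrt (L / \<sigma>)) ^ J \<le> \<epsilon>\<^sup>2"
  obtains t' where "agd g G A y1 \<epsilon> L \<sigma> t = Some (agd_fuel J Gd \<epsilon> L (L / \<sigma>) y1 y1, t')"
    "t' \<le> t + real J * (2 * G + 8 * A) + G + 10 * A"
    "norm (Gd (agd_fuel J Gd \<epsilon> L (L / \<sigma>) y1 y1)) \<le> \<epsilon>"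
    "g (agd_fuel J Gd \<epsilon> L (L / \<sigma>) y1 y1) \<le> g y1"
  using agd_loop_fuel[OF d lip strong pos refl J, of y1 y1 0 J "t + 7 * A"]
  unfolding agd_def by auto

section \<open>Accelerated proximal point steps\<close>

definition prox_accuracy :: "real \<Rightarrow> real \<Rightarrow> real \<Rightarrow> real" where
  "prox_accuracy \<epsilon> \<gamma> L = \<epsilon> * sqrt (\<gamma> / (50 * (L + 2 * \<gamma>)))"

definition prox_step :: "nat \<Rightarrow> (rvec \<Rightarrow> rvec) \<Rightarrow> real \<Rightarrow> real \<Rightarrow> real \<Rightarrow> rvec \<Rightarrow> rvec" where
  "prox_step J Hd \<epsilon> \<gamma> L z = agd_fuel J (\<lambda>w. Hd w + (2 * \<gamma>) *\<^sub>R (w - z))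
     (prox_accuracy \<epsilon> \<gamma> L) (L + 2 * \<gamma>) ((L + 2 * \<gamma>) / \<gamma>) z z"

primrec acagd_fuel ::
  "nat \<Rightarrow> nat \<Rightarrow> (rvec \<Rightarrow> rvec) \<Rightarrow> real \<Rightarrow> real \<Rightarrow> real \<Rightarrow> rvec \<Rightarrow> rvec" where
  "acagd_fuel 0 J Hd \<epsilon> \<gamma> L z = z"
| "acagd_fuel (Suc n) J Hd \<epsilon> \<gamma> L z =
    (if norm (Hd z) \<le> \<epsilon> then z else acagd_fuel n J Hd \<epsilon> \<gamma> L (prox_step J Hd \<epsilon> \<gamma> L z))"

locale almost_convex =
  fixes h :: "rvec \<Rightarrow> real" and Hd :: "rvec \<Rightarrow> rvec" and L \<gamma> hmin :: real
  assumes hd: "\<And>x. GDERIV h x :> Hd x"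
    and hlip: "\<And>x y. norm (Hd y - Hd x) \<le> L * norm (y - x)"
    and hmono: "\<And>x y. - \<gamma> * (norm (y - x))\<^sup>2 \<le> (Hd y - Hd x) \<bullet> (y - x)"
    and hlb: "\<And>x. hmin \<le> h x"
    and L: "0 < L" and \<gamma>: "0 < \<gamma>"
begin

lemma prox_gderiv:
  "GDERIV (\<lambda>w. h w + \<gamma> * (norm (w - z))\<^sup>2) x :> Hd x + (2 * \<gamma>) *\<^sub>R (x - z)"
  using GDERIV_add[OF hd GDERIV_cmult[OF GDERIV_dist_square, of \<gamma>]] by (simp add: mult.commute)

lemma prox_lipschitz:
  "norm (Hd y + (2 * \<gamma>) *\<^sub>R (y - z) - (Hd x + (2 * \<gamma>) *\<^sub>R (x - z))) \<le> (L + 2 * \<gamma>) * norm (y - x)"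
proof -
  have "Hd y + (2 * \<gamma>) *\<^sub>R (y - z) - (Hd x + (2 * \<gamma>) *\<^sub>R (x - z)) = (Hd y - Hd x) + (2 * \<gamma>) *\<^sub>R (y - x)"
    by (simp add: algebra_simps)
  also have "norm \<dots> \<le> L * norm (y - x) + 2 * \<gamma> * norm (y - x)"
    using \<gamma> by (intro order_trans[OF norm_triangle_ineq] add_mono hlip) auto
  finally show ?thesis by (simp add: distrib_right)
qed

lemma prox_strongly_convex:
  "(h x + \<gamma> * (norm (x - z))\<^sup>2) + (Hd x + (2 * \<gamma>) *\<^sub>R (x - z)) \<bullet> (y - x) + \<gamma> / 2 * (norm (y - x))\<^sup>2
     \<le> h y + \<gamma> * (norm (y - z))\<^sup>2"
proof (rule quadratic_lower_bound[OF prox_gderiv])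
  fix x y
  have "(Hd y + (2 * \<gamma>) *\<^sub>R (y - z) - (Hd x + (2 * \<gamma>) *\<^sub>R (x - z))) \<bullet> (y - x)
      = (Hd y - Hd x) \<bullet> (y - x) + 2 * \<gamma> * (norm (y - x))\<^sup>2"
    unfolding power2_norm_eq_inner by (simp add: inner_diff_left inner_add_left inner_diff_right algebra_simps)
  then show "\<gamma> * (norm (y - x))\<^sup>2 \<le> (Hd y + (2 * \<gamma>) *\<^sub>R (y - z) - (Hd x + (2 * \<gamma>) *\<^sub>R (x - z))) \<bullet> (y - x)"
    using hmono[of y x] by simp
qed

text \<open>The constant 50 in the procedure gives
  \<open>50 (L + 2 \<gamma>) \<ge> 100 \<gamma>\<close>, hence a square root of at most
  1/10.\<close>

lemma prox_accuracy_le: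
  assumes "0 \<le> \<epsilon>"
  shows "prox_accuracy \<epsilon> \<gamma> L \<le> \<epsilon> / 10" "0 \<le> prox_accuracy \<epsilon> \<gamma> L"
proof -
  have "sqrt (\<gamma> / (50 * (L + 2 * \<gamma>))) \<le> sqrt ((1 / 10)\<^sup>2)"
    using L \<gamma> by (intro real_sqrt_le_mono) (simp add: field_simps)
  then have "sqrt (\<gamma> / (50 * (L + 2 * \<gamma>))) \<le> 1 / 10" by simp
  then show "prox_accuracy \<epsilon> \<gamma> L \<le> \<epsilon> / 10"
    using mult_left_mono[OF _ assms] by (fastforce simp: prox_accuracy_def)
  show "0 \<le> prox_accuracy \<epsilon> \<gamma> L" using L \<gamma> assms by (simp add: prox_accuracy_def)
qed

section \<open>Proximal steps with a fixed inner iteration count\<close>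

context
  fixes J :: nat and \<epsilon> G A D0 :: real
  assumes \<epsilon>: "0 < \<epsilon>" and GA: "0 \<le> G" "0 \<le> A"
    and J: "8 * ((L + 2 * \<gamma>) / \<gamma>) * L * D0 * (1 - 1 / sqrt ((L + 2 * \<gamma>) / \<gamma>)) ^ J
        \<le> (prox_accuracy \<epsilon> \<gamma> L)\<^sup>2"
begin

text \<open>One \<open>J\<close> serves all centres: the squared gradient at a point with value gap
  at most \<open>D0\<close> is at most \<open>2 L D0\<close>, and the factor 4 in the AGD condition
  makes this the 8 in hypothesis \<open>J\<close>.\<close>

lemma prox_step_correct:
  assumes z: "h z \<le> hmin + D0"
  defines "z' \<equiv> prox_step J Hd \<epsilon> \<gamma> L z"
  obtains t' where
    "agd (\<lambda>w. h w + \<gamma> * (norm (w - z))\<^sup>2) (G + 4 * A) A z (prox_accuracy \<epsilon> \<gamma> L) (L + 2 * \<gamma>) \<gamma> t = Some (z', t')"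
    "t' \<le> t + real J * (2 * G + 16 * A) + G + 14 * A"
    "norm (Hd z' + (2 * \<gamma>) *\<^sub>R (z' - z)) \<le> prox_accuracy \<epsilon> \<gamma> L"
    "h z' + \<gamma> * (norm (z' - z))\<^sup>2 \<le> h z"
proof -
  let ?\<kappa> = "(L + 2 * \<gamma>) / \<gamma>"
  have \<kappa>: "1 \<le> ?\<kappa>" using L \<gamma> by simp
  have g0: "Hd z + (2 * \<gamma>) *\<^sub>R (z - z) = Hd z" by simp
  have "(norm (Hd z))\<^sup>2 \<le> 2 * L * (h z - hmin)" by (rule norm_gradient_le[OF hd hlip L hlb])
  also have "\<dots> \<le> 2 * L * D0" using z L by (intro mult_left_mono) auto
  finally have "4 * ?\<kappa> * (norm (Hd z))\<^sup>2 \<le> 4 * ?\<kappa> * (2 * L * D0)"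
    using L \<gamma> by (intro mult_left_mono) auto
  then have "4 * ?\<kappa> * (norm (Hd z))\<^sup>2 * (1 - 1 / sqrt ?\<kappa>) ^ J \<le> 4 * ?\<kappa> * (2 * L * D0) * (1 - 1 / sqrt ?\<kappa>) ^ J"
    using \<kappa> by (intro mult_right_mono zero_le_power) (simp_all del: real_sqrt_divide)
  also have "\<dots> \<le> (prox_accuracy \<epsilon> \<gamma> L)\<^sup>2" using J by (simp add: mult_ac)
  finally have J': "4 * (L + 2 * \<gamma>) / \<gamma> * (norm (Hd z + (2 * \<gamma>) *\<^sub>R (z - z)))\<^sup>2 * (1 - 1 / sqrt ?\<kappa>) ^ J
      \<le> (prox_accuracy \<epsilon> \<gamma> L)\<^sup>2" by simp
  show ?thesis
  proof (rule agd_fuel_correct[OF prox_gderiv prox_lipschitz prox_strongly_convex \<gamma> _ _ _ GA(2) J', of "G + 4 * A" t],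
      goal_cases)
    case (4 t')
    have *: "2 * (G + 4 * A) + 8 * A = 2 * G + 16 * A" by simp
    from 4 show ?case unfolding * by (intro that[of t']) (simp_all add: z'_def prox_step_def)
  qed (use L \<gamma> \<epsilon> GA prox_accuracy_le(2) in auto)
qed

text \<open>Let \<open>n\<close> be the length of the step. The inner gradient is at most
  \<open>\<epsilon> / 10\<close>, so a gradient of \<open>h\<close> above \<open>\<epsilon>\<close>
  forces \<open>2 \<gamma> n \<ge> 9/10 \<epsilon>\<close>. The penalty and strong convexity
  together give a decrease of \<open>3/2 \<gamma> n^2 - \<epsilon> n / 10\<close>, and
  \<open>3/2 * 9/20 - 1/10 = 23/40\<close>.\<close>

lemma prox_step_long:
  assumes z: "h z \<le> hmin + D0"
  defines "z' \<equiv> prox_step J Hd \<epsilon> \<gamma> L z"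
  assumes big: "\<epsilon> < norm (Hd z')"
  shows "9 / 20 * \<epsilon> \<le> \<gamma> * norm (z' - z)" "23 / 40 * \<epsilon> * norm (z' - z) \<le> h z - h z'"
proof -
  obtain t' where g: "norm (Hd z' + (2 * \<gamma>) *\<^sub>R (z' - z)) \<le> prox_accuracy \<epsilon> \<gamma> L"
    using prox_step_correct[OF z] unfolding z'_def by metis
  have acc: "prox_accuracy \<epsilon> \<gamma> L \<le> \<epsilon> / 10" using prox_accuracy_le(1) \<epsilon> by simp
  have "norm (Hd z') \<le> norm (Hd z' + (2 * \<gamma>) *\<^sub>R (z' - z)) + norm ((2 * \<gamma>) *\<^sub>R (z' - z))"
    using norm_triangle_ineq4[of "Hd z' + (2 * \<gamma>) *\<^sub>R (z' - z)" "(2 * \<gamma>) *\<^sub>R (z' - z)"] by simp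
  then show d: "9 / 20 * \<epsilon> \<le> \<gamma> * norm (z' - z)" using g acc big \<gamma> by simp
  define n where "n = norm (z' - z)"
  have "\<bar>(Hd z' + (2 * \<gamma>) *\<^sub>R (z' - z)) \<bullet> (z - z')\<bar> \<le> norm (Hd z' + (2 * \<gamma>) *\<^sub>R (z' - z)) * norm (z - z')"
    by (rule Cauchy_Schwarz_ineq2)
  also have "\<dots> \<le> \<epsilon> / 10 * n"
    unfolding n_def norm_minus_commute[of z z'] using g acc by (intro mult_right_mono) auto
  finally have "h z' + \<gamma> * n\<^sup>2 - \<epsilon> / 10 * n + \<gamma> / 2 * n\<^sup>2 \<le> h z"
    using prox_strongly_convex[of z' z z] by (simp add: n_def norm_minus_commute[of z z'])
  moreover have "27 / 40 * \<epsilon> * n \<le> 3 / 2 * (\<gamma> * n) * n"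
    using d by (intro mult_right_mono) (auto simp: n_def)
  ultimately show "23 / 40 * \<epsilon> * norm (z' - z) \<le> h z - h z'"
    unfolding n_def[symmetric] by (simp add: power2_eq_square algebra_simps)
qed

text \<open>The value of \<open>\<gamma> n^2\<close> at the least possible length
  \<open>n = 9 \<epsilon> / (20 \<gamma>)\<close> of a step that leaves a large gradient.\<close>

definition descent_unit :: real where
  "descent_unit = 81 / 400 * \<epsilon>\<^sup>2 / \<gamma>"

lemma descent_unit_pos: "0 < descent_unit"
  using \<epsilon> \<gamma> by (simp add: descent_unit_def)

lemma prox_step_long_descent:
  assumes z: "h z \<le> hmin + D0" and big: "\<epsilon> < norm (Hd (prox_step J Hd \<epsilon> \<gamma> L z))"
  shows "h (prox_step J Hd \<epsilon> \<gamma> L z) \<le> h z - descent_unit"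
proof -
  let ?z' = "prox_step J Hd \<epsilon> \<gamma> L z"
  have "\<gamma> * descent_unit = (9 / 20 * \<epsilon>)\<^sup>2" using \<gamma> by (simp add: descent_unit_def power2_eq_square)
  also have "\<dots> \<le> (\<gamma> * norm (?z' - z))\<^sup>2" using prox_step_long(1)[OF assms] \<epsilon> by (intro power_mono) auto
  also have "\<dots> = \<gamma> * (\<gamma> * (norm (?z' - z))\<^sup>2)" by (simp add: power2_eq_square)
  finally have "descent_unit \<le> \<gamma> * (norm (?z' - z))\<^sup>2" using \<gamma> by simp
  moreover have "h ?z' + \<gamma> * (norm (?z' - z))\<^sup>2 \<le> h z" using prox_step_correct[OF z] by metis
  ultimately show ?thesis by simp
qed

text \<open>The state of a run started at \<open>z0\<close>: after at least one long step, the path length \<open>\<rho>\<close> is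
  bounded by the decrease so far.\<close>

definition travelled :: "rvec \<Rightarrow> rvec \<Rightarrow> bool" where
  "travelled z0 z \<longleftrightarrow> z = z0 \<or> (\<exists>\<rho>. 9 / 20 * \<epsilon> \<le> \<gamma> * \<rho> \<and> norm (z - z0) \<le> \<rho> \<and> 23 / 40 * \<epsilon> * \<rho> \<le> h z0 - h z)"

text \<open>The last step may be short, and then only its quadratic decrease is known. A single step
  from \<open>z0\<close> gives the first alternative; after long steps, lowering the rate from 23/40
  to 2/5 pays for a short last one.\<close>

definition large_descent :: "rvec \<Rightarrow> rvec \<Rightarrow> bool" where
  "large_descent z0 z \<longleftrightarrow> min (\<gamma> * (norm (z - z0))\<^sup>2) (2 / 5 * \<epsilon> * norm (z - z0)) \<le> h z0 - h z"

lemma travelled_large_descent: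
  assumes "travelled z0 z" shows "large_descent z0 z"
proof (cases "z = z0")
  case False
  then obtain \<rho> where \<rho>: "norm (z - z0) \<le> \<rho>" "23 / 40 * \<epsilon> * \<rho> \<le> h z0 - h z"
    using assms unfolding travelled_def by blast
  have "2 / 5 * \<epsilon> * norm (z - z0) \<le> 23 / 40 * \<epsilon> * \<rho>"
    using \<rho> \<epsilon> by (intro mult_mono) auto
  then show ?thesis using \<rho> by (simp add: large_descent_def min_le_iff_disj)
qed (simp add: large_descent_def)

lemma travelled_step:
  assumes z: "h z \<le> hmin + D0" and tr: "travelled z0 z"
  defines "z' \<equiv> prox_step J Hd \<epsilon> \<gamma> L z"
  shows "\<epsilon> < norm (Hd z') \<Longrightarrow> travelled z0 z'" and "large_descent z0 z'"
proof -
  define n where "n = norm (z' - z)"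
  have n0: "0 \<le> n" by (simp add: n_def)
  have dec: "h z' + \<gamma> * n\<^sup>2 \<le> h z"
    using prox_step_correct[OF z] unfolding n_def z'_def by metis
  have tri: "norm (z' - z0) \<le> norm (z - z0) + n"
    using norm_triangle_ineq[of "z' - z" "z - z0"] by (simp add: n_def)
  show "travelled z0 z'" if big: "\<epsilon> < norm (Hd z')"
  proof -
    have long: "9 / 20 * \<epsilon> \<le> \<gamma> * n" "23 / 40 * \<epsilon> * n \<le> h z - h z'"
      using prox_step_long[OF z] big unfolding n_def z'_def by auto
    show ?thesis
    proof (cases "z = z0")
      case True
      then show ?thesis using long by (auto simp: travelled_def n_def)
    next
      case False
      then obtain \<rho> where \<rho>: "9 / 20 * \<epsilon> \<le> \<gamma> * \<rho>" "norm (z - z0) \<le> \<rho>" "23 / 40 * \<epsilon> * \<rho> \<le> h z0 - h z"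
        using tr unfolding travelled_def by blast
      have "0 \<le> \<gamma> * n" using n0 \<gamma> by simp
      then have "9 / 20 * \<epsilon> \<le> \<gamma> * (\<rho> + n)" "norm (z' - z0) \<le> \<rho> + n" "23 / 40 * \<epsilon> * (\<rho> + n) \<le> h z0 - h z'"
        using \<rho> long tri by (auto simp: distrib_left)
      then show ?thesis unfolding travelled_def by blast
    qed
  qed
  show "large_descent z0 z'"
  proof (cases "z = z0")
    case True
    then show ?thesis using dec by (simp add: large_descent_def n_def min_le_iff_disj)
  next
    case False
    then obtain \<rho> where \<rho>: "9 / 20 * \<epsilon> \<le> \<gamma> * \<rho>" "norm (z - z0) \<le> \<rho>" "23 / 40 * \<epsilon> * \<rho> \<le> h z0 - h z"
      using tr unfolding travelled_def by blast
    \<comment> \<open>The path so far has a surplus of \<open>23/40 - 2/5 = 7/40\<close> per unit of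
      length, and \<open>\<gamma> \<rho> \<ge> 9/20 \<epsilon>\<close>. As
      \<open>7/40 * 9/20 = (1/5)^2 + 31/800\<close>, it covers the deficit
      \<open>2/5 \<epsilon> n - \<gamma> n^2\<close> of the last step by completing the
      square.\<close>
    define x where "x = \<gamma> * n"
    have "0 \<le> (x - \<epsilon> / 5)\<^sup>2 + 31 / 800 * \<epsilon>\<^sup>2" by simp
    also have "\<dots> = 7 / 40 * \<epsilon> * (9 / 20 * \<epsilon>) + x\<^sup>2 - 2 / 5 * \<epsilon> * x"
      by (simp add: power2_eq_square algebra_simps)
    also have "\<dots> \<le> 7 / 40 * \<epsilon> * (\<gamma> * \<rho>) + x\<^sup>2 - 2 / 5 * \<epsilon> * x"
      using \<rho>(1) \<epsilon> by (intro diff_right_mono add_right_mono mult_left_mono) auto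
    also have "\<dots> = \<gamma> * (7 / 40 * \<epsilon> * \<rho> + \<gamma> * n\<^sup>2 - 2 / 5 * \<epsilon> * n)"
      by (simp add: x_def power2_eq_square algebra_simps)
    finally have "0 \<le> 7 / 40 * \<epsilon> * \<rho> + \<gamma> * n\<^sup>2 - 2 / 5 * \<epsilon> * n"
      using \<gamma> by (simp add: zero_le_mult_iff)
    then have "2 / 5 * \<epsilon> * (\<rho> + n) \<le> h z0 - h z'"
      using \<rho>(3) dec unfolding distrib_left mult.assoc by linarith
    moreover have "2 / 5 * \<epsilon> * norm (z' - z0) \<le> 2 / 5 * \<epsilon> * (\<rho> + n)"
      using tri \<rho>(2) \<epsilon> by (intro mult_left_mono) auto
    ultimately show ?thesis by (simp add: large_descent_def min_le_iff_disj)
  qed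
qed

text \<open>\<open>W\<close> bounds the time of one pass of the loop. A pass that leaves a large
  gradient is paid for by its own decrease of at least \<open>descent_unit\<close>; the summand 1
  pays for the last pass, whose decrease may be smaller.\<close>

lemma acagd_fuel_run:
  assumes W: "real J * (2 * G + 16 * A) + 2 * G + 23 * A \<le> W"
    and z0: "h z0 \<le> hmin + D0"
    and z: "h z \<le> h z0" "norm (Hd z) \<le> \<epsilon> \<and> large_descent z0 z \<or> travelled z0 z"
    and fuel: "norm (Hd z) \<le> \<epsilon> \<or> h z - hmin < real n * descent_unit"
  defines "zf \<equiv> acagd_fuel n J Hd \<epsilon> \<gamma> L z"
  shows "\<exists>t'. acagd h G A z \<epsilon> \<gamma> L t = Some (zf, t') \<and>
      t' \<le> t + W * ((if norm (Hd z) \<le> \<epsilon> then 0 else 1) + (h z - h zf) / descent_unit) + G + 3 * A \<and>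
      norm (Hd zf) \<le> \<epsilon> \<and> h zf \<le> h z \<and> large_descent z0 zf"
  using z fuel unfolding zf_def
proof (induction n arbitrary: z t)
  have grad: "grad h x = Hd x" for x by (rule grad_eqI[OF hd])
  {
    case 0
    then have *: "norm (Hd z) \<le> \<epsilon>" using hlb[of z] by auto
    then show ?case
      using 0 travelled_large_descent by (subst acagd.simps) (auto simp: grad)
  next
    case (Suc n)
    show ?case
    proof (cases "norm (Hd z) \<le> \<epsilon>")
      case True
      then show ?thesis
        using Suc.prems travelled_large_descent by (subst acagd.simps) (auto simp: grad)
    next
      case False
      define z' where "z' = prox_step J Hd \<epsilon> \<gamma> L z"
      have tr: "travelled z0 z" and zD: "h z \<le> hmin + D0" using Suc.prems False z0 by auto
      obtain t1 where agd: "agd (\<lambda>w. h w + \<gamma> * (norm (w - z))\<^sup>2) (G + 4 * A) A z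
            (\<epsilon> * sqrt (\<gamma> / (50 * (L + 2 * \<gamma>)))) (L + 2 * \<gamma>) \<gamma> (t + G + 9 * A) = Some (z', t1)"
        and t1: "t1 \<le> (t + G + 9 * A) + real J * (2 * G + 16 * A) + G + 14 * A"
        and dec: "h z' + \<gamma> * (norm (z' - z))\<^sup>2 \<le> h z"
        by (rule prox_step_correct[OF zD, of "t + G + 9 * A", folded z'_def, unfolded prox_accuracy_def])
      have "0 \<le> \<gamma> * (norm (z' - z))\<^sup>2" using \<gamma> by simp
      then have le: "h z' \<le> h z" using dec by linarith
      have long: "norm (Hd z') \<le> \<epsilon> \<or> h z' \<le> h z - descent_unit"
        using prox_step_long_descent[OF zD] unfolding z'_def by force
      have "norm (Hd z') \<le> \<epsilon> \<or> h z' - hmin < real n * descent_unit"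
        using long False Suc.prems(3) by (auto simp: algebra_simps)
      moreover have "norm (Hd z') \<le> \<epsilon> \<and> large_descent z0 z' \<or> travelled z0 z'"
        using travelled_step[OF zD tr] unfolding z'_def by force
      moreover have "h z' \<le> h z0" using le Suc.prems by simp
      ultimately obtain t' where run: "acagd h G A z' \<epsilon> \<gamma> L t1 = Some (acagd_fuel n J Hd \<epsilon> \<gamma> L z', t')"
        and t': "t' \<le> t1 + W * ((if norm (Hd z') \<le> \<epsilon> then 0 else 1)
            + (h z' - h (acagd_fuel n J Hd \<epsilon> \<gamma> L z')) / descent_unit) + G + 3 * A"
        and fin: "norm (Hd (acagd_fuel n J Hd \<epsilon> \<gamma> L z')) \<le> \<epsilon>"
          "h (acagd_fuel n J Hd \<epsilon> \<gamma> L z') \<le> h z'" "large_descent z0 (acagd_fuel n J Hd \<epsilon> \<gamma> L z')"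
        using Suc.IH[of z' t1] by blast
      define zf where "zf = acagd_fuel n J Hd \<epsilon> \<gamma> L z'"
      have "0 \<le> W" using W GA by (smt (verit) mult_nonneg_nonneg of_nat_0_le_iff)
      have "(if norm (Hd z') \<le> \<epsilon> then 0 else 1) \<le> (h z - h z') / descent_unit"
        using long le descent_unit_pos by (auto simp: field_simps)
      then have "W * (1 + (if norm (Hd z') \<le> \<epsilon> then 0 else 1) + (h z' - h zf) / descent_unit)
          \<le> W * (1 + (h z - h zf) / descent_unit)"
        using \<open>0 \<le> W\<close> by (intro mult_left_mono) (auto simp: diff_divide_distrib)
      moreover have "t1 \<le> t + W" using t1 W by linarith
      ultimately have "t' \<le> t + W * (1 + (h z - h zf) / descent_unit) + G + 3 * A"
        using t' unfolding zf_def[symmetric] by (simp add: distrib_left)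
      moreover have "acagd h G A z \<epsilon> \<gamma> L t = Some (zf, t')"
        by (subst acagd.simps) (simp only: grad False if_False agd Option.bind.simps prod.case run zf_def)
      moreover have "acagd_fuel (Suc n) J Hd \<epsilon> \<gamma> L z = zf"
        using False by (simp add: zf_def z'_def)
      ultimately show ?thesis using fin le False unfolding zf_def[symmetric] by auto
    qed
  }
qed

text \<open>The start above \<open>2 \<epsilon>\<close> secures a positive decrease: if already the
  first step brings the gradient down to \<open>\<epsilon>\<close>, the gradient has changed by more
  than \<open>\<epsilon>\<close>, so the step is at least \<open>\<epsilon> / L\<close> long. ANCM
  provides this factor 2 by passing half of its accuracy.\<close>

lemma acagd_fuel_correct:
  assumes W: "real J * (2 * G + 16 * A) + 2 * G + 23 * A \<le> W"
    and z: "h z \<le> hmin + D0" and big: "2 * \<epsilon> < norm (Hd z)"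
    and fuel: "D0 < real n * descent_unit"
  defines "zf \<equiv> acagd_fuel n J Hd \<epsilon> \<gamma> L z"
  obtains t' where "acagd h G A z \<epsilon> \<gamma> L t = Some (zf, t')"
      "t' \<le> t + W * (1 + (h z - h zf) / descent_unit) + G + 3 * A"
      "norm (Hd zf) \<le> \<epsilon>" "large_descent z zf"
      "min descent_unit (\<gamma> * (\<epsilon> / L)\<^sup>2) \<le> h z - h zf"
proof -
  have "\<not> norm (Hd z) \<le> \<epsilon>" using big \<epsilon> by simp
  moreover have tr: "travelled z z" by (simp add: travelled_def)
  moreover have fz: "h z - hmin < real n * descent_unit" using fuel z by simp
  ultimately obtain t' where run: "acagd h G A z \<epsilon> \<gamma> L t = Some (zf, t')"
      "t' \<le> t + W * (1 + (h z - h zf) / descent_unit) + G + 3 * A"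
      "norm (Hd zf) \<le> \<epsilon>" "large_descent z zf"
    using acagd_fuel_run[OF W z, of z n t] unfolding zf_def by auto
  obtain m where m: "n = Suc m"
    using fz hlb[of z] by (cases n) auto
  define z' where "z' = prox_step J Hd \<epsilon> \<gamma> L z"
  have zf: "zf = acagd_fuel m J Hd \<epsilon> \<gamma> L z'"
    using \<open>\<not> norm (Hd z) \<le> \<epsilon>\<close> by (simp add: zf_def m z'_def)
  have dec: "h z' + \<gamma> * (norm (z' - z))\<^sup>2 \<le> h z"
    using prox_step_correct[OF z] unfolding z'_def by metis
  have "0 \<le> \<gamma> * (norm (z' - z))\<^sup>2" using \<gamma> by simp
  then have le: "h z' \<le> h z" using dec by linarith
  have long: "h z' \<le> h z - descent_unit" if "\<epsilon> < norm (Hd z')"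
    using prox_step_long_descent[OF z] that unfolding z'_def by force
  have "norm (Hd z') \<le> \<epsilon> \<or> h z' - hmin < real m * descent_unit"
    using long fz by (cases "norm (Hd z') \<le> \<epsilon>") (simp_all add: m distrib_right not_le)
  moreover have "norm (Hd z') \<le> \<epsilon> \<and> large_descent z z' \<or> travelled z z'"
    using travelled_step[OF z tr] unfolding z'_def by force
  ultimately have "h zf \<le> h z'"
    using acagd_fuel_run[OF W z le, of m] unfolding zf by blast
  moreover have "min descent_unit (\<gamma> * (\<epsilon> / L)\<^sup>2) \<le> h z - h z'"
  proof (cases "norm (Hd z') \<le> \<epsilon>")
    case True
    have "norm (Hd z) \<le> norm (Hd z') + norm (Hd z' - Hd z)"
      using norm_triangle_sub[of "Hd z" "Hd z'"] by (simp add: norm_minus_commute)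
    then have "\<epsilon> \<le> L * norm (z' - z)" using True big hlip[where x = z and y = z'] by linarith
    then have "\<epsilon> / L \<le> norm (z' - z)" using L by (simp add: field_simps)
    then have "\<gamma> * (\<epsilon> / L)\<^sup>2 \<le> \<gamma> * (norm (z' - z))\<^sup>2"
      using \<gamma> L \<epsilon> by (intro mult_left_mono power_mono) auto
    then show ?thesis using dec by (simp add: min_le_iff_disj)
  qed (use long in \<open>auto simp: min_le_iff_disj not_le\<close>)
  ultimately show ?thesis using run by (intro that[of t']) auto
qed

end

end

section \<open>The eigenvector calls of a run\<close>

lemma agd_fuel_subspace:
  assumes S: "subspace S" and "\<And>w. w \<in> S \<Longrightarrow> Gd w \<in> S" "y \<in> S" "z \<in> S"
  shows "agd_fuel n Gd \<epsilon> L \<kappa> y z \<in> S"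
  using assms(3,4)
proof (induction n arbitrary: y z)
  case (Suc n)
  then show ?case
    by (auto simp: Let_def intro!: Suc.IH subspace_diff[OF S] subspace_scale[OF S] assms(2))
qed simp

lemma acagd_fuel_subspace:
  assumes S: "subspace S" and "\<And>w. w \<in> S \<Longrightarrow> Hd w \<in> S" "z \<in> S"
  shows "acagd_fuel n J Hd \<epsilon> \<gamma> L z \<in> S"
  using assms(3)
proof (induction n arbitrary: z)
  case (Suc n)
  have "prox_step J Hd \<epsilon> \<gamma> L z \<in> S"
    unfolding prox_step_def using Suc.prems assms(2)
    by (intro agd_fuel_subspace[OF S] subspace_add[OF S] subspace_diff[OF S] subspace_scale[OF S])
  then show ?case using Suc by simp
qed simp

text \<open>The gradient field depends on the sample because the centres of the proximal term and of
  the penalty are random points.\<close>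

lemma measurable_agd_fuel:
  fixes Gd :: "'w \<Rightarrow> rvec \<Rightarrow> rvec"
  assumes Gd: "\<And>X. X \<in> borel_measurable M \<Longrightarrow> (\<lambda>\<omega>. Gd \<omega> (X \<omega>)) \<in> borel_measurable M"
    and "Y \<in> borel_measurable M" "Z \<in> borel_measurable M"
  shows "(\<lambda>\<omega>. agd_fuel n (Gd \<omega>) \<epsilon> L \<kappa> (Y \<omega>) (Z \<omega>)) \<in> borel_measurable M"
  using assms(2,3)
proof (induction n arbitrary: Y Z)
  case (Suc n)
  note [measurable] = Suc.prems Gd[OF Suc.prems(1)] Gd[OF Suc.prems(2)]
  define m where "m = (sqrt \<kappa> - 1) / (sqrt \<kappa> + 1)"
  define Y' where "Y' \<omega> = Z \<omega> - (1 / L) *\<^sub>R Gd \<omega> (Z \<omega>)" for \<omega>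
  define Z' where "Z' \<omega> = (1 + m) *\<^sub>R Y' \<omega> - m *\<^sub>R Y \<omega>" for \<omega>
  have [measurable]: "Y' \<in> borel_measurable M" unfolding Y'_def by measurable
  have [measurable]: "Z' \<in> borel_measurable M" unfolding Z'_def by measurable
  have [measurable]: "(\<lambda>\<omega>. agd_fuel n (Gd \<omega>) \<epsilon> L \<kappa> (Y' \<omega>) (Z' \<omega>)) \<in> borel_measurable M"
    by (rule Suc.IH) measurable
  have "(\<lambda>\<omega>. agd_fuel (Suc n) (Gd \<omega>) \<epsilon> L \<kappa> (Y \<omega>) (Z \<omega>)) =
      (\<lambda>\<omega>. if norm (Gd \<omega> (Y \<omega>)) \<le> \<epsilon> then Y \<omega> else agd_fuel n (Gd \<omega>) \<epsilon> L \<kappa> (Y' \<omega>) (Z' \<omega>))"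
    by (simp only: agd_fuel.simps Let_def Y'_def Z'_def m_def)
  also have "\<dots> \<in> borel_measurable M" by measurable
  finally show ?case .
qed simp

lemma measurable_acagd_fuel:
  fixes Hd :: "'w \<Rightarrow> rvec \<Rightarrow> rvec"
  assumes Hd: "\<And>X. X \<in> borel_measurable M \<Longrightarrow> (\<lambda>\<omega>. Hd \<omega> (X \<omega>)) \<in> borel_measurable M"
    and "Z \<in> borel_measurable M"
  shows "(\<lambda>\<omega>. acagd_fuel n J (Hd \<omega>) \<epsilon> \<gamma> L (Z \<omega>)) \<in> borel_measurable M"
  using assms(2)
proof (induction n arbitrary: Z)
  case (Suc n)
  note [measurable] = Suc.prems Hd[OF Suc.prems]
  have "(\<lambda>\<omega>. prox_step J (Hd \<omega>) \<epsilon> \<gamma> L (Z \<omega>)) \<in> borel_measurable M"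
    unfolding prox_step_def
  proof (rule measurable_agd_fuel)
    fix X :: "'w \<Rightarrow> rvec" assume [measurable]: "X \<in> borel_measurable M"
    note [measurable] = Hd[OF this]
    show "(\<lambda>\<omega>. Hd \<omega> (X \<omega>) + (2 * \<gamma>) *\<^sub>R (X \<omega> - Z \<omega>)) \<in> borel_measurable M" by measurable
  qed measurable
  note [measurable] = Suc.IH[OF this]
  show ?case by simp
qed simp

text \<open>\<open>past\<close> says that \<open>X\<close> depends only on the first
  \<open>n\<close> seeds. Under \<open>comb_seq\<close> the sequence is a pair of independent
  sequences: \<open>X\<close> is determined by the first and seed \<open>n\<close> is the head of
  the second. For a fixed first sequence \<open>X\<close> is a constant, the hypothesis applies to
  the fresh seed, and Fubini's theorem concludes.\<close>

lemma (in sequence_space) adaptive_event_bound: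
  assumes X [measurable]: "X \<in> measurable S N" and past: "\<And>\<omega> \<omega>'. X (comb_seq n \<omega> \<omega>') = X \<omega>"
    and B [measurable]: "B \<in> sets (N \<Otimes>\<^sub>M M)"
    and p: "\<And>x. x \<in> space N \<Longrightarrow> measure M {s \<in> space M. (x, s) \<in> B} \<le> p"
  shows "{\<omega> \<in> space S. (X \<omega>, \<omega> n) \<in> B} \<in> sets S" (is "?E \<in> _")
    and "measure S {\<omega> \<in> space S. (X \<omega>, \<omega> n) \<in> B} \<le> p"
proof -
  show E [measurable]: "?E \<in> sets S" by measurable
  have "0 \<le> p"
  proof -
    obtain \<omega> where "\<omega> \<in> space S" using P.not_empty by blast
    then have "X \<omega> \<in> space N" by (rule measurable_space[OF X])
    then show ?thesis using p measure_nonneg order_trans by blast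
  qed
  have "emeasure S ?E = emeasure (distr (S \<Otimes>\<^sub>M S) S (\<lambda>(\<omega>, \<omega>'). comb_seq n \<omega> \<omega>')) ?E"
    by (simp add: PiM_comb_seq)
  also have "\<dots> = emeasure (S \<Otimes>\<^sub>M S) ((\<lambda>(\<omega>, \<omega>'). comb_seq n \<omega> \<omega>') -` ?E \<inter> space (S \<Otimes>\<^sub>M S))"
    by (rule emeasure_distr) measurable
  also have "\<dots> = (\<integral>\<^sup>+\<omega>. emeasure S (Pair \<omega> -` ((\<lambda>(\<omega>, \<omega>'). comb_seq n \<omega> \<omega>') -` ?E \<inter> space (S \<Otimes>\<^sub>M S))) \<partial>S)"
    by (rule P.emeasure_pair_measure_alt) measurable
  also have "\<dots> \<le> (\<integral>\<^sup>+\<omega>. ennreal p \<partial>S)"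
  proof (rule nn_integral_mono)
    fix \<omega> assume \<omega>: "\<omega> \<in> space S"
    have XN: "X \<omega> \<in> space N" by (rule measurable_space[OF X \<omega>])
    have sec [measurable]: "{s \<in> space M. (X \<omega>, s) \<in> B} \<in> sets M"
      using XN by measurable
    have space: "comb_seq n \<omega> \<omega>' \<in> space S" if "\<omega>' \<in> space S" for \<omega>'
      using \<omega> that by (auto simp: space_PiM PiE_iff split: split_comb_seq)
    have "Pair \<omega> -` ((\<lambda>(\<omega>, \<omega>'). comb_seq n \<omega> \<omega>') -` ?E \<inter> space (S \<Otimes>\<^sub>M S))
        = (\<lambda>\<omega>'. \<omega>' 0) -` {s \<in> space M. (X \<omega>, s) \<in> B} \<inter> space S"
      using \<omega> space by (auto simp: space_pair_measure past comb_seq_def space_PiM PiE_iff)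
    also have "emeasure S \<dots> = emeasure (distr S M (\<lambda>\<omega>'. \<omega>' 0)) {s \<in> space M. (X \<omega>, s) \<in> B}"
      by (rule emeasure_distr[symmetric]) measurable
    also have "distr S M (\<lambda>\<omega>'. \<omega>' 0) = M"
      by (rule distr_PiM_component) (auto intro: prob_space)
    also have "emeasure M {s \<in> space M. (X \<omega>, s) \<in> B} \<le> ennreal p"
      using p[OF XN] by (simp add: M.emeasure_eq_measure ennreal_leI)
    finally show "emeasure S (Pair \<omega> -` ((\<lambda>(\<omega>, \<omega>'). comb_seq n \<omega> \<omega>') -` ?E \<inter> space (S \<Otimes>\<^sub>M S))) \<le> ennreal p" .
  qed
  also have "\<dots> = ennreal p" using P.emeasure_space_1 by simp
  finally show "measure S ?E \<le> p"
    using \<open>0 \<le> p\<close> by (simp add: P.emeasure_eq_measure)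
qed

lemma sequence_space_of_prob_space: "prob_space M \<Longrightarrow> sequence_space M"
  by (simp add: sequence_space_def product_prob_space_def product_prob_space_axioms_def
      product_sigma_finite_def prob_space_imp_sigma_finite)

section \<open>The outer loop\<close>

locale ancm_problem =
  fixes d :: nat and f :: "rvec \<Rightarrow> real" and x1 :: rvec and L1 L2 \<Delta> \<epsilon> \<alpha> fmin :: real and J N :: nat
  assumes d: "1 \<le> d" and fRn: "function_on_Rn d f" and x1: "x1 \<in> Rn d"
    and pos: "0 < L1" "0 < L2" "0 < \<epsilon>" "0 < \<alpha>" "0 < \<Delta>" and \<alpha>_le: "\<alpha> \<le> L1"
    and smooth: "smooth L1 f" and lh: "lipschitz_hessian L2 f"
    and fmin: "\<And>x. fmin \<le> f x" and start: "f x1 \<le> fmin + \<Delta>"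
    and J: "8 * ((5 * L1 + 2 * (3 * \<alpha>)) / (3 * \<alpha>)) * (5 * L1) * \<Delta>
        * (1 - 1 / sqrt ((5 * L1 + 2 * (3 * \<alpha>)) / (3 * \<alpha>))) ^ J
      \<le> (prox_accuracy (\<epsilon> / 2) (3 * \<alpha>) (5 * L1))\<^sup>2"
    and N: "\<Delta> < real N * (27 / 1600 * \<epsilon>\<^sup>2 / \<alpha>)"
begin

text \<open>The \<open>descent_unit\<close> of the proximal steps, which have accuracy \<open>\<epsilon> / 2\<close> and \<open>\<gamma> = 3 * \<alpha>\<close>.\<close>

definition dec_unit :: real where "dec_unit = 27 / 1600 * \<epsilon>\<^sup>2 / \<alpha>"

definition descend :: "rvec \<Rightarrow> rvec" where
  "descend x = acagd_fuel N J (penalized_grad f L1 (\<alpha> / L2) x) (\<epsilon> / 2) (3 * \<alpha>) (5 * L1) x"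

lemma dec_unit_pos: "0 < dec_unit" using pos by (simp add: dec_unit_def)

lemma L2_nonneg: "0 \<le> L2" using pos by simp

lemma f_gderiv: "GDERIV f x :> grad f x"
  using smooth by (simp add: smooth_def)

lemma f_lipschitz: "norm (grad f x - grad f y) \<le> L1 * norm (x - y)"
  using smooth by (simp add: smooth_def)

lemma curvature_ge:
  "- \<alpha> \<le> lambda_min d (hess f x) \<Longrightarrow> - \<alpha> * (norm v)\<^sup>2 \<le> hess f x v \<bullet> v"
  using hess_lower_bound[OF d fRn lh L2_nonneg] pos by simp

lemma curvature_ge_L1: "- L1 * (norm v)\<^sup>2 \<le> hess f x v \<bullet> v"
  using hess_ge_of_lipschitz_grad[OF lh L2_nonneg f_lipschitz] .

lemma lambda_min_ge_L1: "- L1 \<le> lambda_min d (hess f x)"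
proof -
  obtain v where v: "norm v = 1" "hess f x v = lambda_min d (hess f x) *\<^sub>R v"
    using lambda_min_hess[OF d fRn lh L2_nonneg] by metis
  then show ?thesis using curvature_ge_L1[of v x] by (simp flip: power2_norm_eq_inner)
qed

lemma almost_convex_penalized:
  assumes "\<And>v. - \<alpha> * (norm v)\<^sup>2 \<le> hess f c v \<bullet> v"
  shows "almost_convex (penalized f L1 (\<alpha> / L2) c) (penalized_grad f L1 (\<alpha> / L2) c) (5 * L1) (3 * \<alpha>) fmin"
proof
  have r: "0 < \<alpha> / L2" using pos by simp
  fix x y
  show "GDERIV (penalized f L1 (\<alpha> / L2) c) x :> penalized_grad f L1 (\<alpha> / L2) c x"
    by (rule GDERIV_penalized[OF f_gderiv r])
  have "norm (penalized_grad f L1 (\<alpha> / L2) c y - penalized_grad f L1 (\<alpha> / L2) c x) \<le> 3 * L1 * norm (y - x)"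
    using pos by (intro penalized_grad_lipschitz f_lipschitz r) auto
  also have "\<dots> \<le> 5 * L1 * norm (y - x)" using pos by (intro mult_right_mono) auto
  finally show "norm (penalized_grad f L1 (\<alpha> / L2) c y - penalized_grad f L1 (\<alpha> / L2) c x) \<le> 5 * L1 * norm (y - x)" .
  show "- (3 * \<alpha>) * (norm (y - x))\<^sup>2 \<le>
      (penalized_grad f L1 (\<alpha> / L2) c y - penalized_grad f L1 (\<alpha> / L2) c x) \<bullet> (y - x)"
    using pos by (intro penalized_grad_monotone[OF f_lipschitz lh] assms) auto
  show "fmin \<le> penalized f L1 (\<alpha> / L2) c x"
    using fmin[of x] pos by (simp add: penalized_def add_increasing2)
qed (use pos in auto)

lemma descend_correct:
  assumes curv: "\<And>v. - \<alpha> * (norm v)\<^sup>2 \<le> hess f x v \<bullet> v"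
    and x: "f x \<le> f x1" and big: "\<epsilon> < norm (grad f x)"
    and GA: "0 \<le> G" "0 \<le> A" and W: "real J * (2 * G + 16 * A) + 2 * G + 23 * A \<le> W"
  obtains t' where
    "acagd (\<lambda>w. f w + L1 * (max (norm (w - x) - \<alpha> / L2) 0)\<^sup>2) G A x (\<epsilon> / 2) (3 * \<alpha>) (5 * L1) t
       = Some (descend x, t')"
    "t' \<le> t + W * (1 + (f x - f (descend x)) / dec_unit) + G + 3 * A"
    "min dec_unit (3 / 100 * \<alpha> * \<epsilon>\<^sup>2 / L1\<^sup>2) \<le> f x - f (descend x)"
    "norm (grad f (descend x)) \<le> \<epsilon> \<or>
       min (3 * \<alpha> ^ 3 / L2\<^sup>2) (\<alpha> * \<epsilon> / (5 * L2)) \<le> f x - f (descend x)"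
proof -
  let ?h = "penalized f L1 (\<alpha> / L2) x" and ?Hd = "penalized_grad f L1 (\<alpha> / L2) x"
  interpret h: almost_convex ?h ?Hd "5 * L1" "3 * \<alpha>" fmin
    by (rule almost_convex_penalized[OF curv])
  have r: "0 < \<alpha> / L2" using pos by simp
  have e: "0 < \<epsilon> / 2" using pos by simp
  note ctx = e GA J
  have dec_unit: "h.descent_unit (\<epsilon> / 2) = dec_unit"
    unfolding h.descent_unit_def[OF ctx] dec_unit_def by (simp add: power2_eq_square)
  have hx: "?h x = f x" using r by (simp add: penalized_def)
  have hge: "f w \<le> ?h w" for w using pos by (simp add: penalized_def)
  have Hdx: "?Hd x = grad f x" by (rule penalized_grad_center[OF r])
  have "?h x \<le> fmin + \<Delta>" using x start by (simp add: hx)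
  moreover have "2 * (\<epsilon> / 2) < norm (?Hd x)" using big by (simp add: Hdx)
  moreover have "\<Delta> < real N * h.descent_unit (\<epsilon> / 2)" using N by (simp add: dec_unit dec_unit_def)
  ultimately obtain t' where t':
      "acagd ?h G A x (\<epsilon> / 2) (3 * \<alpha>) (5 * L1) t = Some (descend x, t')"
      "t' \<le> t + W * (1 + (?h x - ?h (descend x)) / dec_unit) + G + 3 * A"
      "norm (?Hd (descend x)) \<le> \<epsilon> / 2" and large: "h.large_descent (\<epsilon> / 2) x (descend x)"
      and dec: "min dec_unit (3 * \<alpha> * (\<epsilon> / 2 / (5 * L1))\<^sup>2) \<le> ?h x - ?h (descend x)"
    using h.acagd_fuel_correct[OF ctx W, of x N t] unfolding descend_def dec_unit by metis
  \<comment> \<open>The penalty vanishes at its centre and is nonnegative elsewhere, so every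
    decrease of the penalized function is one of \<open>f\<close>.\<close>
  have le: "?h x - ?h (descend x) \<le> f x - f (descend x)" using hge[of "descend x"] by (simp add: hx)
  show ?thesis
  proof (rule that[of t'])
    show "acagd (\<lambda>w. f w + L1 * (max (norm (w - x) - \<alpha> / L2) 0)\<^sup>2) G A x (\<epsilon> / 2) (3 * \<alpha>) (5 * L1) t
       = Some (descend x, t')" using t'(1) by (simp add: penalized_def)
    have "0 \<le> real J * (2 * G + 16 * A)" using GA by simp
    then have "0 \<le> W" using W GA by linarith
    then have "W * (1 + (?h x - ?h (descend x)) / dec_unit) \<le> W * (1 + (f x - f (descend x)) / dec_unit)"
      using le dec_unit_pos by (intro mult_left_mono add_left_mono divide_right_mono) auto
    then show "t' \<le> t + W * (1 + (f x - f (descend x)) / dec_unit) + G + 3 * A" using t'(2) by linarith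
    have "3 * \<alpha> * (\<epsilon> / 2 / (5 * L1))\<^sup>2 = 3 / 100 * \<alpha> * \<epsilon>\<^sup>2 / L1\<^sup>2"
      by (simp add: power2_eq_square)
    then show "min dec_unit (3 / 100 * \<alpha> * \<epsilon>\<^sup>2 / L1\<^sup>2) \<le> f x - f (descend x)" using dec le by simp
    show "norm (grad f (descend x)) \<le> \<epsilon> \<or>
       min (3 * \<alpha> ^ 3 / L2\<^sup>2) (\<alpha> * \<epsilon> / (5 * L2)) \<le> f x - f (descend x)"
    proof (cases "norm (descend x - x) \<le> \<alpha> / L2")
      case True
      then have "?Hd (descend x) = grad f (descend x)" by (simp add: penalized_grad_def shrink_inside)
      then show ?thesis using t'(3) pos by simp
    next
      case False
      define R where "R = norm (descend x - x)"
      have R: "\<alpha> / L2 \<le> R" using False by (simp add: R_def)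
      have l1: "3 * \<alpha> * (\<alpha> / L2)\<^sup>2 \<le> 3 * \<alpha> * R\<^sup>2"
        using R pos by (intro mult_left_mono power_mono) auto
      have l2: "2 / 5 * (\<epsilon> / 2) * (\<alpha> / L2) \<le> 2 / 5 * (\<epsilon> / 2) * R"
        using R pos by (intro mult_left_mono) auto
      have l3: "min (3 * \<alpha> * R\<^sup>2) (2 / 5 * (\<epsilon> / 2) * R) \<le> ?h x - ?h (descend x)"
        using large unfolding h.large_descent_def[OF ctx] R_def .
      have eqs: "3 * \<alpha> * (\<alpha> / L2)\<^sup>2 = 3 * \<alpha> ^ 3 / L2\<^sup>2"
        "2 / 5 * (\<epsilon> / 2) * (\<alpha> / L2) = \<alpha> * \<epsilon> / (5 * L2)"
        by (simp_all add: power2_eq_square power3_eq_cube)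
      have "min (3 * \<alpha> ^ 3 / L2\<^sup>2) (\<alpha> * \<epsilon> / (5 * L2)) \<le> ?h x - ?h (descend x)"
        using order_trans[OF min.mono[OF l1 l2] l3] unfolding eqs .
      then show ?thesis using le by linarith
    qed
  qed
qed

lemma lambda_min_descent:
  assumes x: "f x \<le> f x1" and neg: "lambda_min d (hess f x) \<le> 0"
  shows "2 / 3 * \<bar>lambda_min d (hess f x)\<bar> ^ 3 \<le> L2\<^sup>2 * \<Delta>"
proof -
  let ?l = "lambda_min d (hess f x)"
  obtain v where v: "norm v = 1" "hess f x v = ?l *\<^sub>R v"
    using lambda_min_hess[OF d fRn lh L2_nonneg] by metis
  then have "?l = v \<bullet> hess f x v" by (simp flip: power2_norm_eq_inner)
  from negative_curvature_step[OF lh L2_nonneg pos(2) v(1) this neg]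
  have "2 / 3 * \<bar>?l\<bar> ^ 3 / L2\<^sup>2 \<le> \<Delta>"
    using fmin[of "x - (2 * \<bar>?l\<bar> / L2 * sign (v \<bullet> grad f x)) *\<^sub>R v"] x start by linarith
  then show ?thesis using pos by (simp add: field_simps)
qed

text \<open>For \<open>\<alpha> = L1\<close> smoothness alone gives the curvature bound. A pass that
  does not stop lowers \<open>f\<close> by \<open>q \<ge> 1\<close> units, because
  \<open>27/1600 \<le> 3/100\<close>, and takes time at most
  \<open>(2 + q) W \<le> 3 q W\<close>.\<close>

lemma ancm_loop_deterministic:
  assumes \<alpha>: "\<alpha> = L1" and costs: "0 \<le> t_grad R" "0 \<le> t_arith R"
    and W: "real J * (2 * t_grad R + 38 * t_arith R) + 2 * t_grad R + 45 * t_arith R \<le> W"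
    and x: "f x \<le> f x1"
  shows "\<exists>x' t'. ancm_loop R E \<omega> f \<epsilon> L1 L2 \<alpha> \<Delta> \<delta>'' x n t = Some (x', t') \<and>
    norm (grad f x') \<le> \<epsilon> \<and> f x' \<le> f x1 \<and> t' \<le> t + W * (1 + 3 * (f x - fmin) / dec_unit)"
proof -
  define A where "A = t_arith R"
  define G where "G = t_grad R + 11 * A"
  have GA: "0 \<le> G" "0 \<le> A" and A0: "0 \<le> t_grad R" using costs by (auto simp: G_def A_def)
  have J0: "0 \<le> real J * (2 * t_grad R + 38 * t_arith R)" using costs by simp
  have W': "real J * (2 * G + 16 * A) + 2 * G + 23 * A \<le> W"
  proof -
    have "2 * G + 16 * A = 2 * t_grad R + 38 * t_arith R" by (simp add: G_def A_def)
    moreover have "2 * G = 2 * t_grad R + 22 * t_arith R" by (simp add: G_def A_def)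
    ultimately show ?thesis using W by (simp only: A_def)
  qed
  have W2: "2 * t_grad R + 45 * A \<le> W" using W J0 by (simp add: A_def)
  then have W0: "0 \<le> W" using A0 GA by linarith
  obtain k :: nat where k: "f x - fmin < real k * dec_unit"
    using reals_Archimedean3[OF dec_unit_pos] by blast
  show ?thesis
    using x k
  proof (induction k arbitrary: x n t)
    case 0
    then show ?case using fmin[of x] by simp
  next
    case (Suc k)
    have unfold: "ancm_loop R E \<omega> f \<epsilon> L1 L2 \<alpha> \<Delta> \<delta>'' x n t =
       (if norm (grad f x) \<le> \<epsilon> then Some (x, t + A + t_grad R + 3 * A)
        else Option.bind (acagd (\<lambda>w. f w + L1 * (max (norm (w - x) - \<alpha> / L2) 0)\<^sup>2) G A x (\<epsilon> / 2) (3 * \<alpha>) (5 * L1)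
             (t + A + t_grad R + 6 * A))
           (\<lambda>(x', t''). ancm_loop R E \<omega> f \<epsilon> L1 L2 \<alpha> \<Delta> \<delta>'' x' n t''))"
      by (subst ancm_loop.simps) (simp add: \<alpha> A_def G_def)
    have gap: "0 \<le> 3 * (f x - fmin) / dec_unit"
      using fmin[of x] dec_unit_pos by (intro divide_nonneg_pos mult_nonneg_nonneg) auto
    show ?case
    proof (cases "norm (grad f x) \<le> \<epsilon>")
      case True
      have "W * 1 \<le> W * (1 + 3 * (f x - fmin) / dec_unit)"
        by (rule mult_left_mono) (use W0 gap in linarith)+
      then show ?thesis using True Suc.prems W2 GA A0 unfolding unfold by auto
    next
      case False
      have "- \<alpha> * (norm v)\<^sup>2 \<le> hess f x v \<bullet> v" for v
        using curvature_ge_L1[of v x] by (simp add: \<alpha>)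
      then obtain t1 where run:
          "acagd (\<lambda>w. f w + L1 * (max (norm (w - x) - \<alpha> / L2) 0)\<^sup>2) G A x (\<epsilon> / 2) (3 * \<alpha>) (5 * L1)
             (t + A + t_grad R + 6 * A) = Some (descend x, t1)"
          and t1: "t1 \<le> (t + A + t_grad R + 6 * A) + W * (1 + (f x - f (descend x)) / dec_unit) + G + 3 * A"
          and dec: "min dec_unit (3 / 100 * \<alpha> * \<epsilon>\<^sup>2 / L1\<^sup>2) \<le> f x - f (descend x)"
        using descend_correct[OF _ Suc.prems(1) _ GA W', of "t + A + t_grad R + 6 * A"] False by auto
      have "dec_unit \<le> 3 / 100 * \<alpha> * \<epsilon>\<^sup>2 / L1\<^sup>2"
        unfolding dec_unit_def using pos by (simp add: \<alpha> power2_eq_square field_simps)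
      then have dec: "dec_unit \<le> f x - f (descend x)" using dec by simp
      define y where "y = descend x"
      have "f y \<le> f x1" "f y - fmin < real k * dec_unit"
        using dec dec_unit_pos Suc.prems by (auto simp: y_def distrib_right)
      from Suc.IH[OF this, of n t1] obtain x' t' where IH:
          "ancm_loop R E \<omega> f \<epsilon> L1 L2 \<alpha> \<Delta> \<delta>'' y n t1 = Some (x', t')"
          "norm (grad f x') \<le> \<epsilon>" "f x' \<le> f x1" "t' \<le> t1 + W * (1 + 3 * (f y - fmin) / dec_unit)" by blast
      have "t' \<le> t + W * (1 + 3 * (f x - fmin) / dec_unit)"
      proof -
        have "1 \<le> (f x - f y) / dec_unit" using dec dec_unit_pos by (simp add: y_def)
        then have "W * (2 + (f x - f y) / dec_unit + (1 + 3 * (f y - fmin) / dec_unit)) \<le> W * (1 + 3 * (f x - fmin) / dec_unit)"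
          using W0 by (intro mult_left_mono) (auto simp: diff_divide_distrib)
        moreover have "t1 \<le> t + W * (2 + (f x - f y) / dec_unit)"
          using t1 W2 GA A0 by (simp add: y_def G_def distrib_left)
        ultimately show ?thesis using IH(4) by (simp add: distrib_left)
      qed
      then show ?thesis
        unfolding unfold using False run IH by (simp add: y_def)
    qed
  qed
qed

end

section \<open>The randomized case, in which \<open>\<alpha>\<close> is smaller than
  \<open>L1\<close>\<close>

locale ancm_random = ancm_problem +
  fixes R :: costs and E :: eig_routine and B \<delta>'' W :: real
  assumes \<alpha>_less: "\<alpha> < L1" and \<alpha>_ge: "\<epsilon> * L2 \<le> \<alpha>\<^sup>2"
    and costs: "0 \<le> t_grad R" "0 \<le> t_arith R" "0 \<le> t_hvp R"
    and E: "eigenvector_subroutine B d L1 f E" and B: "0 \<le> B"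
    and \<delta>'': "0 < \<delta>''" "\<delta>'' < 1"
    and W_acagd: "real J * (2 * t_grad R + 38 * t_arith R) + 2 * t_grad R + 45 * t_arith R \<le> W"
    and W_ncd: "B * (1 + ln (real d / (\<delta>'' / (1 + 12 * L2\<^sup>2 * \<Delta> / \<alpha> ^ 3))) * sqrt (L1 / (\<alpha> / 2)))
      + t_hvp R + t_grad R + 12 * t_arith R \<le> W"
begin

definition \<delta>' :: real where "\<delta>' = \<delta>'' / (1 + 12 * L2\<^sup>2 * \<Delta> / \<alpha> ^ 3)"

definition ncd_unit :: real where "ncd_unit = \<alpha> ^ 3 / (12 * L2\<^sup>2)"

definition acagd_unit :: real where "acagd_unit = \<alpha> * \<epsilon> / (5 * L2)"

lemma \<delta>': "0 < \<delta>'" "\<delta>' < 1"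
proof -
  have "0 \<le> 12 * L2\<^sup>2 * \<Delta> / \<alpha> ^ 3" using pos by simp
  then show "0 < \<delta>'" "\<delta>' < 1" using \<delta>'' by (auto simp: \<delta>'_def divide_less_eq)
qed

text \<open>Makes \<open>dec_unit\<close> the common currency for time: a descent by one of the call
  units is also a descent by a time unit. Both comparisons rest on
  \<open>\<epsilon> L2 \<le> \<alpha>^2\<close>.\<close>

lemma units:
  "0 < ncd_unit" "0 < acagd_unit" "dec_unit \<le> ncd_unit" "dec_unit \<le> acagd_unit"
proof -
  show "0 < ncd_unit" "0 < acagd_unit" using pos by (auto simp: ncd_unit_def acagd_unit_def)
  have "dec_unit \<le> \<epsilon>\<^sup>2 / (12 * \<alpha>)" unfolding dec_unit_def using pos by (simp add: field_simps)
  also have "\<dots> \<le> ncd_unit"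
  proof -
    have "\<epsilon>\<^sup>2 * L2\<^sup>2 \<le> (\<alpha>\<^sup>2)\<^sup>2" using power_mono[OF \<alpha>_ge, of 2] pos by (simp add: power_mult_distrib)
    then show ?thesis unfolding ncd_unit_def using pos
      by (simp add: field_simps power2_eq_square power3_eq_cube)
  qed
  finally show "dec_unit \<le> ncd_unit" .
  have "dec_unit \<le> \<epsilon>\<^sup>2 / (5 * \<alpha>)" unfolding dec_unit_def using pos by (simp add: field_simps)
  also have "\<dots> \<le> acagd_unit"
    unfolding acagd_unit_def using pos mult_left_mono[OF \<alpha>_ge, of \<epsilon>]
    by (simp add: field_simps power2_eq_square)
  finally show "dec_unit \<le> acagd_unit" .
qed

definition direction :: "rvec \<Rightarrow> real \<Rightarrow> rvec" where
  "direction z s = eig_vec E (\<alpha> / 2) \<delta>' z s"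

definition curvature :: "rvec \<Rightarrow> real \<Rightarrow> real" where
  "curvature z s = direction z s \<bullet> hess f z (direction z s)"

text \<open>One eigenvector call leads either to an NCD step or to the end of NCD followed by ACAGD.
  The latter uses no seed, so the seed index alone numbers these points across all outer
  iterations.\<close>

definition next_point :: "rvec \<Rightarrow> real \<Rightarrow> rvec" where
  "next_point z s =
    (if curvature z s \<le> - \<alpha> / 2
     then z - (2 * \<bar>curvature z s\<bar> / L2 * sign (direction z s \<bullet> grad f z)) *\<^sub>R direction z s
     else descend z)"

text \<open>As long as the seeds are good, the run calls the eigenvector subroutine at \<open>call_point 0 \<omega>\<close>,
  \<open>call_point 1 \<omega>\<close>, \<dots>. The sequence continues after the run has ended, and with bad seeds it need not
  describe the run: this makes it total and measurable.\<close>

primrec call_point :: "nat \<Rightarrow> (nat \<Rightarrow> real) \<Rightarrow> rvec" where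
  "call_point 0 \<omega> = x1"
| "call_point (Suc n) \<omega> = next_point (call_point n \<omega>) (\<omega> n)"

definition good_seed :: "rvec \<Rightarrow> real \<Rightarrow> bool" where
  "good_seed z s \<longleftrightarrow> lambda_min d (hess f z) \<ge> curvature z s - \<alpha> / 2"

lemma eig:
  assumes "z \<in> Rn d"
  shows "direction z s \<in> Rn d" "norm (direction z s) = 1" "0 \<le> eig_time E (\<alpha> / 2) \<delta>' z s"
    "eig_time E (\<alpha> / 2) \<delta>' z s + t_hvp R + t_grad R + 12 * t_arith R \<le> W"
    "measure (seed_law E) {s \<in> space (seed_law E). good_seed z s} \<ge> 1 - \<delta>'"
proof -
  have "0 < \<alpha> / 2" using pos by simp
  note * = E[unfolded eigenvector_subroutine_def, THEN conjunct2, THEN conjunct2, rule_format,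
      of "\<alpha> / 2" \<delta>', THEN conjunct2, rule_format, OF _ assms, simplified this \<delta>']
  show "direction z s \<in> Rn d" "norm (direction z s) = 1" "0 \<le> eig_time E (\<alpha> / 2) \<delta>' z s"
    using * by (auto simp: direction_def)
  have "eig_time E (\<alpha> / 2) \<delta>' z s \<le> B * (1 + ln (real d / \<delta>') * sqrt (L1 / (\<alpha> / 2)))"
    using * by auto
  then show "eig_time E (\<alpha> / 2) \<delta>' z s + t_hvp R + t_grad R + 12 * t_arith R \<le> W"
    using W_ncd unfolding \<delta>'_def by linarith
  show "measure (seed_law E) {s \<in> space (seed_law E). good_seed z s} \<ge> 1 - \<delta>'"
    using * by (simp add: good_seed_def curvature_def direction_def)
qed

lemma descend_in_Rn: "z \<in> Rn d \<Longrightarrow> descend z \<in> Rn d"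
  unfolding descend_def
  by (intro acagd_fuel_subspace subspace_Rn)
    (auto simp: penalized_grad_def shrink_def intro!: Rn_intros grad_in_Rn[OF fRn f_gderiv])

lemma next_point_in_Rn: "z \<in> Rn d \<Longrightarrow> next_point z s \<in> Rn d"
  by (auto simp: next_point_def intro!: Rn_intros eig descend_in_Rn)

text \<open>Must hold for every seed sequence, good or bad, because the subroutine is specified and
  measurable only at points of \<open>Rn d\<close>.\<close>

lemma call_point_in_Rn: "call_point n \<omega> \<in> Rn d"
  by (induction n) (auto intro: x1 next_point_in_Rn)

lemma call_point_past: "k \<le> n \<Longrightarrow> call_point k (comb_seq n \<omega> \<omega>') = call_point k \<omega>"
  by (induction k) (auto simp: comb_seq_less)

lemma prob_space_seed: "prob_space (seed_law E)"
  and sets_seed [measurable_cong]: "sets (seed_law E) = sets borel"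
  using E by (auto simp: eigenvector_subroutine_def)

sublocale seeds: sequence_space "seed_law E"
  by (rule sequence_space_of_prob_space[OF prob_space_seed])

lemma measurable_grad [measurable]: "grad f \<in> borel_measurable borel"
proof (rule borel_measurable_continuous_onI)
  show "continuous_on UNIV (grad f)"
    by (rule lipschitz_on_continuous_on[of L1])
      (use pos f_lipschitz in \<open>auto simp: lipschitz_on_def dist_norm\<close>)
qed

lemma measurable_direction:
  assumes "X \<in> borel_measurable M" "\<And>\<omega>. X \<omega> \<in> Rn d" "s \<in> measurable M (seed_law E)"
  shows "(\<lambda>\<omega>. direction (X \<omega>) (s \<omega>)) \<in> borel_measurable M"
proof -
  have "0 < \<alpha> / 2" using pos by simp
  then have "(\<lambda>(x, s). eig_vec E (\<alpha> / 2) \<delta>' x s)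
      \<in> borel_measurable (restrict_space borel (Rn d) \<Otimes>\<^sub>M seed_law E)"
    using E \<delta>' unfolding eigenvector_subroutine_def by blast
  moreover have "(\<lambda>\<omega>. (X \<omega>, s \<omega>)) \<in> measurable M (restrict_space borel (Rn d) \<Otimes>\<^sub>M seed_law E)"
    using assms by (intro measurable_Pair measurable_restrict_space2) auto
  ultimately have "(\<lambda>\<omega>. (\<lambda>(x, s). eig_vec E (\<alpha> / 2) \<delta>' x s) (X \<omega>, s \<omega>)) \<in> borel_measurable M"
    by (rule measurable_compose[rotated])
  then show ?thesis by (simp add: direction_def)
qed

lemma measurable_curvature:
  assumes "X \<in> borel_measurable M" "\<And>\<omega>. X \<omega> \<in> Rn d" "s \<in> measurable M (seed_law E)"
  shows "(\<lambda>\<omega>. curvature (X \<omega>) (s \<omega>)) \<in> borel_measurable M"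
proof -
  have "(\<lambda>p. snd p \<bullet> hess f (fst p) (snd p)) \<in> borel_measurable borel"
    by (intro borel_measurable_continuous_onI continuous_on_curvature[OF lh L2_nonneg])
  from measurable_compose[OF _ this, of "\<lambda>\<omega>. (X \<omega>, direction (X \<omega>) (s \<omega>))"]
  show ?thesis
    by (simp add: curvature_def borel_measurable_Pair assms measurable_direction)
qed

lemma measurable_descend:
  assumes [measurable]: "X \<in> borel_measurable M"
  shows "(\<lambda>\<omega>. descend (X \<omega>)) \<in> borel_measurable M"
  unfolding descend_def
proof (rule measurable_acagd_fuel)
  fix Y :: "'a \<Rightarrow> rvec" assume [measurable]: "Y \<in> borel_measurable M"
  show "(\<lambda>\<omega>. penalized_grad f L1 (\<alpha> / L2) (X \<omega>) (Y \<omega>)) \<in> borel_measurable M"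
    unfolding penalized_grad_def shrink_def by measurable
qed measurable

lemma measurable_call_point: "call_point n \<in> borel_measurable seeds.S"
proof (induction n)
  case (Suc n)
  note [measurable] = Suc
  have s [measurable]: "(\<lambda>\<omega>. \<omega> n) \<in> measurable seeds.S (seed_law E)" by measurable
  note [measurable] = measurable_curvature[OF Suc call_point_in_Rn s]
    measurable_direction[OF Suc call_point_in_Rn s] measurable_descend[OF Suc]
  have "call_point (Suc n) = (\<lambda>\<omega>. next_point (call_point n \<omega>) (\<omega> n))" by (simp add: fun_eq_iff)
  also have "\<dots> \<in> borel_measurable seeds.S"
    unfolding next_point_def sign_def by measurable
  finally show ?case .
qed simp

lemma good_event:
  fixes m :: nat
  defines "A \<equiv> {\<omega> \<in> space seeds.S. \<forall>n<m. good_seed (call_point n \<omega>) (\<omega> n)}"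
  shows "A \<in> sets seeds.S" "1 - real m * \<delta>' \<le> measure seeds.S A"
proof -
  let ?N = "restrict_space borel (Rn d)"
  define Bad where "Bad = {p \<in> space (?N \<Otimes>\<^sub>M seed_law E). \<not> good_seed (fst p) (snd p)}"
  have fst_Rn: "fst p \<in> Rn d" if "p \<in> space (?N \<Otimes>\<^sub>M seed_law E)" for p
    using that by (auto simp: space_pair_measure space_restrict_space)
  have space_seed: "space (seed_law E) = UNIV"
    using sets_eq_imp_space_eq[OF sets_seed] by simp
  have Bad: "Bad \<in> sets (?N \<Otimes>\<^sub>M seed_law E)"
  proof -
    \<comment> \<open>\<open>measurable_curvature\<close> asks for values in \<open>Rn d\<close>
      everywhere, also at pairs outside the space of the product; the default 0 supplies
      them.\<close>
    define X where "X p = (if fst p \<in> Rn d then fst p else 0)" for p :: "rvec \<times> real"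
    have [measurable]: "fst \<in> borel_measurable (?N \<Otimes>\<^sub>M seed_law E)"
      by (rule measurable_compose[OF measurable_fst]) (simp add: measurable_restrict_space1)
    have "{p \<in> space (?N \<Otimes>\<^sub>M seed_law E). fst p \<in> Rn d} = space (?N \<Otimes>\<^sub>M seed_law E)"
      using fst_Rn by auto
    then have X: "X \<in> borel_measurable (?N \<Otimes>\<^sub>M seed_law E)" "\<And>p. X p \<in> Rn d"
      unfolding X_def by (auto intro!: Rn_intros measurable_If)
    have [measurable]: "(\<lambda>x. lambda_min d (hess f x)) \<in> borel_measurable borel"
      by (intro borel_measurable_continuous_onI continuous_on_lambda_min_hess[OF d fRn lh L2_nonneg])
    note [measurable] = X(1) measurable_curvature[OF X measurable_snd]
    have "Bad = {p \<in> space (?N \<Otimes>\<^sub>M seed_law E). \<not> good_seed (X p) (snd p)}"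
      unfolding Bad_def X_def using fst_Rn by auto
    also have "\<dots> \<in> sets (?N \<Otimes>\<^sub>M seed_law E)" unfolding good_seed_def by measurable
    finally show ?thesis .
  qed
  have bad_prob: "measure (seed_law E) {s \<in> space (seed_law E). (x, s) \<in> Bad} \<le> \<delta>'"
    if "x \<in> space ?N" for x
  proof -
    have x: "x \<in> Rn d" using that by (simp add: space_restrict_space)
    have sec: "{s \<in> space (seed_law E). (x, s) \<in> Bad} \<in> sets (seed_law E)"
      using measurable_sets[OF measurable_Pair1'[OF that] Bad] by (simp add: vimage_def Int_def conj_commute)
    have "{s \<in> space (seed_law E). good_seed x s} = space (seed_law E) - {s \<in> space (seed_law E). (x, s) \<in> Bad}"
      using x by (auto simp: Bad_def space_pair_measure space_restrict_space)
    then have "measure (seed_law E) {s \<in> space (seed_law E). good_seed x s}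
        = 1 - measure (seed_law E) {s \<in> space (seed_law E). (x, s) \<in> Bad}"
      using prob_space.prob_compl[OF prob_space_seed sec] by simp
    then show ?thesis using eig(5)[OF x] by simp
  qed
  define bad where "bad n = {\<omega> \<in> space seeds.S. (call_point n \<omega>, \<omega> n) \<in> Bad}" for n
  have X: "call_point n \<in> measurable seeds.S ?N" for n
    by (intro measurable_restrict_space2 measurable_call_point) (auto intro: call_point_in_Rn)
  have bad: "bad n \<in> sets seeds.S" "measure seeds.S (bad n) \<le> \<delta>'" for n
    unfolding bad_def
    using seeds.adaptive_event_bound[OF X call_point_past[OF order_refl] Bad bad_prob] by auto
  have A: "A = space seeds.S - (\<Union>n<m. bad n)"
    unfolding A_def bad_def Bad_def using call_point_in_Rn
    by (auto simp: space_pair_measure space_restrict_space space_seed)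
  show "A \<in> sets seeds.S" unfolding A using bad by auto
  have "measure seeds.S (\<Union>n<m. bad n) \<le> (\<Sum>n<m. measure seeds.S (bad n))"
    by (intro seeds.finite_measure_subadditive_finite) (use bad in auto)
  also have "\<dots> \<le> real m * \<delta>'" using sum_bounded_above[of "{..<m}" _ \<delta>'] bad by auto
  finally show "1 - real m * \<delta>' \<le> measure seeds.S A"
    unfolding A using bad by (subst seeds.prob_compl) auto
qed

lemma next_point_descent:
  assumes z: "z \<in> Rn d" and c: "curvature z s \<le> - \<alpha> / 2"
  shows "f (next_point z s) \<le> f z - ncd_unit"
proof -
  have "f (next_point z s) \<le> f z - 2 / 3 * \<bar>curvature z s\<bar> ^ 3 / L2\<^sup>2"
    using negative_curvature_step[OF lh L2_nonneg pos(2) eig(2)[OF z] curvature_def] c pos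
    by (simp add: next_point_def)
  moreover have "ncd_unit = 2 / 3 * (\<alpha> / 2) ^ 3 / L2\<^sup>2" by (simp add: ncd_unit_def power3_eq_cube)
  moreover have "2 / 3 * (\<alpha> / 2) ^ 3 / L2\<^sup>2 \<le> 2 / 3 * \<bar>curvature z s\<bar> ^ 3 / L2\<^sup>2"
    using c pos by (intro divide_right_mono mult_left_mono power_mono) auto
  ultimately show ?thesis by linarith
qed

lemma W_nonneg: "0 \<le> W"
proof -
  have "0 \<le> real J * (2 * t_grad R + 38 * t_arith R)" using costs by simp
  then show ?thesis using W_acagd costs by linarith
qed

section \<open>Runs along good seeds\<close>

context
  fixes \<omega> :: "nat \<Rightarrow> real" and m :: nat
  assumes good: "\<And>n. n < m \<Longrightarrow> good_seed (call_point n \<omega>) (\<omega> n)"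
begin

text \<open>The second premise keeps the seeds good for all affordable steps and for the stopping
  call. That call certifies \<open>- \<alpha>\<close>: half comes from the stopping test, half from
  the accuracy of the subroutine. The last call point is \<open>descend\<close> of the returned
  point, which keeps \<open>call_point\<close> aligned with the outer loop.\<close>

lemma ncd_loop_run:
  assumes "f (call_point n \<omega>) - fmin < real k * ncd_unit"
    and "\<And>p. real p * ncd_unit \<le> f (call_point n \<omega>) - fmin \<Longrightarrow> n + p < m"
  shows "\<exists>p t'. ncd_loop R E \<omega> f L2 \<alpha> \<delta>' (call_point n \<omega>) n t = Some (call_point (n + p) \<omega>, Suc (n + p), t')
    \<and> f (call_point (n + p) \<omega>) \<le> f (call_point n \<omega>) - real p * ncd_unit
    \<and> - \<alpha> \<le> lambda_min d (hess f (call_point (n + p) \<omega>))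
    \<and> call_point (Suc (n + p)) \<omega> = descend (call_point (n + p) \<omega>)
    \<and> t' \<le> t + real (Suc p) * W"
  using assms
proof (induction k arbitrary: n t)
  case 0
  then show ?case using fmin[of "call_point n \<omega>"] by simp
next
  case (Suc k)
  define z where "z = call_point n \<omega>"
  define c where "c = curvature z (\<omega> n)"
  define T where "T = t + eig_time E (\<alpha> / 2) \<delta>' z (\<omega> n) + t_hvp R + 4 * t_arith R"
  have z: "z \<in> Rn d" by (simp add: z_def call_point_in_Rn)
  have "n < m" using Suc.prems(2)[of 0] fmin[of z] by (simp add: z_def)
  then have gd: "good_seed z (\<omega> n)" using good by (simp add: z_def)
  have next_z: "call_point (Suc n) \<omega> = next_point z (\<omega> n)" by (simp add: z_def)
  have unfold: "ncd_loop R E \<omega> f L2 \<alpha> \<delta>' z n t =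
      (if c \<le> - \<alpha> / 2 then ncd_loop R E \<omega> f L2 \<alpha> \<delta>' (next_point z (\<omega> n)) (Suc n) (T + t_grad R + 8 * t_arith R)
       else Some (z, Suc n, T))"
    by (subst ncd_loop.simps) (simp add: Let_def c_def T_def next_point_def curvature_def direction_def)
  have T: "T + t_grad R + 8 * t_arith R \<le> t + W"
    using eig(4)[OF z, of "\<omega> n"] by (simp add: T_def)
  show ?case
  proof (cases "c \<le> - \<alpha> / 2")
    case True
    have dec: "f (call_point (Suc n) \<omega>) \<le> f z - ncd_unit"
      unfolding next_z using next_point_descent[OF z] True by (simp add: c_def)
    have "f (call_point (Suc n) \<omega>) - fmin < real k * ncd_unit"
      using dec Suc.prems(1) by (simp add: z_def algebra_simps)
    moreover have "Suc n + p < m" if "real p * ncd_unit \<le> f (call_point (Suc n) \<omega>) - fmin" for p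
      using Suc.prems(2)[of "Suc p"] that dec by (simp add: z_def algebra_simps)
    ultimately obtain p t' where IH:
      "ncd_loop R E \<omega> f L2 \<alpha> \<delta>' (call_point (Suc n) \<omega>) (Suc n) (T + t_grad R + 8 * t_arith R)
        = Some (call_point (Suc n + p) \<omega>, Suc (Suc n + p), t')"
      "f (call_point (Suc n + p) \<omega>) \<le> f (call_point (Suc n) \<omega>) - real p * ncd_unit"
      "- \<alpha> \<le> lambda_min d (hess f (call_point (Suc n + p) \<omega>))"
      "call_point (Suc (Suc n + p)) \<omega> = descend (call_point (Suc n + p) \<omega>)"
      "t' \<le> T + t_grad R + 8 * t_arith R + real (Suc p) * W"
      using Suc.IH[of "Suc n" "T + t_grad R + 8 * t_arith R"] by blast
    have shift: "Suc n + p = n + Suc p" by simp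
    have "t' \<le> t + real (Suc (Suc p)) * W" using IH(5) T by (simp add: distrib_right)
    moreover have "f (call_point (n + Suc p) \<omega>) \<le> f z - real (Suc p) * ncd_unit"
      using IH(2) dec unfolding shift by (simp add: distrib_right)
    moreover have "ncd_loop R E \<omega> f L2 \<alpha> \<delta>' z n t = Some (call_point (n + Suc p) \<omega>, Suc (n + Suc p), t')"
      using IH(1) True unfolding unfold next_z shift by simp
    ultimately show ?thesis using IH(3,4) unfolding shift z_def by blast
  next
    case False
    have "- \<alpha> \<le> lambda_min d (hess f z)" using gd False by (simp add: good_seed_def c_def)
    moreover have "call_point (Suc n) \<omega> = descend z"
      using False unfolding next_z by (simp add: next_point_def c_def)
    moreover have "T \<le> t + W" using T costs by simp
    ultimately show ?thesis
      using False unfold by (intro exI[of _ 0] exI[of _ T]) (simp add: z_def)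
  qed
qed

text \<open>\<open>s = 1\<close> records that the gradient at the current point is already small, so that the run ends
  unless the next call of \<open>ncd\<close> makes progress. The premise on \<open>P\<close> and \<open>Q\<close> reserves two eigenvector
  calls per descent by \<open>ncd_unit\<close> and one per descent by \<open>acagd_unit\<close>.\<close>

lemma ancm_loop_run:
  assumes "f (call_point n \<omega>) \<le> f x1" and "s = 1 \<or> s = 2"
    and "s = 1 \<Longrightarrow> norm (grad f (call_point n \<omega>)) \<le> \<epsilon>"
    and "\<And>P Q. real P * ncd_unit + real Q * acagd_unit \<le> f (call_point n \<omega>) - fmin \<Longrightarrow> n + 2 * P + Q + s \<le> m"
  shows "\<exists>x' t'. ancm_loop R E \<omega> f \<epsilon> L1 L2 \<alpha> \<Delta> \<delta>'' (call_point n \<omega>) n t = Some (x', t') \<and>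
    norm (grad f x') \<le> \<epsilon> \<and> f x' \<le> f x1 \<and> - \<alpha> \<le> lambda_min d (hess f x') \<and>
    t' \<le> t + W * (5 * real s + 12 * ((f (call_point n \<omega>) - fmin) / dec_unit))"
  using assms
proof (induction "m - n" arbitrary: n s t rule: less_induct)
  case less
  define A where "A = t_arith R"
  define G where "G = t_grad R + 11 * A"
  define x where "x = call_point n \<omega>"
  have GA: "0 \<le> G" "0 \<le> A" and A0: "0 \<le> t_grad R" using costs by (auto simp: G_def A_def)
  have J0: "0 \<le> real J * (2 * t_grad R + 38 * t_arith R)" using costs by simp
  have W': "real J * (2 * G + 16 * A) + 2 * G + 23 * A \<le> W"
  proof -
    have "2 * G + 16 * A = 2 * t_grad R + 38 * t_arith R" by (simp add: G_def A_def)
    moreover have "2 * G = 2 * t_grad R + 22 * t_arith R" by (simp add: G_def A_def)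
    ultimately show ?thesis using W_acagd by (simp only: A_def)
  qed
  have W2: "2 * t_grad R + 45 * A \<le> W" using W_acagd J0 by (simp add: A_def)
  obtain k :: nat where k: "f x - fmin < real k * ncd_unit"
    using reals_Archimedean3[OF units(1)] by blast
  have budget: "n + 2 * P + Q + s \<le> m" if "real P * ncd_unit + real Q * acagd_unit \<le> f x - fmin" for P Q
    using less.prems(4) that by (simp add: x_def)
  have "n + p < m" if "real p * ncd_unit \<le> f x - fmin" for p
    using budget[of p 0] that less.prems(2) by auto
  then obtain p t1 where ncd:
      "ncd_loop R E \<omega> f L2 \<alpha> \<delta>' x n (t + A + 8 * A) = Some (call_point (n + p) \<omega>, Suc (n + p), t1)"
      and dec: "f (call_point (n + p) \<omega>) \<le> f x - real p * ncd_unit"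
      and lam: "- \<alpha> \<le> lambda_min d (hess f (call_point (n + p) \<omega>))"
      and succ: "call_point (Suc (n + p)) \<omega> = descend (call_point (n + p) \<omega>)"
      and t1: "t1 \<le> t + A + 8 * A + real (Suc p) * W"
    using ncd_loop_run[of n k "t + A + 8 * A"] k unfolding x_def by blast
  define y where "y = call_point (n + p) \<omega>"
  define x' where "x' = call_point (Suc (n + p)) \<omega>"
  have unfold: "ancm_loop R E \<omega> f \<epsilon> L1 L2 \<alpha> \<Delta> \<delta>'' x n t =
     (if norm (grad f y) \<le> \<epsilon> then Some (y, t1 + t_grad R + 3 * A)
      else Option.bind (acagd (\<lambda>w. f w + L1 * (max (norm (w - y) - \<alpha> / L2) 0)\<^sup>2) G A y (\<epsilon> / 2) (3 * \<alpha>) (5 * L1)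
           (t1 + t_grad R + 6 * A))
         (\<lambda>(x', t''). ancm_loop R E \<omega> f \<epsilon> L1 L2 \<alpha> \<Delta> \<delta>'' x' (Suc (n + p)) t''))"
    using \<alpha>_less ncd
    by (subst ancm_loop.simps) (simp add: ncd_def A_def G_def y_def flip: \<delta>'_def)
  have pu: "real p * dec_unit \<le> real p * ncd_unit" using units(3) by (intro mult_left_mono) auto
  have y_le: "f y \<le> f x" using dec units(1) by (simp add: y_def) (smt (verit) mult_nonneg_nonneg of_nat_0_le_iff)
  have y1: "f y \<le> f x1" using y_le less.prems(1) by (simp add: x_def)
  have "(real p * dec_unit + (f y - fmin)) / dec_unit \<le> (f x - fmin) / dec_unit"
    using dec pu dec_unit_pos by (intro divide_right_mono) (auto simp: y_def)
  then have drop: "real p + (f y - fmin) / dec_unit \<le> (f x - fmin) / dec_unit"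
    using dec_unit_pos by (simp only: add_divide_distrib) simp
  show ?case
  proof (cases "norm (grad f y) \<le> \<epsilon>")
    case True
    have "real p \<le> (f x - fmin) / dec_unit" using drop divide_nonneg_pos[OF _ dec_unit_pos, of "f y - fmin"] fmin[of y] by simp
    moreover have "1 \<le> real s" using less.prems(2) by auto
    ultimately have "real p + 2 \<le> 5 * real s + 12 * ((f x - fmin) / dec_unit)" by linarith
    then have "W * (real p + 2) \<le> W * (5 * real s + 12 * ((f x - fmin) / dec_unit))"
      by (rule mult_left_mono[OF _ W_nonneg])
    moreover have "t1 + t_grad R + 3 * A \<le> t + W * (real p + 2)"
      using t1 W2 A0 GA by (simp add: algebra_simps)
    ultimately show ?thesis
      unfolding x_def[symmetric] using True unfold y1 lam by (auto simp: y_def)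
  next
    case False
    have "- \<alpha> * (norm v)\<^sup>2 \<le> hess f y v \<bullet> v" for v
      using curvature_ge[OF lam] by (simp add: y_def)
    then obtain t2 where run:
        "acagd (\<lambda>w. f w + L1 * (max (norm (w - y) - \<alpha> / L2) 0)\<^sup>2) G A y (\<epsilon> / 2) (3 * \<alpha>) (5 * L1)
           (t1 + t_grad R + 6 * A) = Some (x', t2)"
        and t2: "t2 \<le> (t1 + t_grad R + 6 * A) + W * (1 + (f y - f x') / dec_unit) + G + 3 * A"
        and min_dec: "min dec_unit (3 / 100 * \<alpha> * \<epsilon>\<^sup>2 / L1\<^sup>2) \<le> f y - f x'"
        and alt: "norm (grad f x') \<le> \<epsilon> \<or> min (3 * \<alpha> ^ 3 / L2\<^sup>2) (\<alpha> * \<epsilon> / (5 * L2)) \<le> f y - f x'"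
      using descend_correct[OF _ y1 _ GA W', of "t1 + t_grad R + 6 * A"] False
      unfolding x'_def succ y_def by auto
    have "0 < 3 / 100 * \<alpha> * \<epsilon>\<^sup>2 / L1\<^sup>2" using pos by simp
    then have x'_le: "f x' \<le> f y" using min_dec dec_unit_pos by linarith
    have x'1: "f x' \<le> f x1" using x'_le y1 by simp
    have ps: "s = 2 \<or> 1 \<le> p"
    proof (rule ccontr)
      assume "\<not> (s = 2 \<or> 1 \<le> p)"
      then have "s = 1" "p = 0" using less.prems(2) by auto
      then show False using less.prems(3) False by (simp add: y_def x_def)
    qed
    define D where "D = (f y - f x') / dec_unit"
    have D0: "0 \<le> D" using x'_le dec_unit_pos by (simp add: D_def)
    have t2': "t2 \<le> t + W * (real p + 4 + D)"
      using t1 t2 W2 A0 GA by (simp add: D_def G_def algebra_simps)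
    have drop': "real p + D + (f x' - fmin) / dec_unit \<le> (f x - fmin) / dec_unit"
      using drop by (simp add: D_def diff_divide_distrib)
    define s' :: nat where "s' = (if norm (grad f x') \<le> \<epsilon> then 1 else 2)"
    have big: "min (36 * ncd_unit) acagd_unit \<le> f y - f x'" if "s' = 2"
      using alt that by (simp add: s'_def ncd_unit_def acagd_unit_def split: if_splits)
    have D1: "1 \<le> D" if "s' = 2"
    proof -
      have "dec_unit \<le> f y - f x'" using big[OF that] units by (auto simp: min_le_iff_disj)
      then show ?thesis using dec_unit_pos by (simp add: D_def)
    qed
    \<comment> \<open>This pass uses \<open>p + 1\<close> calls. The second call reserved per NCD
      step is for the pass it may cause: from a small gradient (\<open>s = 1\<close>) the run
      reaches ACAGD only if NCD has moved, so \<open>2 \<le> p + s\<close> always. That covers the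
      case \<open>s' = 1\<close>; for \<open>s' = 2\<close> the descent of ACAGD supplies the
      missing call.\<close>
    have budget': "Suc (n + p) + 2 * P + Q + s' \<le> m"
      if PQ: "real P * ncd_unit + real Q * acagd_unit \<le> f x' - fmin" for P Q
    proof -
      have use: "n + 2 * (P + p + i) + (Q + j) + s \<le> m"
        if "real i * ncd_unit + real j * acagd_unit \<le> f y - f x'" for i j
        using budget[of "P + p + i" "Q + j"] PQ that dec
        by (simp add: y_def distrib_right)
      show ?thesis
      proof (cases "s' = 1")
        case True
        then show ?thesis using use[of 0 0] x'_le ps less.prems(2) by auto
      next
        case False
        then have s': "s' = 2" by (simp add: s'_def split: if_splits)
        have "ncd_unit \<le> 36 * ncd_unit" using units(1) by simp
        then consider "real 1 * ncd_unit + real 0 * acagd_unit \<le> f y - f x'"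
          | "real 0 * ncd_unit + real 1 * acagd_unit \<le> f y - f x'"
          using big[OF s'] by (auto simp: min_le_iff_disj)
        then show ?thesis
          by cases (use use[of 1 0] use[of 0 1] ps s' less.prems(2) in auto)
      qed
    qed
    have "n < m" using budget[of 0 0] fmin[of x] less.prems(2) by auto
    then have "m - Suc (n + p) < m - n" by simp
    moreover have "s' = 1 \<or> s' = 2" "s' = 1 \<Longrightarrow> norm (grad f x') \<le> \<epsilon>"
      by (auto simp: s'_def split: if_splits)
    ultimately obtain xf t' where IH:
      "ancm_loop R E \<omega> f \<epsilon> L1 L2 \<alpha> \<Delta> \<delta>'' x' (Suc (n + p)) t2 = Some (xf, t')"
      "norm (grad f xf) \<le> \<epsilon>" "f xf \<le> f x1" "- \<alpha> \<le> lambda_min d (hess f xf)"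
      "t' \<le> t2 + W * (5 * real s' + 12 * ((f x' - fmin) / dec_unit))"
      using less.hyps[of "Suc (n + p)" s' t2] x'1 budget' unfolding x'_def by blast
    have "real p + 4 + D + (5 * real s' + 12 * ((f x' - fmin) / dec_unit)) \<le> 5 * real s + 12 * ((f x - fmin) / dec_unit)"
    proof -
      \<comment> \<open>A pass ending with a large gradient has \<open>D \<ge> 1\<close>, and a pass
        beginning with \<open>s = 1\<close> has \<open>p \<ge> 1\<close>; the factor 12 then
        dominates. A pass from \<open>s = 2\<close> to \<open>s' = 1\<close> is paid for by the drop
        of 5.\<close>
      have "real p + 4 + D + 5 * real s' \<le> 5 * real s + 12 * (real p + D)"
      proof (cases "s' = 2")
        case True
        then show ?thesis using D1 ps less.prems(2) by auto
      next
        case False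
        then have "s' = 1" by (simp add: s'_def split: if_splits)
        then show ?thesis using D0 ps less.prems(2) by auto
      qed
      moreover have "X + (Y + 12 * a) \<le> Z + 12 * b"
        if "X + Y \<le> Z + 12 * (real p + D)" "real p + D + a \<le> b" for X Y Z a b
        using that by simp
      ultimately show ?thesis using drop' by blast
    qed
    then have "W * (real p + 4 + D + (5 * real s' + 12 * ((f x' - fmin) / dec_unit)))
        \<le> W * (5 * real s + 12 * ((f x - fmin) / dec_unit))"
      by (rule mult_left_mono[OF _ W_nonneg])
    then have "t' \<le> t + W * (5 * real s + 12 * ((f x - fmin) / dec_unit))"
      using IH(5) t2' by (simp add: distrib_left)
    then show ?thesis
      unfolding x_def[symmetric] using False unfold run IH by auto
  qed
qed

end

end

section \<open>Parameters and running time\<close>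

locale parameters =
  fixes d :: nat and L1 L2 \<Delta> \<epsilon> \<delta> \<alpha> \<tau> :: real
  assumes d: "1 \<le> d" and pos: "0 < L1" "0 < L2" "0 < \<Delta>" "0 < \<epsilon>" "0 < \<delta>" "\<delta> < 1"
    and \<alpha>: "\<alpha> = min L1 (max (\<epsilon>\<^sup>2 / \<Delta>) (\<epsilon> powr (1/2) * L2 powr (1/2)))"
    and \<tau>: "\<tau> = 1 + 1 / \<epsilon> + 1 / \<delta> + real d + L1 + L2 + \<Delta>"
begin

abbreviation root_scale :: real where
  "root_scale \<equiv> \<epsilon> powr (1/2) * L2 powr (1/2)"

lemma root_scale: "0 < root_scale" "root_scale\<^sup>2 = \<epsilon> * L2"
  using pos by (simp_all add: power_mult_distrib powr_half_sqrt)

lemma \<alpha>_pos: "0 < \<alpha>" and \<alpha>_le: "\<alpha> \<le> L1"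
  using pos by (auto simp: \<alpha> less_max_iff_disj)

lemma \<tau>_ge: "1 / \<epsilon> \<le> \<tau>" "1 / \<delta> \<le> \<tau>" "real d \<le> \<tau>" "L1 \<le> \<tau>" "\<Delta> \<le> \<tau>" "3 \<le> \<tau>"
proof -
  have "0 < 1 / \<epsilon>" "1 < 1 / \<delta>" "1 \<le> real d" using pos d by auto
  then show "1 / \<epsilon> \<le> \<tau>" "1 / \<delta> \<le> \<tau>" "real d \<le> \<tau>" "L1 \<le> \<tau>" "\<Delta> \<le> \<tau>" "3 \<le> \<tau>"
    using pos unfolding \<tau> by linarith+
qed

lemma ln_\<tau>_ge: "1 \<le> ln \<tau>"
proof -
  have "exp 1 \<le> \<tau>" using exp_le \<tau>_ge(6) by linarith
  then show ?thesis using \<tau>_ge(6) by (subst ln_ge_iff) auto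
qed

text \<open>As \<open>3 \<le> \<tau>\<close>, numerical constants are absorbed into powers of
  \<open>\<tau>\<close>, so that no additive constant is left beside the logarithm.\<close>

lemma ln_le_power:
  assumes "0 < x" "x \<le> 3 ^ j * \<tau> ^ k"
  shows "ln x \<le> real (j + k) * ln \<tau>"
proof -
  have "(3::real) ^ j * \<tau> ^ k \<le> \<tau> ^ j * \<tau> ^ k"
    using \<tau>_ge(6) by (intro mult_right_mono power_mono) auto
  then have "x \<le> \<tau> ^ (j + k)" using assms(2) by (simp add: power_add)
  then have "ln x \<le> ln (\<tau> ^ (j + k))" using assms(1) by simp
  also have "\<dots> = real (j + k) * ln \<tau>" using \<tau>_ge(6) by (simp add: ln_realpow)
  finally show ?thesis .
qed

lemma eps_inv_square_le: "1 / \<epsilon>\<^sup>2 \<le> \<tau>\<^sup>2"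
  using power_mono[OF \<tau>_ge(1), of 2] pos by (simp add: power_divide)

lemma gap_ratio_le: "L1 * \<Delta> / \<epsilon>\<^sup>2 \<le> \<tau> ^ 4"
proof -
  have "L1 * \<Delta> * (1 / \<epsilon>\<^sup>2) \<le> \<tau> * \<tau> * \<tau>\<^sup>2"
    using pos \<tau>_ge eps_inv_square_le by (intro mult_mono) auto
  then show ?thesis by (simp add: power2_eq_square power4_eq_xxxx)
qed

lemma ratio_le: "L1 / \<alpha> \<le> max 1 (L1 * \<Delta> / \<epsilon>\<^sup>2)"
proof (cases "L1 \<le> \<epsilon>\<^sup>2 / \<Delta>")
  case True
  then have "\<alpha> = L1" by (simp add: \<alpha>)
  then show ?thesis using pos by simp
next
  case False
  then have "\<epsilon>\<^sup>2 / \<Delta> \<le> \<alpha>" by (simp add: \<alpha>)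
  then have "L1 / \<alpha> \<le> L1 / (\<epsilon>\<^sup>2 / \<Delta>)" using pos \<alpha>_pos by (intro divide_left_mono) auto
  then show ?thesis by simp
qed

lemma ratio_ge: "1 \<le> L1 / \<alpha>" "1 \<le> sqrt (L1 / \<alpha>)"
  using \<alpha>_le \<alpha>_pos by auto

lemma ratio_le_power: "L1 / \<alpha> \<le> \<tau> ^ 4"
proof -
  have "1 \<le> \<tau> ^ 4" using \<tau>_ge(6) by (simp add: one_le_power)
  then show ?thesis using ratio_le gap_ratio_le by linarith
qed

lemma agd_iterations:
  obtains J :: nat where
    "8 * ((5 * L1 + 2 * (3 * \<alpha>)) / (3 * \<alpha>)) * (5 * L1) * \<Delta>
        * (1 - 1 / sqrt ((5 * L1 + 2 * (3 * \<alpha>)) / (3 * \<alpha>))) ^ J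
      \<le> (prox_accuracy (\<epsilon> / 2) (3 * \<alpha>) (5 * L1))\<^sup>2"
    "real J \<le> 47 * (sqrt (L1 / \<alpha>) * ln \<tau>)"
proof -
  define \<kappa> where "\<kappa> = (5 * L1 + 2 * (3 * \<alpha>)) / (3 * \<alpha>)"
  \<comment> \<open>The factor by which the power must shrink the left-hand side:
    \<open>40 \<kappa> L1 \<Delta>\<close> divided by the squared accuracy
    \<open>\<epsilon>^2 / (200 \<kappa>)\<close>.\<close>
  define \<Lambda> where "\<Lambda> = 8000 * \<kappa>\<^sup>2 * (L1 * \<Delta> / \<epsilon>\<^sup>2)"
  define J where "J = nat \<lceil>sqrt \<kappa> * ln \<Lambda>\<rceil>"
  have \<kappa>_eq: "\<kappa> = 5 / 3 * (L1 / \<alpha>) + 2" using \<alpha>_pos by (simp add: \<kappa>_def field_simps)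
  have \<kappa>: "1 \<le> \<kappa>" "\<kappa> \<le> 11 / 3 * (L1 / \<alpha>)" using ratio_ge unfolding \<kappa>_eq by auto
  have \<Lambda>_pos: "0 < \<Lambda>" using \<kappa> pos by (simp add: \<Lambda>_def)
  have sq: "1 \<le> sqrt \<kappa>" using \<kappa> by simp
  have acc: "(prox_accuracy (\<epsilon> / 2) (3 * \<alpha>) (5 * L1))\<^sup>2 = 8 * \<kappa> * (5 * L1) * \<Delta> / \<Lambda>"
  proof -
    have "(prox_accuracy (\<epsilon> / 2) (3 * \<alpha>) (5 * L1))\<^sup>2 = (\<epsilon> / 2)\<^sup>2 * (3 * \<alpha> / (50 * (5 * L1 + 2 * (3 * \<alpha>))))"
    proof -
      have "0 \<le> 3 * \<alpha> / (50 * (5 * L1 + 2 * (3 * \<alpha>)))" using pos \<alpha>_pos by simp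
      then show ?thesis by (simp only: prox_accuracy_def power_mult_distrib real_sqrt_pow2)
    qed
    also have "3 * \<alpha> / (50 * (5 * L1 + 2 * (3 * \<alpha>))) = 1 / (50 * \<kappa>)"
      using pos \<alpha>_pos by (simp add: \<kappa>_def)
    also have "(\<epsilon> / 2)\<^sup>2 * (1 / (50 * \<kappa>)) = 8 * \<kappa> * (5 * L1) * \<Delta> / \<Lambda>"
      using pos \<kappa> by (simp add: \<Lambda>_def power2_eq_square field_simps)
    finally show ?thesis .
  qed
  have "(1 - 1 / sqrt \<kappa>) ^ J \<le> exp (- 1 / sqrt \<kappa>) ^ J"
    using exp_ge_add_one_self[of "- 1 / sqrt \<kappa>"] sq by (intro power_mono) auto
  also have "\<dots> = exp (- (real J / sqrt \<kappa>))" by (simp add: exp_of_nat_mult[symmetric])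
  also have "\<dots> \<le> exp (- ln \<Lambda>)"
  proof -
    have "sqrt \<kappa> * ln \<Lambda> \<le> real J" unfolding J_def by linarith
    then have "ln \<Lambda> \<le> real J / sqrt \<kappa>" using sq by (simp add: field_simps)
    then show ?thesis by simp
  qed
  also have "\<dots> = 1 / \<Lambda>" using \<Lambda>_pos by (simp add: exp_minus inverse_eq_divide)
  finally have "8 * \<kappa> * (5 * L1) * \<Delta> * (1 - 1 / sqrt \<kappa>) ^ J \<le> 8 * \<kappa> * (5 * L1) * \<Delta> * (1 / \<Lambda>)"
    using pos \<kappa> by (intro mult_left_mono) auto
  then have J1: "8 * \<kappa> * (5 * L1) * \<Delta> * (1 - 1 / sqrt \<kappa>) ^ J \<le> (prox_accuracy (\<epsilon> / 2) (3 * \<alpha>) (5 * L1))\<^sup>2"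
    by (simp add: acc)
  have "\<kappa>\<^sup>2 \<le> (11 / 3 * \<tau> ^ 4)\<^sup>2" using \<kappa> ratio_le_power by (intro power_mono) auto
  then have "8000 * \<kappa>\<^sup>2 * (L1 * \<Delta> / \<epsilon>\<^sup>2) \<le> 8000 * (11 / 3 * \<tau> ^ 4)\<^sup>2 * \<tau> ^ 4"
    using gap_ratio_le pos by (intro mult_mono) auto
  also have "\<dots> = 968000 / 9 * \<tau> ^ 12" by (simp add: power_mult_distrib power2_eq_square flip: power_add)
  also have "\<dots> \<le> 3 ^ 11 * \<tau> ^ 12" using \<tau>_ge(6) by (intro mult_right_mono) auto
  finally have "ln \<Lambda> \<le> real (11 + 12) * ln \<tau>"
    using \<Lambda>_pos unfolding \<Lambda>_def[symmetric] by (intro ln_le_power) auto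
  then have lnL: "ln \<Lambda> \<le> 23 * ln \<tau>" by simp
  have sq2: "sqrt \<kappa> \<le> 2 * sqrt (L1 / \<alpha>)"
  proof -
    have "\<kappa> \<le> 4 * (L1 / \<alpha>)" using \<kappa> ratio_ge by linarith
    then have "sqrt \<kappa> \<le> sqrt (4 * (L1 / \<alpha>))" by (rule real_sqrt_le_mono)
    then show ?thesis by (simp only: real_sqrt_mult real_sqrt_four)
  qed
  define X where "X = sqrt (L1 / \<alpha>) * ln \<tau>"
  have X: "1 \<le> X" unfolding X_def using mult_mono[OF ratio_ge(2) ln_\<tau>_ge] ratio_ge(2) by simp
  have "sqrt \<kappa> * ln \<Lambda> \<le> sqrt \<kappa> * (23 * ln \<tau>)" using sq lnL by (intro mult_left_mono) auto
  also have "\<dots> \<le> 2 * sqrt (L1 / \<alpha>) * (23 * ln \<tau>)" using sq2 ln_\<tau>_ge by (intro mult_right_mono) auto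
  also have "\<dots> = 46 * X" by (simp add: X_def)
  finally have "sqrt \<kappa> * ln \<Lambda> \<le> 46 * X" .
  then have "real J \<le> 47 * X" unfolding J_def using X by linarith
  then show ?thesis using J1 that unfolding \<kappa>_def X_def by blast
qed

text \<open>The cost of one AGD call times the number of calls, up to constants and logarithms. The
  first part uses that \<open>\<alpha>\<close> is \<open>L1\<close> or at least
  \<open>\<epsilon>^2 / \<Delta>\<close>. The second part is
  \<open>\<Delta> sqrt (L1 \<alpha>) / \<epsilon>^2\<close>, where
  \<open>\<alpha> \<le> \<epsilon>^2 / \<Delta> + root_scale\<close> and subadditivity of the square
  root give \<open>Y\<close> and the power \<open>1/4 - 2 = - 7/4\<close> of
  \<open>\<epsilon>\<close>.\<close>

lemma time_bound:
  "sqrt (L1 / \<alpha>) * (1 + \<Delta> * \<alpha> / \<epsilon>\<^sup>2) \<le>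
     2 * (\<Delta> * L1 powr (1/2) * L2 powr (1/4) * \<epsilon> powr (-7/4)
          + \<Delta> powr (1/2) * L1 powr (1/2) * \<epsilon> powr (-1) + 1)"
proof -
  define Y where "Y = sqrt \<Delta> * sqrt L1 / \<epsilon>"
  have Y0: "0 \<le> Y" using pos by (simp add: Y_def)
  have Y: "Y = \<Delta> powr (1/2) * L1 powr (1/2) * \<epsilon> powr (-1)"
    using pos by (simp add: Y_def powr_half_sqrt powr_minus_divide)
  define Z where "Z = \<Delta> * L1 powr (1/2) * L2 powr (1/4) * \<epsilon> powr (-7/4)"
  have Z0: "0 \<le> Z" using pos by (simp add: Z_def)
  have "sqrt (L1 / \<alpha>) \<le> sqrt (max 1 (L1 * \<Delta> / \<epsilon>\<^sup>2))" by (rule real_sqrt_le_mono[OF ratio_le])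
  also have "\<dots> \<le> 1 + Y"
  proof -
    have "sqrt (L1 * \<Delta> / \<epsilon>\<^sup>2) = Y" using pos by (simp add: Y_def real_sqrt_divide real_sqrt_mult)
    then show ?thesis using Y0 by (simp add: max_def)
  qed
  finally have first: "sqrt (L1 / \<alpha>) \<le> 1 + Y" .
  have "sqrt (L1 / \<alpha>) * (\<Delta> * \<alpha> / \<epsilon>\<^sup>2) = \<Delta> * sqrt L1 / \<epsilon>\<^sup>2 * sqrt \<alpha>"
    using \<alpha>_pos pos by (simp add: real_sqrt_divide field_simps)
  also have "\<dots> \<le> \<Delta> * sqrt L1 / \<epsilon>\<^sup>2 * (\<epsilon> / sqrt \<Delta> + \<epsilon> powr (1/4) * L2 powr (1/4))"
  proof (rule mult_left_mono)
    have "\<alpha> \<le> \<epsilon>\<^sup>2 / \<Delta> + root_scale"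
    proof -
      have "0 \<le> \<epsilon>\<^sup>2 / \<Delta>" using pos by simp
      then have "max (\<epsilon>\<^sup>2 / \<Delta>) root_scale \<le> \<epsilon>\<^sup>2 / \<Delta> + root_scale" using root_scale(1) by linarith
      then show ?thesis unfolding \<alpha> by linarith
    qed
    then have "sqrt \<alpha> \<le> sqrt (\<epsilon>\<^sup>2 / \<Delta> + root_scale)" by (rule real_sqrt_le_mono)
    also have "\<dots> \<le> sqrt (\<epsilon>\<^sup>2 / \<Delta>) + sqrt root_scale"
      using root_scale(1) pos by (intro sqrt_add_le_add_sqrt) auto
    also have "sqrt (\<epsilon>\<^sup>2 / \<Delta>) = \<epsilon> / sqrt \<Delta>" using pos by (simp add: real_sqrt_divide)
    also have "sqrt root_scale = \<epsilon> powr (1/4) * L2 powr (1/4)"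
      using pos by (simp add: powr_half_sqrt[symmetric] powr_mult powr_powr)
    finally show "sqrt \<alpha> \<le> \<epsilon> / sqrt \<Delta> + \<epsilon> powr (1/4) * L2 powr (1/4)" .
  qed (use pos in simp)
  also have "\<dots> = Y + Z"
  proof -
    have "\<Delta> * sqrt L1 / \<epsilon>\<^sup>2 * (\<epsilon> / sqrt \<Delta>) = Y"
      using pos real_sqrt_mult_self[of \<Delta>] by (simp add: Y_def power2_eq_square field_simps)
    moreover have "\<Delta> * sqrt L1 / \<epsilon>\<^sup>2 * (\<epsilon> powr (1/4) * L2 powr (1/4)) = Z"
    proof -
      have "\<epsilon> powr (1/4) / \<epsilon> powr 2 = \<epsilon> powr (1/4 - 2)" by (rule powr_diff[symmetric])
      then have e: "\<epsilon> powr (1/4) / \<epsilon>\<^sup>2 = \<epsilon> powr (-7/4)" using pos by simp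
      have "\<Delta> * sqrt L1 / \<epsilon>\<^sup>2 * (\<epsilon> powr (1/4) * L2 powr (1/4))
          = \<Delta> * sqrt L1 * L2 powr (1/4) * (\<epsilon> powr (1/4) / \<epsilon>\<^sup>2)" by simp
      also have "\<dots> = Z" unfolding e Z_def using pos by (simp add: powr_half_sqrt)
      finally show ?thesis .
    qed
    ultimately show ?thesis by (simp only: distrib_left)
  qed
  finally have "sqrt (L1 / \<alpha>) * (1 + \<Delta> * \<alpha> / \<epsilon>\<^sup>2) \<le> 1 + Y + (Y + Z)"
    using first by (simp only: distrib_left mult_1_right)
  also have "\<dots> \<le> 2 * (Z + Y + 1)" using Z0 by simp
  finally show ?thesis unfolding Z_def Y .
qed

lemma \<alpha>_le_square: "\<alpha> < L1 \<Longrightarrow> \<epsilon> * L2 \<le> \<alpha>\<^sup>2"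
proof -
  assume "\<alpha> < L1"
  then have "root_scale \<le> \<alpha>" by (auto simp: \<alpha> min_def split: if_splits)
  then show ?thesis using power_mono[of root_scale \<alpha> 2] root_scale by simp
qed

lemma lambda_min_bound:
  assumes lam: "- \<alpha> \<le> l" and desc: "l \<le> 0 \<Longrightarrow> 2 / 3 * \<bar>l\<bar> ^ 3 \<le> L2\<^sup>2 * \<Delta>"
  shows "- 2 * root_scale \<le> l"
proof (rule ccontr)
  let ?s = root_scale
  assume "\<not> - 2 * ?s \<le> l"
  then have l: "2 * ?s < - l" by simp
  then have "l \<le> 0" using root_scale(1) by linarith
  have "(2 * ?s) ^ 3 \<le> \<bar>l\<bar> ^ 3" using l root_scale(1) by (intro power_mono) auto
  then have "2 / 3 * (2 * ?s) ^ 3 \<le> L2\<^sup>2 * \<Delta>" using desc[OF \<open>l \<le> 0\<close>] by linarith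
  then have A: "16 / 3 * ?s ^ 3 \<le> L2\<^sup>2 * \<Delta>" by (simp add: power3_eq_cube)
  have "2 * ?s < \<alpha>" using l lam by linarith
  then have "2 * ?s < \<epsilon>\<^sup>2 / \<Delta>" using root_scale(1) unfolding \<alpha> by (auto simp: max_def split: if_splits)
  then have B: "2 * ?s * \<Delta> < \<epsilon>\<^sup>2" using pos by (simp add: field_simps)
  have s4: "?s ^ 4 = \<epsilon>\<^sup>2 * L2\<^sup>2"
    using arg_cong[OF root_scale(2), of "\<lambda>x. x\<^sup>2"] by (simp only: power_mult_distrib power_mult[symmetric]) simp
  have "32 / 3 * ?s ^ 4 = 2 * ?s * (16 / 3 * ?s ^ 3)" by (simp add: power3_eq_cube power4_eq_xxxx)
  also have "\<dots> \<le> 2 * ?s * (L2\<^sup>2 * \<Delta>)" using A root_scale(1) by (intro mult_left_mono) auto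
  also have "\<dots> = L2\<^sup>2 * (2 * ?s * \<Delta>)" by simp
  also have "\<dots> < L2\<^sup>2 * \<epsilon>\<^sup>2" using B pos by (intro mult_strict_left_mono) auto
  also have "\<dots> = ?s ^ 4" by (simp add: s4)
  finally show False using root_scale(1) by simp
qed

section \<open>Counting the eigenvector calls\<close>

definition ncd_calls :: real where "ncd_calls = 12 * L2\<^sup>2 * \<Delta> / \<alpha> ^ 3"

text \<open>\<open>\<Delta>\<close> divided by \<open>acagd_unit\<close>, as
  \<open>ncd_calls\<close> is \<open>\<Delta>\<close> divided by \<open>ncd_unit\<close>: how many
  descents of each kind the gap can pay for.\<close>

definition acagd_calls :: real where "acagd_calls = 5 * L2 * \<Delta> / (\<alpha> * \<epsilon>)"

definition outer_bound :: int where
  "outer_bound = \<lceil>1 + \<Delta> * (12 * L2\<^sup>2 / \<alpha> ^ 3 + sqrt 10 * L2 / (\<alpha> * \<epsilon>))\<rceil>"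

lemma outer_bound_eq: "outer_bound = \<lceil>1 + ncd_calls + sqrt 10 / 5 * acagd_calls\<rceil>"
  by (simp add: outer_bound_def ncd_calls_def acagd_calls_def field_simps)

lemma calls_pos: "0 < ncd_calls" "0 < acagd_calls"
  using pos \<alpha>_pos by (auto simp: ncd_calls_def acagd_calls_def)

lemma outer_bound_ge: "2 \<le> outer_bound"
proof -
  have "0 < sqrt 10 / 5 * acagd_calls" using calls_pos by simp
  then have "1 < 1 + ncd_calls + sqrt 10 / 5 * acagd_calls" using calls_pos by linarith
  then show ?thesis unfolding outer_bound_eq by linarith
qed

text \<open>If \<open>ncd_calls < 1\<close> then \<open>\<alpha> = \<epsilon>\<^sup>2 / \<Delta>\<close>, and the union bound of \<open>call_count\<close> has hardly any slack.\<close>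

lemma few_ncd_calls:
  assumes "\<alpha> < L1" "ncd_calls < 1"
  shows "12 * acagd_calls\<^sup>2 = 25 * ncd_calls"
proof -
  have max: "\<alpha> = max (\<epsilon>\<^sup>2 / \<Delta>) root_scale" using assms(1) by (auto simp: \<alpha> min_def split: if_splits)
  \<comment> \<open>Otherwise \<open>\<alpha>^2 = \<epsilon> L2\<close>, and then
    \<open>ncd_calls = 12 \<Delta> \<alpha> / \<epsilon>^2\<close> is at least 12.\<close>
  have "\<alpha> = \<epsilon>\<^sup>2 / \<Delta>"
  proof (rule ccontr)
    assume "\<alpha> \<noteq> \<epsilon>\<^sup>2 / \<Delta>"
    then have eq: "\<alpha> = root_scale" and ge: "\<epsilon>\<^sup>2 / \<Delta> \<le> \<alpha>" using max by (auto simp: max_def split: if_splits)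
    have "\<alpha>\<^sup>2 = \<epsilon> * L2" using root_scale(2) by (simp add: eq)
    then have "L2\<^sup>2 * \<epsilon>\<^sup>2 = \<alpha> ^ 4"
      by (metis mult.commute power_mult power_mult_distrib numeral_Bit0 mult_2 numeral_times_numeral semiring_norm(11) semiring_norm(13))
    then have "ncd_calls * \<epsilon>\<^sup>2 = 12 * \<Delta> * \<alpha>"
      using \<alpha>_pos by (simp add: ncd_calls_def field_simps power4_eq_xxxx power3_eq_cube)
    moreover have "\<epsilon>\<^sup>2 \<le> \<Delta> * \<alpha>" using ge pos by (simp add: field_simps)
    moreover have "ncd_calls * \<epsilon>\<^sup>2 < 1 * \<epsilon>\<^sup>2" using assms(2) pos by (intro mult_strict_right_mono) auto
    moreover have "0 < \<epsilon>\<^sup>2" using pos by simp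
    ultimately show False by linarith
  qed
  then have "\<epsilon>\<^sup>2 = \<alpha> * \<Delta>" using pos by simp
  have "12 * acagd_calls\<^sup>2 = 300 * L2\<^sup>2 * \<Delta>\<^sup>2 / (\<alpha>\<^sup>2 * \<epsilon>\<^sup>2)"
    by (simp add: acagd_calls_def power_divide power_mult_distrib)
  also have "\<dots> = 25 * ncd_calls"
    using pos \<alpha>_pos unfolding \<open>\<epsilon>\<^sup>2 = \<alpha> * \<Delta>\<close> ncd_calls_def
    by (simp add: field_simps power2_eq_square power3_eq_cube)
  finally show ?thesis .
qed

text \<open>If \<open>1 \<le> ncd_calls\<close>, the factor \<open>1 + ncd_calls \<ge> 2\<close>
  makes up for \<open>sqrt 10 / 5 < 1\<close>, since \<open>acagd_calls\<close> is at most twice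
  \<open>sqrt 10 / 5 * acagd_calls\<close>; the rest is \<open>2 + 2 a \<le> (1 + a)^2\<close> for
  \<open>a = ncd_calls\<close>. Otherwise \<open>P = 0\<close> and \<open>Q \<le> 1\<close>, and
  only \<open>outer_bound \<ge> 2\<close> or \<open>outer_bound \<ge> 3\<close> is required.\<close>

lemma call_count:
  fixes P Q :: nat
  assumes "\<alpha> < L1" and PQ: "real P / ncd_calls + real Q / acagd_calls \<le> 1"
  shows "real (2 * P + Q + 2) \<le> outer_bound * (1 + ncd_calls)"
proof -
  let ?a = ncd_calls and ?y = acagd_calls
  have sqrt10: "3 \<le> sqrt 10" by (rule real_le_rsqrt) simp
  have y: "3 / 5 * ?y \<le> sqrt 10 / 5 * ?y" using sqrt10 calls_pos by (intro mult_right_mono) auto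
  have K: "1 + ?a + sqrt 10 / 5 * ?y \<le> outer_bound" unfolding outer_bound_eq by linarith
  have "0 \<le> real P / ?a" "0 \<le> real Q / ?y" using calls_pos by simp_all
  then have Pa: "real P / ?a \<le> 1" and Qy: "real Q / ?y \<le> 1" using PQ by linarith+
  have P: "real P \<le> ?a" using Pa calls_pos(1) by (subst (asm) pos_divide_le_eq) auto
  have Q: "real Q \<le> ?y" using Qy calls_pos(2) by (subst (asm) pos_divide_le_eq) auto
  show ?thesis
  proof (cases "1 \<le> ?a")
    case True
    have "2 * real P + real Q = 2 * ?a * (real P / ?a) + ?y * (real Q / ?y)" using calls_pos by simp
    also have "\<dots> \<le> (2 * ?a + ?y) * (real P / ?a) + (2 * ?a + ?y) * (real Q / ?y)"
      using calls_pos by (intro add_mono mult_right_mono) auto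
    also have "\<dots> = (2 * ?a + ?y) * (real P / ?a + real Q / ?y)" by (simp only: distrib_left)
    also have "\<dots> \<le> (2 * ?a + ?y) * 1" using PQ calls_pos by (intro mult_left_mono) auto
    finally have "real (2 * P + Q + 2) \<le> 2 + 2 * ?a + 2 * (3 / 5 * ?y)" using calls_pos by simp
    also have "\<dots> \<le> (1 + ?a + sqrt 10 / 5 * ?y) * (1 + ?a)"
    proof -
      define b where "b = sqrt 10 / 5 * ?y"
      have "2 * b \<le> b * (1 + ?a)" using True y calls_pos by (simp add: b_def)
      moreover have "1 * 1 \<le> ?a * ?a" using True by (intro mult_mono) auto
      ultimately have "2 + 2 * ?a + 2 * b \<le> (1 + ?a + b) * (1 + ?a)" by (simp add: algebra_simps)
      then show ?thesis using y unfolding b_def by linarith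
    qed
    also have "\<dots> \<le> outer_bound * (1 + ?a)" using K calls_pos by (intro mult_right_mono) auto
    finally show ?thesis .
  next
    case False
    then have rel: "12 * ?y\<^sup>2 = 25 * ?a" using few_ncd_calls assms(1) by simp
    have "P = 0" using P False by simp
    have "?y\<^sup>2 < 2\<^sup>2" using rel False by simp
    then have "?y < 2" by (rule power_less_imp_less_base) simp
    then consider "Q = 0" | "Q = 1" using Q by fastforce
    then show ?thesis
    proof cases
      case 1
      have "real_of_int 2 * 1 \<le> outer_bound * (1 + ?a)"
        using outer_bound_ge calls_pos by (intro mult_mono) auto
      then show ?thesis using 1 \<open>P = 0\<close> by simp
    next
      case 2
      then have "1 \<le> ?y" using Q by simp
      then have "1 \<le> ?y\<^sup>2" by (simp add: one_le_power)
      \<comment> \<open>\<open>acagd_calls \<ge> 1\<close> gives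
        \<open>ncd_calls \<ge> 12/25\<close>, and \<open>12/25 + 3/5 = 27/25\<close> narrowly
        exceeds 1; the ceiling then supplies the missing call.\<close>
      then have "2 < 1 + ?a + sqrt 10 / 5 * ?y" using rel y \<open>1 \<le> ?y\<close> by linarith
      then have "3 \<le> outer_bound" unfolding outer_bound_eq by linarith
      then have "real_of_int 3 * 1 \<le> outer_bound * (1 + ?a)"
        using calls_pos by (intro mult_mono) auto
      then show ?thesis using 2 \<open>P = 0\<close> by simp
    qed
  qed
qed

text \<open>Both call numbers are multiples of at most
  \<open>\<Delta> \<alpha> / \<epsilon>^2 \<le> \<tau>^4\<close>, so the inverse failure probability
  is polynomial in \<open>\<tau>\<close>. The 15 is the exponent 10 of \<open>\<tau>\<close> plus 5,
  because \<open>18 * 13 = 234 \<le> 3^5\<close>.\<close>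

lemma ln_failure_bound:
  assumes "\<alpha> < L1"
  shows "ln (real d / (\<delta> / outer_bound / (1 + ncd_calls))) \<le> 15 * ln \<tau>"
proof -
  have \<tau>1: "1 \<le> \<tau> ^ 4" using \<tau>_ge(6) by (simp add: one_le_power)
  have ratio: "\<Delta> * \<alpha> / \<epsilon>\<^sup>2 \<le> \<tau> ^ 4"
  proof -
    have "\<Delta> * \<alpha> / \<epsilon>\<^sup>2 \<le> L1 * \<Delta> / \<epsilon>\<^sup>2"
      using \<alpha>_le pos by (intro divide_right_mono) auto
    then show ?thesis using gap_ratio_le by linarith
  qed
  have sq: "\<epsilon> * L2 \<le> \<alpha>\<^sup>2" by (rule \<alpha>_le_square[OF assms])
  have "ncd_calls \<le> 12 * (\<Delta> * \<alpha> / \<epsilon>\<^sup>2)"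
  proof -
    have "(\<epsilon> * L2)\<^sup>2 \<le> (\<alpha>\<^sup>2)\<^sup>2" using sq pos by (intro power_mono) auto
    then have "\<Delta> * (L2\<^sup>2 * \<epsilon>\<^sup>2) \<le> \<Delta> * \<alpha> ^ 4"
      using pos by (intro mult_left_mono) (auto simp: power_mult_distrib mult.commute)
    then show ?thesis using pos \<alpha>_pos
      by (simp add: ncd_calls_def field_simps power4_eq_xxxx power3_eq_cube)
  qed
  then have a: "ncd_calls \<le> 12 * \<tau> ^ 4" using ratio by linarith
  have "acagd_calls \<le> 5 * (\<Delta> * \<alpha> / \<epsilon>\<^sup>2)"
    using mult_left_mono[OF sq, of "\<Delta>"] pos \<alpha>_pos
    by (simp add: acagd_calls_def field_simps power2_eq_square)
  then have y: "acagd_calls \<le> 5 * \<tau> ^ 4" using ratio by linarith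
  have "sqrt 10 \<le> 4" by (rule real_le_lsqrt) auto
  then have "sqrt 10 / 5 * acagd_calls \<le> 4 / 5 * (5 * \<tau> ^ 4)"
    using y calls_pos by (intro mult_mono) auto
  then have "real_of_int outer_bound \<le> 18 * \<tau> ^ 4"
    unfolding outer_bound_eq using a \<tau>1 by linarith
  moreover have "1 + ncd_calls \<le> 13 * \<tau> ^ 4" using a \<tau>1 by linarith
  ultimately have "real d * (1 / \<delta>) * outer_bound * (1 + ncd_calls) \<le> \<tau> * \<tau> * (18 * \<tau> ^ 4) * (13 * \<tau> ^ 4)"
    using \<tau>_ge outer_bound_ge calls_pos pos by (intro mult_mono mult_nonneg_nonneg) auto
  also have "\<dots> = 234 * \<tau> ^ 10" by (simp flip: power_add power_Suc add: power_Suc2[symmetric])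
  also have "\<dots> \<le> 3 ^ 5 * \<tau> ^ 10" using \<tau>_ge(6) by (intro mult_right_mono) auto
  finally have "real d / (\<delta> / outer_bound / (1 + ncd_calls)) \<le> 3 ^ 5 * \<tau> ^ 10" by simp
  moreover have "0 < real d / (\<delta> / outer_bound / (1 + ncd_calls))"
    using d pos outer_bound_ge calls_pos by simp
  ultimately have "ln (real d / (\<delta> / outer_bound / (1 + ncd_calls))) \<le> real (5 + 10) * ln \<tau>"
    by (intro ln_le_power)
  then show ?thesis by simp
qed

end

text \<open>If \<open>\<alpha> = L1\<close> the run is deterministic. Otherwise \<open>m\<close> eigenvector calls fit into the budget
  \<open>m * \<delta>' \<le> \<delta>\<close> of the union bound, and by \<open>call_count\<close> no run makes more than \<open>m\<close> of them.\<close>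

lemma ancm_guarantee:
  fixes c T :: real and R :: costs and E :: eig_routine
  assumes hyps: "0 < c" "1 \<le> d" "function_on_Rn d f" "x1 \<in> Rn d" "0 < L1" "0 < L2"
    "smooth L1 f" "lipschitz_hessian L2 f" "0 < \<Delta>" "bdd_below (range f)" "f x1 - (INF x. f x) \<le> \<Delta>"
    "0 < \<epsilon>" "0 < \<delta>" "\<delta> < 1" "0 < T"
    and \<alpha>: "\<alpha> = min L1 (max (\<epsilon>\<^sup>2 / \<Delta>) (\<epsilon> powr (1/2) * L2 powr (1/2)))"
    and \<tau>: "\<tau> = 1 + 1 / \<epsilon> + 1 / \<delta> + real d + L1 + L2 + \<Delta>"
    and R: "costs_bounded (c * T) R" and E: "eigenvector_subroutine (c * T) d L1 f E"
  shows "\<exists>A \<in> sets (Pi\<^sub>M UNIV (\<lambda>_::nat. seed_law E)).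
         measure (Pi\<^sub>M UNIV (\<lambda>_::nat. seed_law E)) A \<ge> 1 - \<delta> \<and>
         (\<forall>\<omega>\<in>A. \<exists>x t.
            ancm R E \<omega> x1 f \<epsilon> L1 L2 \<alpha> \<Delta> \<delta> = Some (x, t) \<and>
            norm (grad f x) \<le> \<epsilon> \<and>
            lambda_min d (hess f x) \<ge> - 2 * \<epsilon> powr (1/2) * L2 powr (1/2) \<and>
            t \<le> 2880000 * c * (T * (\<Delta> * L1 powr (1/2) * L2 powr (1/4) * \<epsilon> powr (-7/4)
                          + \<Delta> powr (1/2) * L1 powr (1/2) * \<epsilon> powr (-1) + 1) * ln \<tau>))"
proof -
  interpret par: parameters d L1 L2 \<Delta> \<epsilon> \<delta> \<alpha> \<tau>
    by unfold_locales (fact hyps \<alpha> \<tau>)+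
  obtain J :: nat where J: "8 * ((5 * L1 + 2 * (3 * \<alpha>)) / (3 * \<alpha>)) * (5 * L1) * \<Delta>
        * (1 - 1 / sqrt ((5 * L1 + 2 * (3 * \<alpha>)) / (3 * \<alpha>))) ^ J
      \<le> (prox_accuracy (\<epsilon> / 2) (3 * \<alpha>) (5 * L1))\<^sup>2"
    and J_le: "real J \<le> 47 * (sqrt (L1 / \<alpha>) * ln \<tau>)"
    by (rule par.agd_iterations)
  have "0 < 27 / 1600 * \<epsilon>\<^sup>2 / \<alpha>" using hyps par.\<alpha>_pos by simp
  from reals_Archimedean3[OF this] obtain N :: nat where N: "\<Delta> < real N * (27 / 1600 * \<epsilon>\<^sup>2 / \<alpha>)" by blast
  define fmin where "fmin = (INF x. f x)"
  have fmin: "fmin \<le> f x" for x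
    unfolding fmin_def by (rule cINF_lower) (use hyps in auto)
  interpret ap: ancm_problem d f x1 L1 L2 \<Delta> \<epsilon> \<alpha> fmin J N
    using hyps J N fmin par.\<alpha>_pos par.\<alpha>_le by unfold_locales (auto simp: fmin_def)
  define B where "B = c * T"
  define X where "X = sqrt (L1 / \<alpha>) * ln \<tau>"
  \<comment> \<open>One unit pays for an AGD call, at most \<open>47 X\<close> iterations of cost
    \<open>40 B\<close> plus \<open>47 B\<close>, and likewise for an eigenvector call with its NCD
    step, at most \<open>31 B X + 14 B\<close>.\<close>
  define W where "W = 2000 * B * X"
  define K where "K = par.outer_bound"
  have B: "0 < B" using hyps by (simp add: B_def)
  have costs: "0 \<le> t_grad R" "t_grad R \<le> B" "0 \<le> t_hvp R" "t_hvp R \<le> B" "0 \<le> t_arith R" "t_arith R \<le> B"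
    using R by (auto simp: costs_bounded_def B_def)
  have ln\<tau>: "1 \<le> ln \<tau>" by (rule par.ln_\<tau>_ge)
  have X: "1 \<le> X" unfolding X_def using mult_mono[OF par.ratio_ge(2) ln\<tau>] par.ratio_ge(2) by simp
  have BX: "B \<le> B * X" using X B by simp
  have W_acagd: "real J * (2 * t_grad R + 38 * t_arith R) + 2 * t_grad R + 45 * t_arith R \<le> W"
  proof -
    have "real J * (2 * t_grad R + 38 * t_arith R) \<le> (47 * X) * (40 * B)"
      using J_le X costs unfolding X_def[symmetric] by (intro mult_mono) auto
    also have "\<dots> = 1880 * (B * X)" by simp
    finally show ?thesis using costs BX by (simp add: W_def)
  qed
  have W0: "0 \<le> W" using B X by (simp add: W_def)
  have gap: "f x1 - fmin \<le> \<Delta>" using hyps by (simp add: fmin_def)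
  \<comment> \<open>The constant is \<open>2000 * 720 * 2\<close>: 2000 from \<open>W\<close>, 720
    from \<open>12 * 1600/27\<close> rounded up, which also absorbs the fixed costs, and 2 from
    \<open>time_bound\<close>.\<close>
  have total: "t \<le> 2880000 * c * (T * (\<Delta> * L1 powr (1/2) * L2 powr (1/4) * \<epsilon> powr (-7/4)
                          + \<Delta> powr (1/2) * L1 powr (1/2) * \<epsilon> powr (-1) + 1) * ln \<tau>)"
    if t: "t \<le> 20 * t_arith R + W * (10 + 12 * ((f x1 - fmin) / ap.dec_unit))" for t
  proof -
    define r where "r = \<Delta> * \<alpha> / \<epsilon>\<^sup>2"
    have r: "0 \<le> r" using hyps par.\<alpha>_pos by (simp add: r_def)
    have "(f x1 - fmin) / ap.dec_unit \<le> \<Delta> / ap.dec_unit"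
      using gap ap.dec_unit_pos by (intro divide_right_mono) auto
    also have "\<dots> = 1600 / 27 * r"
      using hyps par.\<alpha>_pos by (simp add: ap.dec_unit_def r_def field_simps)
    finally have "10 + 12 * ((f x1 - fmin) / ap.dec_unit) \<le> 710 + 720 * r" using r by linarith
    then have "W * (10 + 12 * ((f x1 - fmin) / ap.dec_unit)) \<le> W * (710 + 720 * r)"
      by (rule mult_left_mono[OF _ W0])
    moreover have "20 * t_arith R \<le> W * 10" unfolding W_def mult.assoc using costs BX B by linarith
    ultimately have "t \<le> W * (720 * (1 + r))" using t by (simp add: distrib_left)
    also have "\<dots> = 1440000 * B * ln \<tau> * (sqrt (L1 / \<alpha>) * (1 + r))" by (simp add: W_def X_def)
    also have "\<dots> \<le> 1440000 * B * ln \<tau> * (2 * (\<Delta> * L1 powr (1/2) * L2 powr (1/4) * \<epsilon> powr (-7/4)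
                          + \<Delta> powr (1/2) * L1 powr (1/2) * \<epsilon> powr (-1) + 1))"
      unfolding r_def using B ln\<tau> by (intro mult_left_mono par.time_bound) auto
    finally show ?thesis by (simp add: B_def mult_ac)
  qed
  have lam: "lambda_min d (hess f x) \<ge> - 2 * \<epsilon> powr (1/2) * L2 powr (1/2)"
    if "f x \<le> f x1" "- \<alpha> \<le> lambda_min d (hess f x)" for x
    using par.lambda_min_bound[OF that(2) ap.lambda_min_descent[OF that(1)]] by (simp add: mult.assoc)
  have ancm: "ancm R E \<omega> x1 f \<epsilon> L1 L2 \<alpha> \<Delta> \<delta> =
      ancm_loop R E \<omega> f \<epsilon> L1 L2 \<alpha> \<Delta> (\<delta> / K) x1 0 (20 * t_arith R)" for \<omega>
    by (simp add: ancm_def Let_def K_def par.outer_bound_def)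
  show ?thesis
  proof (cases "\<alpha> = L1")
    case True
    let ?S = "Pi\<^sub>M UNIV (\<lambda>_::nat. seed_law E)"
    have "prob_space (seed_law E)" using E by (simp add: eigenvector_subroutine_def)
    then have "prob_space ?S" by (intro prob_space_PiM)
    then have "measure ?S (space ?S) = 1" by (rule prob_space.prob_space)
    moreover have "\<exists>x t. ancm R E \<omega> x1 f \<epsilon> L1 L2 \<alpha> \<Delta> \<delta> = Some (x, t) \<and>
            norm (grad f x) \<le> \<epsilon> \<and>
            lambda_min d (hess f x) \<ge> - 2 * \<epsilon> powr (1/2) * L2 powr (1/2) \<and>
            t \<le> 2880000 * c * (T * (\<Delta> * L1 powr (1/2) * L2 powr (1/4) * \<epsilon> powr (-7/4)
                          + \<Delta> powr (1/2) * L1 powr (1/2) * \<epsilon> powr (-1) + 1) * ln \<tau>)" for \<omega>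
    proof -
      obtain x t where run: "ancm R E \<omega> x1 f \<epsilon> L1 L2 \<alpha> \<Delta> \<delta> = Some (x, t)"
        "norm (grad f x) \<le> \<epsilon>" "f x \<le> f x1" and t: "t \<le> 20 * t_arith R + W * (1 + 3 * (f x1 - fmin) / ap.dec_unit)"
        using ap.ancm_loop_deterministic[OF True costs(1,5) W_acagd order_refl] unfolding ancm by metis
      have "0 \<le> (f x1 - fmin) / ap.dec_unit" using fmin[of x1] ap.dec_unit_pos by simp
      then have "W * (1 + 3 * ((f x1 - fmin) / ap.dec_unit)) \<le> W * (10 + 12 * ((f x1 - fmin) / ap.dec_unit))"
        by (intro mult_left_mono[OF _ W0]) linarith
      then have "t \<le> 20 * t_arith R + W * (10 + 12 * ((f x1 - fmin) / ap.dec_unit))"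
        using t by (simp only: times_divide_eq_right[symmetric])
      then show ?thesis
        using run total lam[OF run(3)] ap.lambda_min_ge_L1[of x] True by blast
    qed
    ultimately show ?thesis using hyps by (intro bexI[of _ "space ?S"]) auto
  next
    case False
    then have less: "\<alpha> < L1" using par.\<alpha>_le by simp
    have K: "2 \<le> real_of_int K" using par.outer_bound_ge by (simp add: K_def)
    have calls: "1 + 12 * L2\<^sup>2 * \<Delta> / \<alpha> ^ 3 = 1 + par.ncd_calls" by (simp add: par.ncd_calls_def)
    have W_ncd: "B * (1 + ln (real d / (\<delta> / K / (1 + 12 * L2\<^sup>2 * \<Delta> / \<alpha> ^ 3))) * sqrt (L1 / (\<alpha> / 2)))
        + t_hvp R + t_grad R + 12 * t_arith R \<le> W"
    proof -
      have "sqrt (L1 / (\<alpha> / 2)) = sqrt 2 * sqrt (L1 / \<alpha>)"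
        by (simp add: real_sqrt_divide real_sqrt_mult mult.commute)
      also have "\<dots> \<le> 2 * sqrt (L1 / \<alpha>)"
        by (intro mult_right_mono real_le_lsqrt) (use hyps par.\<alpha>_pos in auto)
      finally have s: "sqrt (L1 / (\<alpha> / 2)) \<le> 2 * sqrt (L1 / \<alpha>)" .
      have "ln (real d / (\<delta> / K / (1 + par.ncd_calls))) * sqrt (L1 / (\<alpha> / 2)) \<le> (15 * ln \<tau>) * sqrt (L1 / (\<alpha> / 2))"
        unfolding K_def using hyps par.\<alpha>_pos by (intro mult_right_mono par.ln_failure_bound less) auto
      also have "\<dots> \<le> (15 * ln \<tau>) * (2 * sqrt (L1 / \<alpha>))" using s ln\<tau> by (intro mult_left_mono) auto
      finally have "ln (real d / (\<delta> / K / (1 + par.ncd_calls))) * sqrt (L1 / (\<alpha> / 2)) \<le> 30 * X"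
        by (simp add: X_def mult.commute)
      then have "B * (1 + ln (real d / (\<delta> / K / (1 + par.ncd_calls))) * sqrt (L1 / (\<alpha> / 2))) \<le> B * (1 + 30 * X)"
        using B by (intro mult_left_mono add_left_mono) auto
      then show ?thesis unfolding calls using costs BX by (simp add: W_def distrib_left)
    qed
    have \<delta>K: "0 < \<delta> / K" "\<delta> / K < 1" using hyps K by (auto simp: divide_less_eq)
    interpret ar: ancm_random d f x1 L1 L2 \<Delta> \<epsilon> \<alpha> fmin J N R E B "\<delta> / K" W
      using less par.\<alpha>_le_square[OF less] costs E B \<delta>K W_acagd W_ncd
      by unfold_locales (auto simp: B_def)
    define m where "m = nat \<lfloor>K * (1 + par.ncd_calls)\<rfloor>"
    let ?A = "{\<omega> \<in> space ar.seeds.S. \<forall>n<m. ar.good_seed (ar.call_point n \<omega>) (\<omega> n)}"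
    have m_le: "real m \<le> K * (1 + par.ncd_calls)"
      using K par.calls_pos by (simp add: m_def)
    have "real m * ar.\<delta>' \<le> \<delta>"
    proof -
      have "real m * ar.\<delta>' \<le> K * (1 + par.ncd_calls) * ar.\<delta>'"
        using m_le ar.\<delta>'(1) by (intro mult_right_mono) auto
      also have "\<dots> = \<delta>" using K par.calls_pos by (simp add: ar.\<delta>'_def calls)
      finally show ?thesis .
    qed
    then have prob: "1 - \<delta> \<le> measure ar.seeds.S ?A" using ar.good_event(2)[of m] by linarith
    have run: "\<exists>x t. ancm R E \<omega> x1 f \<epsilon> L1 L2 \<alpha> \<Delta> \<delta> = Some (x, t) \<and>
            norm (grad f x) \<le> \<epsilon> \<and>
            lambda_min d (hess f x) \<ge> - 2 * \<epsilon> powr (1/2) * L2 powr (1/2) \<and>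
            t \<le> 2880000 * c * (T * (\<Delta> * L1 powr (1/2) * L2 powr (1/4) * \<epsilon> powr (-7/4)
                          + \<Delta> powr (1/2) * L1 powr (1/2) * \<epsilon> powr (-1) + 1) * ln \<tau>)"
      if \<omega>: "\<omega> \<in> ?A" for \<omega>
    proof -
      have good: "ar.good_seed (ar.call_point n \<omega>) (\<omega> n)" if "n < m" for n using \<omega> that by simp
      have budget: "0 + 2 * P + Q + 2 \<le> m"
        if PQ: "real P * ar.ncd_unit + real Q * ar.acagd_unit \<le> f (ar.call_point 0 \<omega>) - fmin" for P Q :: nat
      proof -
        have "ar.ncd_unit = \<Delta> / par.ncd_calls" "ar.acagd_unit = \<Delta> / par.acagd_calls"
          using hyps par.\<alpha>_pos
          by (simp_all add: ar.ncd_unit_def ar.acagd_unit_def par.ncd_calls_def par.acagd_calls_def)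
        then have "\<Delta> * (real P / par.ncd_calls + real Q / par.acagd_calls) \<le> \<Delta> * 1"
          using PQ gap by (simp add: distrib_left mult.commute)
        then have "real P / par.ncd_calls + real Q / par.acagd_calls \<le> 1"
          using hyps by (simp only: mult_le_cancel_left_pos)
        then have "real (2 * P + Q + 2) \<le> K * (1 + par.ncd_calls)"
          unfolding K_def by (rule par.call_count[OF less])
        then show ?thesis unfolding m_def by linarith
      qed
      obtain x t where run: "ancm R E \<omega> x1 f \<epsilon> L1 L2 \<alpha> \<Delta> \<delta> = Some (x, t)"
        "norm (grad f x) \<le> \<epsilon>" "f x \<le> f x1" "- \<alpha> \<le> lambda_min d (hess f x)"
        and t: "t \<le> 20 * t_arith R + W * (5 * real 2 + 12 * ((f x1 - fmin) / ap.dec_unit))"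
        using ar.ancm_loop_run[where m = m and \<omega> = \<omega> and n = 0 and s = 2 and t = "20 * t_arith R", OF good] budget
        unfolding ancm by auto
      then show ?thesis using total[of t] lam[OF run(3,4)] by auto
    qed
    show ?thesis
      using ar.good_event(1)[of m] prob run by (intro bexI[of _ ?A]) blast+
  qed
qed

theorem theorem4p3:
  fixes c :: real
  assumes "0 < c"
  shows "\<exists>C::real.
    \<forall>(d::nat) (f :: rvec \<Rightarrow> real) (x1::rvec) (L1::real) (L2::real) (\<Delta>::real) (\<epsilon>::real) (\<delta>::real)
      (\<alpha>::real) (\<tau>::real) (T::real) (R::costs) (E::eig_routine).
      1 \<le> d \<and> function_on_Rn d f \<and> x1 \<in> Rn d \<and> 0 < L1 \<and> 0 < L2 \<and>
      smooth L1 f \<and> lipschitz_hessian L2 f \<and>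
      0 < \<Delta> \<and> bdd_below (range f) \<and> f x1 - (INF x. f x) \<le> \<Delta> \<and>
      0 < \<epsilon> \<and> 0 < \<delta> \<and> \<delta> < 1 \<and>
      \<alpha> = min L1 (max (\<epsilon>\<^sup>2 / \<Delta>) (\<epsilon> powr (1/2) * L2 powr (1/2))) \<and>
      \<tau> = 1 + 1 / \<epsilon> + 1 / \<delta> + real d + L1 + L2 + \<Delta> \<and>
      0 < T \<and> costs_bounded (c * T) R \<and> eigenvector_subroutine (c * T) d L1 f E
      \<longrightarrow>
      (\<exists>A \<in> sets (Pi\<^sub>M UNIV (\<lambda>_::nat. seed_law E)).
         measure (Pi\<^sub>M UNIV (\<lambda>_::nat. seed_law E)) A \<ge> 1 - \<delta> \<and>
         (\<forall>\<omega>\<in>A. \<exists>x t.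
            ancm R E \<omega> x1 f \<epsilon> L1 L2 \<alpha> \<Delta> \<delta> = Some (x, t) \<and>
            norm (grad f x) \<le> \<epsilon> \<and>
            lambda_min d (hess f x) \<ge> - 2 * \<epsilon> powr (1/2) * L2 powr (1/2) \<and>
            t \<le> C * (T * (\<Delta> * L1 powr (1/2) * L2 powr (1/4) * \<epsilon> powr (-7/4)
                          + \<Delta> powr (1/2) * L1 powr (1/2) * \<epsilon> powr (-1) + 1) * ln \<tau>)))"
  by (rule exI[of _ "2880000 * c"], intro allI impI, elim conjE)
    (rule ancm_guarantee[OF assms])

end
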